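(* For every integer $d\ge 2^{72}$, all zeros of $H_d(t)$ are real and negative.
   Context: $P_d=P_d(132,213)\subset\mathbb R^d$ is the convex hull of the points $(\pi_1,\ldots,\pi_d)$ over all permutations $\pi$ of $\{1,\ldots,d\}$ avoiding both patterns $132$ and $213$. The Ehrhart $h^*$-polynomial $H_d(t)$ is defined by $\sum_{m\ge0}|mP_d\cap\mathbb Z^d|t^m=H_d(t)/(1-t)^d$. *)

theory Defs
  imports
    "HOL-Analysis.Analysis"
    "HOL-Analysis.Finite_Function_Topology"
    "HOL-Combinatorics.Permutations"
    "HOL-Computational_Algebra.Polynomial_FPS"
begin

text \<open>
  Permutations of \<open>{1..d}\<close> are functions \<open>p\<close> with \<open>p permutes {1..d}\<close>; a pattern is given by
  its one-line notation, e.g. \<open>[1, 3, 2]\<close>. The increasing map \<open>i\<close> selects the positions of an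
  occurrence of the pattern.
\<close>

definition contains_pattern :: "nat \<Rightarrow> (nat \<Rightarrow> nat) \<Rightarrow> nat list \<Rightarrow> bool" where
  "contains_pattern d p s \<longleftrightarrow>
     (\<exists>i :: nat \<Rightarrow> nat. strict_mono_on {..<length s} i \<and> i ` {..<length s} \<subseteq> {1..d} \<and>
        (\<forall>a<length s. \<forall>b<length s. p (i a) < p (i b) \<longleftrightarrow> s ! a < s ! b))"

definition avoiding_perms :: "nat \<Rightarrow> nat list set \<Rightarrow> (nat \<Rightarrow> nat) set" where
  "avoiding_perms d S = {p. p permutes {1..d} \<and> (\<forall>s\<in>S. \<not> contains_pattern d p s)}"

text \<open>
  Since the dimension \<open>d\<close> is a variable, \<open>\<real>\<^sup>d\<close> is realised as the coordinate subspace of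
  vectors supported on \<open>{1..d}\<close> in the real vector space of finitely supported sequences;
  \<open>Poly_Mapping.single i 1\<close> is the \<open>i\<close>-th unit vector.
\<close>

type_synonym finvec = "(nat, real) poly_mapping"

definition perm_point :: "nat \<Rightarrow> (nat \<Rightarrow> nat) \<Rightarrow> finvec" where
  "perm_point d p = (\<Sum>i=1..d. Poly_Mapping.single i (real (p i)))"

lemma lookup_perm_point:
  "Poly_Mapping.lookup (perm_point d p) i = (if i \<in> {1..d} then real (p i) else 0)"
  by (simp add: perm_point_def lookup_sum lookup_single when_def)

definition pattern_polytope :: "nat \<Rightarrow> nat list set \<Rightarrow> finvec set" where
  "pattern_polytope d S = convex hull (perm_point d ` avoiding_perms d S)"

definition integer_lattice :: "nat \<Rightarrow> finvec set" where
  "integer_lattice d =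
     {x. Poly_Mapping.keys x \<subseteq> {1..d} \<and> (\<forall>i. Poly_Mapping.lookup x i \<in> \<int>)}"

definition ehrhart_series :: "nat \<Rightarrow> finvec set \<Rightarrow> real fps" where
  "ehrhart_series d P = Abs_fps (\<lambda>m. real (card (scaleR (real m) ` P \<inter> integer_lattice d)))"

definition P_132_213 :: "nat \<Rightarrow> finvec set" where
  "P_132_213 d = pattern_polytope d {[1, 3, 2], [2, 1, 3]}"

text \<open>
  The numerator is unique since \<open>(1 - fps_X) ^ d\<close> is a unit (see \<open>h_star_eqI\<close> below); that it
  is a polynomial at all is Ehrhart's theorem for a lattice polytope of dimension at most
  \<open>d - 1\<close>.
\<close>

definition h_star :: "nat \<Rightarrow> real poly" where
  "h_star d = (THE h. ehrhart_series d (P_132_213 d) = fps_of_poly h / (1 - fps_X) ^ d)"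

lemma h_star_eqI:
  assumes "ehrhart_series d (P_132_213 d) = fps_of_poly h / (1 - fps_X) ^ d"
  shows "h_star d = h"
  unfolding h_star_def
proof (rule the_equality)
  fix h' :: "real poly"
  assume "ehrhart_series d (P_132_213 d) = fps_of_poly h' / (1 - fps_X) ^ d"
  with assms have *: "fps_of_poly h' / (1 - fps_X) ^ d = fps_of_poly h / (1 - fps_X) ^ d"
    by simp
  have "is_unit ((1 - fps_X :: real fps) ^ d)"
    by (simp add: fps_is_unit_iff fps_power_zeroth)
  with * show "h' = h"
    by (metis dvd_div_mult_self fps_of_poly_eq_iff unit_imp_dvd)
qed (fact assms)

end

theory Submission
  imports Defs "HOL-Library.Multiset"
begin

text \<open>
  A lattice point of \<open>m P\<^sub>d\<close> is determined by the gaps between its partial sums and those of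
  \<open>m (d, \<dots>, 1)\<close>. These gaps turn the lattice points into closed excursions of length \<open>d\<close>; cutting
  at returns to \<open>0\<close> and the cyclic lemma give an exponential formula for their number, in
  which every piece contributes a binomial coefficient that splits into linear factors in \<open>m\<close>.

  Written in the basis \<open>m\<^sup>i (1 + m)\<^sup>d\<^sup>-\<^sup>1\<^sup>-\<^sup>i\<close> with coefficients \<open>c\<^sub>i\<close>, the Ehrhart polynomial has
  \<open>H\<^sub>d = \<Sum> c\<^sub>i A\<^sub>i\<close>, where \<open>A\<^sub>i\<close> is the numerator belonging to a single basis element and \<open>A\<^sub>0\<close> is the
  Eulerian polynomial. At a zero of \<open>A\<^sub>0\<close> the values of \<open>A\<^sub>1, \<dots>, A\<^sub>d\<^sub>-\<^sub>2\<close> have the same sign, which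
  alternates from zero to zero, and ratios of neighbours lie in \<open>[1/4, 4]\<close>. For large \<open>d\<close> the
  coefficients are dominated by the product for a single piece of length \<open>d\<close>, so that \<open>H\<^sub>d\<close>
  inherits these signs. Together with the signs at \<open>0\<close> and \<open>-\<infinity>\<close> they give \<open>d - 1\<close> negative zeros.
\<close>

section \<open>Excursions and bridges\<close>

text \<open>Only the list \<open>[d]\<close> gives a product of full degree \<open>d - 1\<close> in
  \<open>m\<close>. Every other list of pieces is filled up with factors \<open>1 - t\<close>
  (\<open>signed_poly\<close>), which bring in negative signs. So the coefficients
  \<open>magic d i\<close> are not controlled one by one; instead their whole sum against the values
  at an Eulerian zero is compared with its part from \<open>[d]\<close>. Single pieces dominate
  because the coefficients of \<open>S\<close> decay like \<open>n\<close> to the power -5/2: those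
  of \<open>exp S\<close> are then asymptotically \<open>exp (S 1)\<close> times those of
  \<open>S\<close>. The factor has to be explicit and below 8/3, since everything but the main part
  enters with weight 3/5. Here \<open>exp (S 1)\<close> is bounded by 491/200, and 51/20 is reached
  for the coefficient itself. The size \<open>2 ^ 72\<close> comes from this estimate alone: its
  errors are of order \<open>1 / d ^ 3\<close> against a main term
  \<open>cbin d / d\<^sup>2\<close>, and their constants are absorbed by
  \<open>cbin d * d \<ge> 2 ^ 35\<close>.\<close>

definition walk :: "int list \<Rightarrow> nat \<Rightarrow> int" where
  "walk s k = (\<Sum>i<k. s ! (i mod length s))"

definition excursions :: "nat \<Rightarrow> nat \<Rightarrow> int list set" where
  "excursions m n = {s. length s = n \<and> walk s n = 0 \<and> (\<forall>k\<le>n. 0 \<le> walk s k) \<and>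
     (\<forall>i. Suc i < n \<longrightarrow> s ! i - 2 * int m \<le> s ! Suc i)}"

text \<open>The step condition also relates the last step to the first, so rotations preserve it.
  \<open>walk\<close> reads its list cyclically for the same purpose: rotating becomes a shift of
  the argument.\<close>

definition bridges :: "nat \<Rightarrow> nat \<Rightarrow> int list set" where
  "bridges m n = {s. length s = n \<and> walk s n = 0 \<and>
     (\<forall>i. s ! (i mod n) - 2 * int m \<le> s ! (Suc i mod n))}"

lemma walk_0 [simp]: "walk s 0 = 0"
  by (simp add: walk_def)

lemma walk_Suc: "walk s (Suc k) = walk s k + s ! (k mod length s)"
  by (simp add: walk_def)

lemma walk_append_left:
  assumes "k \<le> length s"
  shows "walk (s @ t) k = walk s k"
  unfolding walk_def
proof (rule sum.cong)
  fix i assume "i \<in> {..<k}"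
  then have "i < length s" using assms by simp
  then show "(s @ t) ! (i mod length (s @ t)) = s ! (i mod length s)"
    by (simp add: nth_append)
qed simp

lemma walk_append_right:
  assumes "k \<le> length t"
  shows "walk (s @ t) (length s + k) = walk s (length s) + walk t k"
  using assms
proof (induction k)
  case 0
  then show ?case by (simp add: walk_append_left)
next
  case (Suc k)
  then show ?case by (simp add: walk_Suc nth_append)
qed

lemma walk_take:
  assumes "k \<le> n" "n \<le> length s"
  shows "walk (take n s) k = walk s k"
  using walk_append_left[of k "take n s" "drop n s"] assms by simp

lemma walk_drop:
  assumes "n + k \<le> length s"
  shows "walk (drop n s) k = walk s (n + k) - walk s n"
  using walk_append_right[of k "drop n s" "take n s"] assms by (simp add: walk_take)

lemma walk_rotate:
  assumes "s \<noteq> []"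
  shows "walk (rotate q s) k = walk s (q + k) - walk s q"
proof (induction k)
  case (Suc k)
  have "rotate q s ! (k mod length s) = s ! ((q + k) mod length s)"
    using assms by (subst nth_rotate) (auto simp: mod_add_right_eq)
  with Suc show ?case by (simp add: walk_Suc)
qed simp

lemma walk_add_length:
  assumes "walk s (length s) = 0"
  shows "walk s (length s + k) = walk s k"
proof (induction k)
  case (Suc k)
  then show ?case by (simp add: walk_Suc)
qed (use assms in simp)

text \<open>The wrap-around condition is automatic: nonnegativity makes the first step
  \<open>\<ge> 0\<close>, and the final return to 0 makes the last step
  \<open>\<le> 0\<close>.\<close>

lemma excursions_subset_bridges:
  assumes "0 < n"
  shows "excursions m n \<subseteq> bridges m n"
proof
  fix s assume s: "s \<in> excursions m n"
  then have len: "length s = n" and w: "walk s n = 0" "\<And>k. k \<le> n \<Longrightarrow> 0 \<le> walk s k"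
    and st: "\<And>i. Suc i < n \<Longrightarrow> s ! i - 2 * int m \<le> s ! Suc i"
    by (auto simp: excursions_def)
  have first: "s ! 0 \<ge> 0" using w(2)[of 1] assms by (simp add: walk_Suc)
  have last: "s ! (n - 1) \<le> 0"
    using w(1) w(2)[of "n - 1"] walk_Suc[of s "n - 1"] assms by (simp add: len)
  have "s ! (i mod n) - 2 * int m \<le> s ! (Suc i mod n)" for i
  proof (cases "Suc (i mod n) = n")
    case True
    then have "Suc i mod n = 0" "i mod n = n - 1" by (auto simp: mod_Suc)
    then show ?thesis using first last by simp
  next
    case False
    then have "Suc i mod n = Suc (i mod n)" "Suc (i mod n) < n"
      using assms by (auto simp: mod_Suc le_neq_implies_less Suc_leI)
    then show ?thesis using st[of "i mod n"] by simp
  qed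
  then show "s \<in> bridges m n" using len w by (auto simp: bridges_def)
qed

lemma rotate_bridge:
  assumes "s \<in> bridges m n" "0 < n"
  shows "rotate q s \<in> bridges m n"
proof -
  have len: "length s = n" and w: "walk s n = 0"
    and st: "\<And>i. s ! (i mod n) - 2 * int m \<le> s ! (Suc i mod n)"
    using assms by (auto simp: bridges_def)
  have ne: "s \<noteq> []" using len assms by auto
  have nth: "rotate q s ! (i mod n) = s ! ((q + i) mod n)" for i
    using assms len by (subst nth_rotate) (auto simp: mod_add_right_eq)
  have "walk (rotate q s) n = 0"
    using walk_add_length[of s q] w len by (simp add: walk_rotate[OF ne] add.commute)
  moreover have "rotate q s ! (i mod n) - 2 * int m \<le> rotate q s ! (Suc i mod n)" for i
    unfolding nth using st[of "q + i"] by simp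
  ultimately show ?thesis using len by (simp add: bridges_def)
qed

text \<open>The range starts at 1 and includes \<open>length s\<close>, where position 0 reappears:
  rotating by \<open>q\<close> puts the mark at \<open>n - q\<close>, which has to be a position
  below \<open>n\<close>.\<close>

definition first_min :: "int list \<Rightarrow> nat" where
  "first_min s = (LEAST q. 0 < q \<and> q \<le> length s \<and> (\<forall>k. walk s q \<le> walk s k))"

lemma first_min:
  assumes "walk s (length s) = 0" "s \<noteq> []"
  shows "0 < first_min s" "first_min s \<le> length s" "\<And>k. walk s (first_min s) \<le> walk s k"
proof -
  let ?n = "length s"
  have n: "?n > 0" using assms by simp
  let ?A = "walk s ` {1..?n}"
  have "Min ?A \<in> ?A" using n by (intro Min_in) (auto simp: Suc_le_eq)
  then obtain q where q: "0 < q" "q \<le> ?n" "walk s q = Min ?A" by (force simp: Suc_le_eq)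
  have "walk s q \<le> walk s k" for k
  proof -
    have "walk s (j * ?n + k) = walk s k" for j k
      by (induction j) (simp_all add: walk_add_length[OF assms(1)] add.assoc)
    from this[of "k div ?n" "k mod ?n"] have e: "walk s k = walk s (k mod ?n)" by simp
    show ?thesis
    proof (cases "k mod ?n = 0")
      case True
      then have "walk s k = walk s ?n" using e assms by simp
      moreover have "walk s ?n \<in> ?A" using n by (intro imageI) (simp add: Suc_le_eq)
      ultimately show ?thesis unfolding q(3) by (intro Min_le) auto
    next
      case False
      moreover have "k mod ?n < ?n" using n by simp
      ultimately have "walk s (k mod ?n) \<in> ?A" by (auto intro!: imageI)
      then show ?thesis unfolding e q(3) by simp
    qed
  qed
  with q have "\<exists>q. 0 < q \<and> q \<le> ?n \<and> (\<forall>k. walk s q \<le> walk s k)" by blast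
  from LeastI_ex[OF this] show "0 < first_min s" "first_min s \<le> ?n"
    "\<And>k. walk s (first_min s) \<le> walk s k" unfolding first_min_def by blast+
qed

lemma first_min_strict:
  assumes "walk s (length s) = 0" "s \<noteq> []" "0 < j" "j < first_min s"
  shows "walk s (first_min s) < walk s j"
proof (rule ccontr)
  assume "\<not> ?thesis"
  then have "0 < j \<and> j \<le> length s \<and> (\<forall>k. walk s j \<le> walk s k)"
    using first_min[OF assms(1,2)] assms(3,4) by (meson le_less_linear less_imp_le order_trans)
  from not_less_Least[OF assms(4)[unfolded first_min_def]] this show False by blast
qed

text \<open>Cyclic lemma: a marked excursion is cut at the first return to \<open>0\<close> after the mark, and the
  piece before the cut is rotated to start at the mark.\<close>

lemma card_marked_excursions:
  assumes fin: "\<And>n. finite (bridges m n)"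
  shows "d * card (excursions m d) = (\<Sum>n=1..d. card (bridges m n) * card (excursions m (d - n)))"
proof -
  let ?X = "SIGMA n : {1..d}. bridges m n \<times> excursions m (d - n)"
  let ?Y = "excursions m d \<times> {..<d}"
  define f where "f = (\<lambda>(n, \<beta>, \<epsilon>). (rotate (first_min \<beta>) \<beta> @ \<epsilon>, n - first_min \<beta>))"
  define N where "N e p = (LEAST n. p < n \<and> walk e n = 0)" for e p
  define g where "g = (\<lambda>(e, p). (N e p, rotate p (take (N e p) e), drop (N e p) e))"
  have fX: "f x \<in> ?Y \<and> g (f x) = x" if x: "x \<in> ?X" for x
  proof -
    obtain n \<beta> \<epsilon> where xe: "x = (n, \<beta>, \<epsilon>)" and n: "0 < n" "n \<le> d" and b: "\<beta> \<in> bridges m n"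
      and e: "\<epsilon> \<in> excursions m (d - n)" using x by auto
    define q where "q = first_min \<beta>"
    define \<rho> where "\<rho> = rotate q \<beta>"
    have lb: "length \<beta> = n" and wb: "walk \<beta> n = 0" using b by (auto simp: bridges_def)
    have ne: "\<beta> \<noteq> []" using lb n by auto
    note fm = first_min[OF wb[folded lb] ne, folded q_def]
    have q: "0 < q" "q \<le> n" using fm lb by auto
    have rb: "\<rho> \<in> bridges m n" unfolding \<rho>_def by (rule rotate_bridge[OF b n(1)])
    have lr: "length \<rho> = n" using lb by (simp add: \<rho>_def)
    have wr: "walk \<rho> k = walk \<beta> (q + k) - walk \<beta> q" for k
      unfolding \<rho>_def by (rule walk_rotate[OF ne])
    have wr0: "walk \<rho> k \<ge> 0" for k using fm(3) by (simp add: wr)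
    have wrn: "walk \<rho> n = 0" using rb by (simp add: bridges_def)
    have le: "length \<epsilon> = d - n" and we: "walk \<epsilon> (d - n) = 0" "\<And>k. k \<le> d - n \<Longrightarrow> 0 \<le> walk \<epsilon> k"
      and se: "\<And>i. Suc i < d - n \<Longrightarrow> \<epsilon> ! i - 2 * int m \<le> \<epsilon> ! Suc i"
      using e by (auto simp: excursions_def)
    have w1: "walk (\<rho> @ \<epsilon>) k = walk \<rho> k" if "k \<le> n" for k
      using walk_append_left[of k \<rho> \<epsilon>] that lr by simp
    have w2: "walk (\<rho> @ \<epsilon>) (n + k) = walk \<epsilon> k" if "k \<le> d - n" for k
      using walk_append_right[of k \<epsilon> \<rho>] that lr le wrn by simp
    have exc: "\<rho> @ \<epsilon> \<in> excursions m d"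
      unfolding excursions_def
    proof (intro CollectI conjI allI impI)
      show "length (\<rho> @ \<epsilon>) = d" using lr le n by simp
      show "walk (\<rho> @ \<epsilon>) d = 0" using w2[of "d - n"] we n by simp
    next
      fix k assume "k \<le> d"
      then show "0 \<le> walk (\<rho> @ \<epsilon>) k"
        using w1[of k] w2[of "k - n"] wr0[of k] we(2)[of "k - n"] by (cases "k \<le> n") auto
    next
      fix i assume i: "Suc i < d"
      consider "Suc i < n" | "Suc i = n" | "n \<le> i" by linarith
      then show "(\<rho> @ \<epsilon>) ! i - 2 * int m \<le> (\<rho> @ \<epsilon>) ! Suc i"
      proof cases
        case 1
        have "\<rho> ! (i mod n) - 2 * int m \<le> \<rho> ! (Suc i mod n)" using rb by (simp add: bridges_def)
        then show ?thesis using 1 lr by (simp add: nth_append)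
      next
        case 2
        \<comment> \<open>The seam satisfies the step condition by itself: the rotated bridge ends
          with a step \<open>\<le> 0\<close>, the excursion starts with one
          \<open>\<ge> 0\<close>.\<close>
        have "\<rho> ! i \<le> 0" using walk_Suc[of \<rho> i] wr0[of i] wrn 2 lr by simp
        moreover have "\<epsilon> ! 0 \<ge> 0" using we(2)[of 1] i 2 by (simp add: walk_Suc)
        ultimately show ?thesis using 2 lr by (simp add: nth_append)
      next
        case 3
        then show ?thesis using se[of "i - n"] i lr by (simp add: nth_append Suc_diff_le)
      qed
    qed
    \<comment> \<open>A zero strictly between the mark and \<open>n\<close> would be a minimum of
      \<open>\<beta>\<close> at the smaller index \<open>q + k - n\<close>, against the choice of
      \<open>q\<close>.\<close>
    have NN: "N (\<rho> @ \<epsilon>) (n - q) = n"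
      unfolding N_def
    proof (rule Least_equality)
      show "n - q < n \<and> walk (\<rho> @ \<epsilon>) n = 0" using q n w1[of n] wrn by simp
    next
      fix k assume k: "n - q < k \<and> walk (\<rho> @ \<epsilon>) k = 0"
      show "n \<le> k"
      proof (rule ccontr)
        assume "\<not> n \<le> k"
        then have kn: "k < n" by simp
        define j where "j = q + k - n"
        have j: "0 < j" "j < q" "q + k = n + j" using k kn q by (auto simp: j_def)
        have "walk \<beta> (q + k) = walk \<beta> j"
          unfolding j(3) using walk_add_length[of \<beta> j] wb lb by simp
        then have "walk \<rho> k > 0"
          using first_min_strict[OF wb[folded lb] ne j(1) j(2)[unfolded q_def]] by (simp add: wr q_def)
        then show False using k kn w1[of k] by simp
      qed
    qed
    have "rotate (n - q) \<rho> = \<beta>"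
      unfolding \<rho>_def rotate_rotate by (rule rotate_id) (use q lb in simp)
    then have "g (f x) = x"
      using NN lr by (simp add: g_def f_def xe q_def[symmetric] \<rho>_def[symmetric])
    moreover have "f x \<in> ?Y"
      using exc q n by (simp add: f_def xe q_def[symmetric] \<rho>_def[symmetric])
    ultimately show ?thesis by blast
  qed
  have gY: "g y \<in> ?X \<and> f (g y) = y" if y: "y \<in> ?Y" for y
  proof -
    obtain e p where ye: "y = (e, p)" and e: "e \<in> excursions m d" and p: "p < d" using y by auto
    have le: "length e = d" and we: "walk e d = 0" "\<And>k. k \<le> d \<Longrightarrow> 0 \<le> walk e k"
      and se: "\<And>i. Suc i < d \<Longrightarrow> e ! i - 2 * int m \<le> e ! Suc i"
      using e by (auto simp: excursions_def)
    define n where "n = N e p"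
    have n1: "p < n \<and> walk e n = 0" unfolding n_def N_def by (rule LeastI[of _ d]) (use p we in auto)
    have nd: "n \<le> d" unfolding n_def N_def by (rule Least_le) (use p we in auto)
    have nmin: "walk e k > 0" if "p < k" "k < n" for k
      using not_less_Least[OF that(2)[unfolded n_def N_def]] that nd we(2)[of k] by auto
    define \<sigma> where "\<sigma> = take n e"
    have ls: "length \<sigma> = n" using nd le by (simp add: \<sigma>_def)
    have ws: "walk \<sigma> k = walk e k" if "k \<le> n" for k
      using walk_take[of k n e] that nd le by (simp add: \<sigma>_def)
    have sexc: "\<sigma> \<in> excursions m n"
      unfolding excursions_def using ls ws n1 we nd se by (auto simp: \<sigma>_def)
    have npos: "0 < n" using n1 by simp
    have sb: "\<sigma> \<in> bridges m n" using excursions_subset_bridges[OF npos] sexc by blast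
    define \<beta> where "\<beta> = rotate p \<sigma>"
    have bb: "\<beta> \<in> bridges m n" unfolding \<beta>_def by (rule rotate_bridge[OF sb npos])
    have lb: "length \<beta> = n" using ls by (simp add: \<beta>_def)
    have ne: "\<sigma> \<noteq> []" using ls npos by auto
    have wb: "walk \<beta> k = walk \<sigma> (p + k) - walk \<sigma> p" for k
      unfolding \<beta>_def by (rule walk_rotate[OF ne])
    have wsn: "walk \<sigma> (length \<sigma>) = 0" using sb ls by (simp add: bridges_def)
    have ws0: "walk \<sigma> k \<ge> 0" for k
    proof -
      have "walk \<sigma> (j * n + k) = walk \<sigma> k" for j k
        using walk_add_length[OF wsn] by (induction j) (simp_all add: add.assoc ls)
      from this[of "k div n" "k mod n"] have "walk \<sigma> k = walk \<sigma> (k mod n)" by simp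
      moreover have "k mod n \<le> n" using npos by (simp add: less_imp_le)
      ultimately show ?thesis using ws[of "k mod n"] we(2)[of "k mod n"] nd by simp
    qed
    \<comment> \<open>The walk is positive strictly between the mark and its next zero, so that zero
      becomes the first minimum after rotation.\<close>
    have q: "first_min \<beta> = n - p"
      unfolding first_min_def
    proof (rule Least_equality)
      have "walk \<sigma> (p + (n - p)) = 0" using n1 wsn ls by simp
      then show "0 < n - p \<and> n - p \<le> length \<beta> \<and> (\<forall>k. walk \<beta> (n - p) \<le> walk \<beta> k)"
        using n1 lb ws0 by (simp add: wb)
    next
      fix j assume j: "0 < j \<and> j \<le> length \<beta> \<and> (\<forall>k. walk \<beta> j \<le> walk \<beta> k)"
      show "n - p \<le> j"
      proof (rule ccontr)
        assume "\<not> n - p \<le> j"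
        then have jn: "p + j < n" by simp
        have "walk \<sigma> (p + (n - p)) = 0" using n1 wsn ls by simp
        moreover have "walk \<sigma> (p + j) > 0" using nmin[of "p + j"] jn j ws[of "p + j"] by simp
        ultimately have "walk \<beta> j > walk \<beta> (n - p)" by (simp add: wb)
        then show False using j by (metis leD)
      qed
    qed
    have undo: "rotate (n - p) \<beta> = \<sigma>"
      unfolding \<beta>_def rotate_rotate by (rule rotate_id) (use n1 ls in simp)
    have dexc: "drop n e \<in> excursions m (d - n)"
      unfolding excursions_def
    proof (intro CollectI conjI allI impI)
      show "length (drop n e) = d - n" using le by simp
      show "walk (drop n e) (d - n) = 0" using walk_drop[of n "d - n" e] nd le we n1 by simp
      show "0 \<le> walk (drop n e) k" if "k \<le> d - n" for k
        using walk_drop[of n k e] that nd le we(2)[of "n + k"] n1 by simp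
      show "drop n e ! i - 2 * int m \<le> drop n e ! Suc i" if "Suc i < d - n" for i
        using se[of "n + i"] that le nd by simp
    qed
    have gy: "g y = (n, \<beta>, drop n e)"
      by (simp add: g_def ye n_def[symmetric] \<sigma>_def[symmetric] \<beta>_def[symmetric])
    have "f (g y) = y" unfolding gy using n1 by (simp add: f_def q undo ye \<sigma>_def)
    then show ?thesis using gy bb dexc npos nd by simp
  qed
  have "bij_betw f ?X ?Y"
    by (rule bij_betw_byWitness[where f' = g]) (use fX gY in blast)+
  then have "card ?X = card ?Y" by (rule bij_betw_same_card)
  moreover have finE: "finite (excursions m n)" for n
  proof (cases "n = 0")
    case True
    then have "excursions m n \<subseteq> {[]}" by (auto simp: excursions_def)
    then show ?thesis by (rule finite_subset) simp
  next
    case False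
    then show ?thesis using finite_subset[OF excursions_subset_bridges fin] by simp
  qed
  moreover have "card ?X = (\<Sum>n=1..d. card (bridges m n \<times> excursions m (d - n)))"
    by (rule card_SigmaI) (simp_all add: fin finE)
  ultimately show ?thesis by (simp add: card_cartesian_product mult.commute)
qed

section \<open>Counting bridges with roots of unity\<close>

definition compositions :: "nat \<Rightarrow> nat \<Rightarrow> nat list set" where
  "compositions N n = {c. length c = n \<and> sum_list c = N}"

lemma compositions_0: "compositions N 0 = (if N = 0 then {[]} else {})"
  by (auto simp: compositions_def)

lemma compositions_Suc: "compositions N (Suc n) = (\<Union>a\<le>N. (#) a ` compositions (N - a) n)"
proof (intro equalityI subsetI)
  fix c assume "c \<in> compositions N (Suc n)"
  then obtain a c' where "c = a # c'" "length c' = n" "a + sum_list c' = N"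
    by (auto simp: compositions_def length_Suc_conv)
  then show "c \<in> (\<Union>a\<le>N. (#) a ` compositions (N - a) n)"
    by (auto simp: compositions_def intro!: bexI[of _ a])
qed (auto simp: compositions_def)

lemma finite_compositions [simp]: "finite (compositions N n)"
  by (induction n arbitrary: N) (simp_all add: compositions_0 compositions_Suc)

lemma sum_compositions_Suc:
  fixes f :: "nat list \<Rightarrow> 'a :: comm_monoid_add"
  shows "sum f (compositions N (Suc n)) = (\<Sum>a\<le>N. \<Sum>c\<in>compositions (N - a) n. f (a # c))"
proof -
  have "sum f (compositions N (Suc n)) = (\<Sum>a\<le>N. sum f ((#) a ` compositions (N - a) n))"
    unfolding compositions_Suc by (rule sum.UNION_disjoint) auto
  also have "\<dots> = (\<Sum>a\<le>N. \<Sum>c\<in>compositions (N - a) n. f (a # c))"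
    by (rule sum.cong[OF refl], subst sum.reindex) auto
  finally show ?thesis .
qed

text \<open>Both sides are the complete homogeneous symmetric polynomial of degree \<open>N\<close>
  in \<open>x 0, ..., x (n - 1)\<close>.\<close>

lemma sum_compositions_powers:
  fixes x :: "nat \<Rightarrow> 'a :: comm_ring_1"
  shows "(\<Sum>c\<in>compositions N n. \<Prod>i<n. x i ^ (c ! i)) = fps_nth (\<Prod>i<n. Abs_fps (\<lambda>k. x i ^ k)) N"
proof (induction n arbitrary: N x)
  case 0
  show ?case by (simp add: compositions_0)
next
  case (Suc n)
  have "(\<Sum>c\<in>compositions N (Suc n). \<Prod>i<Suc n. x i ^ (c ! i))
      = (\<Sum>a\<le>N. x 0 ^ a * (\<Sum>c\<in>compositions (N - a) n. \<Prod>i<n. x (Suc i) ^ (c ! i)))"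
    by (simp add: sum_compositions_Suc prod.lessThan_Suc_shift sum_distrib_left del: prod.lessThan_Suc)
  also have "\<dots> = (\<Sum>a\<le>N. x 0 ^ a * fps_nth (\<Prod>i<n. Abs_fps (\<lambda>k. x (Suc i) ^ k)) (N - a))"
    using Suc[of "\<lambda>i. x (Suc i)"] by simp
  finally show ?case
    by (simp add: prod.lessThan_Suc_shift fps_mult_nth atLeast0AtMost del: prod.lessThan_Suc)
qed

section \<open>Bridges encoded by their cyclic increments\<close>

text \<open>Increments fix the steps up to a common constant. By Abel summation the constant that
  makes the steps sum to 0 is an integer exactly if \<open>n\<close> divides
  \<open>\<Sum>i<n. i * c ! i\<close>; the shift by \<open>2 * m\<close> changes this sum by
  \<open>m * n * (n - 1)\<close>, a multiple of \<open>n\<close>.\<close>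

definition bridge_codes :: "nat \<Rightarrow> nat \<Rightarrow> nat list set" where
  "bridge_codes m n = {c \<in> compositions (2 * m * n) n. n dvd (\<Sum>i<n. i * c ! i)}"

definition increments :: "nat \<Rightarrow> int list \<Rightarrow> nat list" where
  "increments m s = map (\<lambda>i. nat (s ! (Suc i mod length s) - s ! i + 2 * int m)) [0..<length s]"

lemma sum_list_eq_sum_nth: "sum_list c = (\<Sum>i<length c. c ! i)"
  by (simp add: sum_list_sum_nth atLeast0LessThan)

lemma walk_length: "walk s (length s) = (\<Sum>i<length s. s ! i)"
  by (simp add: walk_def)

lemma increments_bridge:
  assumes s: "s \<in> bridges m n" and n: "0 < n"
  shows "increments m s \<in> bridge_codes m n"
    and "\<And>i. i < n \<Longrightarrow> int (increments m s ! i) = s ! (Suc i mod n) - s ! i + 2 * int m"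
proof -
  have len: "length s = n" and w: "walk s n = 0"
    and st: "\<And>i. s ! (i mod n) - 2 * int m \<le> s ! (Suc i mod n)"
    using s by (auto simp: bridges_def)
  show nth: "int (increments m s ! i) = s ! (Suc i mod n) - s ! i + 2 * int m" if "i < n" for i
    using that st[of i] by (simp add: increments_def len)
  define p where "p i = s ! (i mod n)" for i
  have nth': "int (increments m s ! i) = p (Suc i) - p i + 2 * int m" if "i < n" for i
    using nth[OF that] that by (simp add: p_def)
  have li: "length (increments m s) = n" by (simp add: increments_def len)
  have pn: "p n = p 0" by (simp add: p_def)
  have sp: "(\<Sum>i<n. p i) = 0" using w by (simp add: walk_def len p_def)
  have tel: "(\<Sum>i<n. p (Suc i) - p i) = p n - p 0" by (rule sum_lessThan_telescope)
  have "int (\<Sum>i<n. increments m s ! i) = (\<Sum>i<n. (p (Suc i) - p i) + 2 * int m)"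
    unfolding of_nat_sum by (rule sum.cong) (simp_all add: nth')
  also have "\<dots> = int (2 * m * n)" unfolding sum.distrib tel pn by simp
  finally have tot: "sum_list (increments m s) = 2 * m * n"
    unfolding sum_list_eq_sum_nth li by (simp only: of_nat_eq_iff)
  have "(\<Sum>i<n. int i * (p (Suc i) - p i)) = (\<Sum>i<n. (int (Suc i) * p (Suc i) - int i * p i) - p (Suc i))"
    by (rule sum.cong) (auto simp: algebra_simps)
  also have "\<dots> = (\<Sum>i<n. int (Suc i) * p (Suc i) - int i * p i) - (\<Sum>i<n. p (Suc i))"
    by (rule sum_subtractf)
  also have "(\<Sum>i<n. int (Suc i) * p (Suc i) - int i * p i) = int n * p n - int 0 * p 0"
    by (rule sum_lessThan_telescope)
  also have "(\<Sum>i<n. p (Suc i)) = 0"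
    using tel sp pn by (simp add: sum_subtractf)
  finally have S1: "(\<Sum>i<n. int i * (p (Suc i) - p i)) = int n * p n" by simp
  have S2: "2 * (\<Sum>i<n. int i) = int n * (int n - 1)"
    by (induction n) (simp_all add: algebra_simps)
  have "int (\<Sum>i<n. i * increments m s ! i) = (\<Sum>i<n. int i * (p (Suc i) - p i) + int m * (2 * int i))"
    unfolding of_nat_sum by (rule sum.cong) (auto simp: nth' algebra_simps)
  also have "\<dots> = int n * p n + int m * (2 * (\<Sum>i<n. int i))"
    unfolding sum.distrib S1 by (simp add: sum_distrib_left)
  also have "\<dots> = int n * (p n + int m * (int n - 1))"
    unfolding S2 by (simp add: algebra_simps)
  finally have "int n dvd int (\<Sum>i<n. i * increments m s ! i)" by simp
  then have "n dvd (\<Sum>i<n. i * increments m s ! i)" by (simp only: of_nat_dvd_iff)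
  then show "increments m s \<in> bridge_codes m n"
    using li tot by (simp add: bridge_codes_def compositions_def)
qed

lemma inj_on_increments:
  assumes n: "0 < n"
  shows "inj_on (increments m) (bridges m n)"
proof (rule inj_onI)
  fix s s' assume s: "s \<in> bridges m n" and s': "s' \<in> bridges m n"
    and eq: "increments m s = increments m s'"
  have len: "length s = n" "length s' = n" and w: "walk s n = 0" "walk s' n = 0"
    using s s' by (auto simp: bridges_def)
  have st: "s ! Suc i - s ! i = s' ! Suc i - s' ! i" if "Suc i < n" for i
    using increments_bridge(2)[OF s n, of i] increments_bridge(2)[OF s' n, of i] eq that by simp
  have d: "s ! i - s' ! i = s ! 0 - s' ! 0" if "i < n" for i
    using that
  proof (induction i)
    case (Suc i)
    then show ?case using st[of i] by simp
  qed simp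
  have "(\<Sum>i<n. s ! i - s' ! i) = (\<Sum>i<n. s ! i) - (\<Sum>i<n. s' ! i)" by (rule sum_subtractf)
  also have "(\<Sum>i<n. s ! i) = 0" using walk_length[of s] unfolding len w by (rule sym)
  also have "(\<Sum>i<n. s' ! i) = 0" using walk_length[of s'] unfolding len w by (rule sym)
  finally have "(\<Sum>i<n. s ! i - s' ! i) = 0" by (rule trans) (rule diff_self)
  moreover have "(\<Sum>i<n. s ! i - s' ! i) = (\<Sum>i<n. s ! 0 - s' ! 0)"
    by (rule sum.cong) (simp, rule d, simp)
  ultimately have "s ! 0 = s' ! 0" using n by simp
  then have "s ! i = s' ! i" if "i < n" for i using d[OF that] by simp
  then show "s = s'" using len by (intro nth_equalityI) auto
qed

lemma increments_surj:
  assumes c: "c \<in> bridge_codes m n" and n: "0 < n"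
  shows "c \<in> increments m ` bridges m n"
proof -
  have len: "length c = n" and tot: "(\<Sum>i<n. c ! i) = 2 * m * n" and dv: "n dvd (\<Sum>i<n. i * c ! i)"
    using c by (auto simp: bridge_codes_def compositions_def sum_list_eq_sum_nth)
  define e where "e i = int (c ! i) - 2 * int m" for i
  define P where "P j = (\<Sum>i<j. e i)" for j
  have P0: "P 0 = 0" "P (Suc j) = P j + e j" for j by (simp_all add: P_def)
  have "int (\<Sum>i<n. c ! i) = 2 * int m * int n" unfolding tot by simp
  then have Pn: "P n = 0" by (simp add: P_def e_def sum_subtractf)
  have S2: "2 * (\<Sum>i<k. int i) = int k * (int k - 1)" for k
    by (induction k) (simp_all add: algebra_simps)
  have abel: "(\<Sum>j<k. P j) = int k * P k - (\<Sum>i<k. e i) - (\<Sum>i<k. int i * e i)" for k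
    by (induction k) (simp_all add: P0 P_def algebra_simps)
  have "(\<Sum>i<n. int i * e i) = int (\<Sum>i<n. i * c ! i) - int m * (2 * (\<Sum>i<n. int i))"
    by (simp add: e_def algebra_simps sum_subtractf sum_distrib_left)
  then have "(\<Sum>j<n. P j) = - (int (\<Sum>i<n. i * c ! i) - int m * (int n * (int n - 1)))"
    using abel[of n] Pn unfolding S2 by (simp add: P_def)
  moreover have "int n dvd int (\<Sum>i<n. i * c ! i)" using dv by (simp only: of_nat_dvd_iff)
  moreover have "int n dvd int m * (int n * (int n - 1))" by simp
  ultimately have "int n dvd (\<Sum>j<n. P j)" by (metis dvd_diff dvd_minus_iff)
  \<comment> \<open>\<open>q\<close> is the mean of the partial sums; subtracting it makes the steps
    sum to 0.\<close>
  then obtain q where q: "(\<Sum>j<n. P j) = int n * q" by blast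
  define s where "s = map (\<lambda>j. P j - q) [0..<n]"
  have ls: "length s = n" by (simp add: s_def)
  have ns: "s ! (j mod n) = P (j mod n) - q" for j using n by (simp add: s_def)
  have nx: "s ! (Suc j mod n) = s ! (j mod n) + e (j mod n)" for j
  proof (cases "Suc (j mod n) = n")
    case True
    then have "Suc j mod n = 0" by (simp add: mod_Suc)
    then have "s ! (Suc j mod n) = P 0 - q" using ns[of "Suc j"] by simp
    also have "P 0 = P (Suc (j mod n))" using True Pn P0 by simp
    finally show ?thesis using ns[of j] P0 by simp
  next
    case False
    then have "Suc j mod n = Suc (j mod n)" by (simp add: mod_Suc)
    then show ?thesis using ns[of j] ns[of "Suc j"] P0 by simp
  qed
  have "walk s n = (\<Sum>i<n. P i - q)"
    using walk_length[of s] by (simp add: ls) (simp add: s_def)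
  then have "walk s n = 0" using q by (simp add: sum_subtractf)
  then have sb: "s \<in> bridges m n"
    using ls nx by (simp add: bridges_def e_def)
  moreover have "increments m s = c"
  proof (rule nth_equalityI)
    show "length (increments m s) = length c" by (simp add: increments_def ls len)
    fix i assume "i < length (increments m s)"
    then have "i < n" by (simp add: increments_def ls)
    then show "increments m s ! i = c ! i"
      using increments_bridge(2)[OF sb n, of i] nx[of i] by (simp add: e_def)
  qed
  ultimately show ?thesis by blast
qed

lemma bij_betw_increments:
  assumes "0 < n"
  shows "bij_betw (increments m) (bridges m n) (bridge_codes m n)"
  unfolding bij_betw_def
  using inj_on_increments[OF assms] increments_bridge(1)[OF _ assms] increments_surj[OF _ assms] by blast

lemma finite_bridges: "finite (bridges m n)"
proof (cases "n = 0")
  case True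
  then have "bridges m n \<subseteq> {[]}" by (auto simp: bridges_def)
  then show ?thesis by (rule finite_subset) simp
next
  case False
  then show ?thesis
    using bij_betw_finite[OF bij_betw_increments[of n m]] by (simp add: bridge_codes_def)
qed

section \<open>The root of unity filter\<close>

lemma prod_one_minus_roots_unity:
  fixes \<zeta> :: complex
  assumes e: "0 < e" and prim: "\<And>j. \<zeta> ^ j = 1 \<longleftrightarrow> e dvd j"
  shows "(\<Prod>b<e. [:1, - (\<zeta> ^ b):]) = 1 - monom 1 e"
proof (rule poly_eqI_degree)
  define \<xi> where "\<xi> = inverse \<zeta>"
  have z0: "\<zeta> \<noteq> 0" using prim[of e] e by (metis dvd_refl power_eq_0_iff zero_neq_one power_0_left neq0_conv)
  \<comment> \<open>The \<open>e\<close> inverse powers are zeros of both sides; the point 0 fixes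
    the constant factor and completes the \<open>e + 1\<close> points needed for degree
    \<open>e\<close>.\<close>
  let ?A = "insert 0 ((\<lambda>b. \<xi> ^ b) ` {..<e})"
  have inj: "inj_on (\<lambda>b. \<xi> ^ b) {..<e}"
  proof (rule linorder_inj_onI)
    fix a b assume ab: "a < b" "a \<in> {..<e}" "b \<in> {..<e}"
    show "\<xi> ^ a \<noteq> \<xi> ^ b"
    proof
      assume "\<xi> ^ a = \<xi> ^ b"
      then have "\<zeta> ^ a = \<zeta> ^ b" by (simp add: \<xi>_def power_inverse)
      also have "\<zeta> ^ b = \<zeta> ^ a * \<zeta> ^ (b - a)" using ab by (simp flip: power_add)
      finally have "\<zeta> ^ (b - a) = 1" using z0 by simp
      then have "e dvd b - a" using prim by simp
      then show False using ab by (auto dest: dvd_imp_le)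
    qed
  qed auto
  have "0 \<notin> (\<lambda>b. \<xi> ^ b) ` {..<e}" using z0 by (auto simp: \<xi>_def)
  then have card: "card ?A = Suc e" using inj by (simp add: card_image)
  have "degree (\<Prod>b<e. [:1, - (\<zeta> ^ b):]) \<le> (\<Sum>b<e. degree [:1, - (\<zeta> ^ b):])"
    using degree_prod_sum_le[of "{..<e}" "\<lambda>b. [:1, - (\<zeta> ^ b):]"] by (simp add: o_def)
  also have "\<dots> \<le> (\<Sum>b<e. 1)" by (rule sum_mono) simp
  finally show "card ?A > degree (\<Prod>b<e. [:1, - (\<zeta> ^ b):])" using card by simp
  have "degree (1 - monom 1 e :: complex poly) \<le> e"
    by (rule degree_diff_le) (auto simp: degree_monom_le)
  then show "card ?A > degree (1 - monom 1 e :: complex poly)" using card by simp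
  fix x assume "x \<in> ?A"
  then consider "x = 0" | b where "b < e" "x = \<xi> ^ b" by auto
  then show "poly (\<Prod>b<e. [:1, - (\<zeta> ^ b):]) x = poly (1 - monom 1 e) x"
  proof cases
    case 1
    then show ?thesis using e by (simp add: poly_prod poly_monom)
  next
    case 2
    have "x * \<zeta> ^ b = 1" using z0 2 by (simp add: \<xi>_def power_inverse)
    then have "poly (\<Prod>b<e. [:1, - (\<zeta> ^ b):]) x = 0"
      using 2 by (auto simp: poly_prod intro!: prod_zero bexI[of _ b])
    moreover have "x ^ e = 1"
    proof -
      have "\<zeta> ^ (b * e) = 1" using prim by simp
      then show ?thesis using 2 z0 by (simp add: \<xi>_def power_inverse flip: power_mult)
    qed
    ultimately show ?thesis by (simp add: poly_monom)
  qed
qed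

text \<open>The series is that of \<open>1 / (1 - X ^ e)\<close>; the induction step is the
  hockey-stick identity.\<close>

lemma fps_nth_geometric_power:
  assumes "0 < e"
  shows "fps_nth (Abs_fps (\<lambda>k. if e dvd k then 1 else 0 :: complex) ^ Suc g) (e * M)
    = of_nat ((M + g) choose g)"
proof (induction g arbitrary: M)
  case 0
  show ?case by simp
next
  case (Suc g)
  let ?G = "Abs_fps (\<lambda>k. if e dvd k then 1 else 0 :: complex)"
  have "fps_nth (?G ^ Suc (Suc g)) (e * M) = (\<Sum>k=0..e*M. fps_nth ?G k * fps_nth (?G ^ Suc g) (e * M - k))"
    by (subst power_Suc, subst fps_mult_nth) simp
  also have "\<dots> = (\<Sum>k\<in>(\<lambda>j. e * j) ` {..M}. fps_nth (?G ^ Suc g) (e * M - k))"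
    using assms by (intro sum.mono_neutral_cong_right) auto
  also have "\<dots> = (\<Sum>j\<le>M. fps_nth (?G ^ Suc g) (e * M - e * j))"
    using assms by (subst sum.reindex) (auto simp: inj_on_def)
  also have "\<dots> = (\<Sum>j\<le>M. of_nat ((M - j + g) choose g))"
    using Suc by (intro sum.cong) (auto simp flip: diff_mult_distrib2)
  also have "\<dots> = (\<Sum>j\<le>M. of_nat ((g + j) choose g))"
    by (rule sum.reindex_bij_witness[of _ "\<lambda>j. M - j" "\<lambda>j. M - j"]) (auto simp: add.commute)
  also have "\<dots> = of_nat (\<Sum>j\<le>M. (g + j) choose j)"
    unfolding of_nat_sum by (intro sum.cong) (auto simp: binomial_symmetric[of g])
  also have "(\<Sum>j\<le>M. (g + j) choose j) = Suc (g + M) choose M" by (rule sum_choose_lower)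
  also have "\<dots> = (M + Suc g) choose Suc g"
    using binomial_symmetric[of M "M + Suc g"] by (simp add: add.commute)
  finally show ?case .
qed

definition unity_root :: "nat \<Rightarrow> complex" where
  "unity_root n = exp (2 * of_real pi * \<i> / of_nat n)"

lemma unity_root_power_eq_1_iff:
  assumes "0 < n"
  shows "unity_root n ^ j = 1 \<longleftrightarrow> n dvd j"
proof -
  have "unity_root n ^ j = exp (2 * of_real pi * \<i> * of_nat j / of_nat n)"
    unfolding unity_root_def exp_of_nat_mult[symmetric] by (simp add: field_simps)
  then show ?thesis using complex_root_unity_eq_1[of n j] assms by simp
qed

lemma sum_unity_root_powers:
  assumes "0 < n"
  shows "(\<Sum>k=1..n. unity_root n ^ (k * j)) = (if n dvd j then of_nat n else 0)"
proof (cases "n dvd j")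
  case True
  then have "unity_root n ^ (k * j) = 1" for k using unity_root_power_eq_1_iff[OF assms] by simp
  then show ?thesis using True by simp
next
  case False
  let ?w = "unity_root n ^ j"
  have w: "?w \<noteq> 1" "?w ^ n = 1"
    using False unity_root_power_eq_1_iff[OF assms] by (simp_all flip: power_mult)
  have "(\<Sum>k=1..n. unity_root n ^ (k * j)) = (\<Sum>k<n. ?w ^ Suc k)"
    by (rule sum.reindex_bij_witness[of _ Suc "\<lambda>k. k - 1"]) (auto simp: mult.commute simp flip: power_mult power_Suc)
  also have "\<dots> = ?w * (\<Sum>k<n. ?w ^ k)" by (simp add: sum_distrib_left)
  also have "\<dots> = 0" using w by (simp add: geometric_sum)
  finally show ?thesis using False by simp
qed

text \<open>The generating function is \<open>(1 - X\<^sup>e)\<^sup>-\<^sup>g\<close> with \<open>e = n / g\<close>.\<close>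

lemma sum_compositions_unity_root:
  assumes n: "0 < n" and k: "0 < k"
  shows "(\<Sum>c\<in>compositions (M * n) n. unity_root n ^ (k * (\<Sum>i<n. i * c ! i)))
    = of_nat ((M * gcd k n + gcd k n - 1) choose (gcd k n - 1))"
proof -
  define g where "g = gcd k n"
  define e where "e = n div g"
  have g: "g > 0" "n = e * g" "e > 0"
    using n by (auto simp: g_def e_def div_greater_zero_iff intro: gcd_le2_nat)
  define \<zeta> where "\<zeta> = unity_root n ^ k"
  \<comment> \<open>\<open>\<zeta>\<close> is a primitive root of unity of order
    \<open>e = n div gcd k n\<close>.\<close>
  have prim: "\<zeta> ^ j = 1 \<longleftrightarrow> e dvd j" for j
  proof -
    define k' where "k' = k div g"
    have k': "k = k' * g" by (simp add: k'_def g_def)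
    have cop: "coprime e k'"
      using div_gcd_coprime[of k n] n unfolding e_def k'_def g_def by (simp add: coprime_commute)
    have "\<zeta> ^ j = 1 \<longleftrightarrow> n dvd k * j"
      using unity_root_power_eq_1_iff[OF n] by (simp add: \<zeta>_def flip: power_mult)
    also have "k * j = (k' * j) * g" by (subst k') (simp only: mult_ac)
    also have "n dvd (k' * j) * g \<longleftrightarrow> e * g dvd (k' * j) * g" by (subst g(2)) (rule refl)
    also have "\<dots> \<longleftrightarrow> e dvd k' * j" using g(1) by simp
    also have "\<dots> \<longleftrightarrow> e dvd j" using cop by (simp add: coprime_dvd_mult_right_iff)
    finally show ?thesis .
  qed
  let ?G = "Abs_fps (\<lambda>k. if e dvd k then 1 else 0 :: complex)"
  let ?F = "\<lambda>x. Abs_fps (\<lambda>k. x ^ k) :: complex fps"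
  have inv: "fps_of_poly [:1, - x:] * ?F x = 1" for x
    by (rule fps_ext) (simp add: fps_of_poly_pCons algebra_simps fps_X_mult_nth flip: power_Suc)
  have P: "(\<Prod>b<e. fps_of_poly [:1, - (\<zeta> ^ b):]) = 1 - fps_X ^ e"
    unfolding fps_of_poly_prod[symmetric] prod_one_minus_roots_unity[OF g(3) prim]
    by (simp add: fps_of_poly_diff fps_of_poly_monom')
  have G: "(1 - fps_X ^ e) * ?G = 1"
  proof (rule fps_ext)
    fix k show "fps_nth ((1 - fps_X ^ e) * ?G) k = fps_nth 1 k"
      using g(3) by (cases "k < e") (auto simp: algebra_simps fps_X_power_mult_nth dvd_minus_self dest: dvd_imp_le)
  qed
  have PF: "(\<Prod>b<e. fps_of_poly [:1, - (\<zeta> ^ b):]) * (\<Prod>b<e. ?F (\<zeta> ^ b)) = 1"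
    unfolding prod.distrib[symmetric] by (simp add: inv)
  have one: "(\<Prod>b<e. ?F (\<zeta> ^ b)) = ?G"
  proof -
    have "(\<Prod>b<e. ?F (\<zeta> ^ b)) = (\<Prod>b<e. ?F (\<zeta> ^ b)) * ((1 - fps_X ^ e) * ?G)" by (simp only: G mult_1_right)
    also have "\<dots> = ((1 - fps_X ^ e) * (\<Prod>b<e. ?F (\<zeta> ^ b))) * ?G" by (simp only: mult_ac)
    also have "\<dots> = ?G" unfolding PF[unfolded P] by (rule mult_1_left)
    finally show ?thesis .
  qed
  have per: "\<zeta> ^ (e * a + b) = \<zeta> ^ b" for a b
  proof -
    have "\<zeta> ^ (e * a) = 1" using prim by simp
    then show ?thesis by (simp add: power_add)
  qed
  \<comment> \<open>The exponents run through full periods of length \<open>e\<close>, and each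
    period contributes one factor \<open>?G\<close>.\<close>
  have all: "(\<Prod>i<e * a. ?F (\<zeta> ^ i)) = ?G ^ a" for a
  proof (induction a)
    case (Suc a)
    have "{..<e * Suc a} = {..<e * a} \<union> (\<lambda>b. e * a + b) ` {..<e}"
    proof (intro equalityI subsetI)
      fix i assume "i \<in> {..<e * Suc a}"
      then show "i \<in> {..<e * a} \<union> (\<lambda>b. e * a + b) ` {..<e}"
        by (cases "i < e * a") (auto intro!: image_eqI[of _ _ "i - e * a"])
    qed auto
    moreover have "{..<e * a} \<inter> (\<lambda>b. e * a + b) ` {..<e} = {}" by auto
    ultimately have "(\<Prod>i<e * Suc a. ?F (\<zeta> ^ i))
        = (\<Prod>i<e * a. ?F (\<zeta> ^ i)) * (\<Prod>i\<in>(\<lambda>b. e * a + b) ` {..<e}. ?F (\<zeta> ^ i))"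
      by (simp add: prod.union_disjoint)
    also have "(\<Prod>i\<in>(\<lambda>b. e * a + b) ` {..<e}. ?F (\<zeta> ^ i)) = (\<Prod>b<e. ?F (\<zeta> ^ b))"
      by (subst prod.reindex) (auto simp: per)
    finally show ?case using Suc one by (simp add: mult.commute)
  qed simp
  have "(\<Sum>c\<in>compositions (M * n) n. unity_root n ^ (k * (\<Sum>i<n. i * c ! i)))
      = (\<Sum>c\<in>compositions (M * n) n. \<Prod>i<n. (\<zeta> ^ i) ^ (c ! i))"
    by (rule sum.cong) (simp_all add: \<zeta>_def power_sum sum_distrib_left mult.assoc flip: power_mult)
  also have "\<dots> = fps_nth (?G ^ g) (M * n)"
    unfolding sum_compositions_powers using all[of g] g by (simp add: mult.commute)
  also have "\<dots> = fps_nth (?G ^ Suc (g - 1)) (e * (M * g))"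
    using g by (simp add: mult_ac)
  also have "\<dots> = of_nat ((M * g + (g - 1)) choose (g - 1))"
    by (rule fps_nth_geometric_power[OF g(3)])
  also have "M * g + (g - 1) = M * g + g - 1" using g(1) by simp
  finally show ?thesis unfolding g_def .
qed

text \<open>Divisibility by \<open>n\<close> is detected by averaging over the \<open>n\<close>-th
  roots of unity. The term for \<open>k\<close> depends only on \<open>gcd k n\<close>; these gcds
  become the piece sizes in \<open>tsum\<close>.\<close>

lemma card_bridges:
  assumes n: "0 < n"
  shows "n * card (bridges m n) = (\<Sum>k=1..n. (2 * m * gcd k n + gcd k n - 1) choose (gcd k n - 1))"
proof -
  have c: "card (bridges m n) = card (bridge_codes m n)"
    by (rule bij_betw_same_card[OF bij_betw_increments[OF n]])
  have "of_nat (n * card (bridge_codes m n))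
      = (\<Sum>c\<in>bridge_codes m n. of_nat n :: complex)" by simp
  also have "\<dots> = (\<Sum>c\<in>compositions (2 * m * n) n. if n dvd (\<Sum>i<n. i * c ! i) then of_nat n else 0)"
    unfolding bridge_codes_def by (rule sum.inter_filter) simp
  also have "\<dots> = (\<Sum>c\<in>compositions (2 * m * n) n. \<Sum>k=1..n. unity_root n ^ (k * (\<Sum>i<n. i * c ! i)))"
    by (simp only: sum_unity_root_powers[OF n])
  also have "\<dots> = (\<Sum>k=1..n. \<Sum>c\<in>compositions (2 * m * n) n. unity_root n ^ (k * (\<Sum>i<n. i * c ! i)))"
    by (rule sum.swap)
  also have "\<dots> = (\<Sum>k=1..n. of_nat ((2 * m * gcd k n + gcd k n - 1) choose (gcd k n - 1)))"
    by (rule sum.cong[OF refl], rule sum_compositions_unity_root[OF n]) simp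
  finally show ?thesis
    unfolding c of_nat_sum[symmetric] by (simp only: of_nat_eq_iff)
qed

section \<open>Lattice points of the polytope\<close>

lemma lookup_scaleR [simp]:
  "Poly_Mapping.lookup (r *\<^sub>R x) i = r * Poly_Mapping.lookup (x :: finvec) i"
proof -
  have "{i. r *\<^sub>R Poly_Mapping.lookup x i \<noteq> 0} \<subseteq> {i. Poly_Mapping.lookup x i \<noteq> 0}" by auto
  then have "finite {i. r *\<^sub>R Poly_Mapping.lookup x i \<noteq> 0}"
    using finite_lookup finite_subset by blast
  then show ?thesis
    unfolding scaleR_poly_mapping_def by (subst lookup_Abs_poly_mapping) simp_all
qed

text \<open>Points are encoded by the gaps \<open>y\<^sub>k\<close> between the sum of the \<open>k\<close> largest coordinates of
  \<open>m (1, \<dots>, d)\<close> and the sum of the first \<open>k\<close> coordinates. In these terms the polytope is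
  \<open>y \<ge> 0\<close> with second differences at least \<open>-2 m\<close>.\<close>

definition gap :: "real \<Rightarrow> nat \<Rightarrow> finvec \<Rightarrow> nat \<Rightarrow> real" where
  "gap m d v k = (\<Sum>i<k. m * real (d - i) - Poly_Mapping.lookup v (Suc i))"

definition feasible :: "real \<Rightarrow> nat \<Rightarrow> (nat \<Rightarrow> real) \<Rightarrow> bool" where
  "feasible m d y \<longleftrightarrow> y 0 = 0 \<and> y d = 0 \<and> (\<forall>k\<le>d. 0 \<le> y k) \<and>
     (\<forall>k. Suc k < d \<longrightarrow> 2 * y (Suc k) - 2 * m \<le> y (Suc (Suc k)) + y k)"

definition point_of :: "nat \<Rightarrow> (nat \<Rightarrow> real) \<Rightarrow> finvec" where
  "point_of d y = (\<Sum>i<d. Poly_Mapping.single (Suc i) (real (d - i) - (y (Suc i) - y i)))"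

lemma lookup_point_of:
  "Poly_Mapping.lookup (point_of d y) j =
    (if j \<in> {1..d} then real (d - (j - 1)) - (y j - y (j - 1)) else 0)"
proof -
  have "Poly_Mapping.lookup (point_of d y) j
      = (\<Sum>i<d. if Suc i = j then real (d - i) - (y (Suc i) - y i) else 0)"
    by (auto simp: point_of_def lookup_sum lookup_single when_def intro!: sum.cong)
  also have "\<dots> = (\<Sum>i\<in>{..<d} \<inter> {i. Suc i = j}. real (d - i) - (y (Suc i) - y i))"
    by (subst sum.inter_restrict) auto
  also have "{..<d} \<inter> {i. Suc i = j} = (if j \<in> {1..d} then {j - 1} else {})" by auto
  finally show ?thesis by auto
qed

lemma gap_Suc: "gap m d v (Suc k) = gap m d v k + (m * real (d - k) - Poly_Mapping.lookup v (Suc k))"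
  by (simp add: gap_def)

lemma point_of_gap:
  assumes "Poly_Mapping.keys v \<subseteq> {1..d}"
  shows "point_of d (gap 1 d v) = v"
proof (rule poly_mapping_eqI)
  fix j
  show "Poly_Mapping.lookup (point_of d (gap 1 d v)) j = Poly_Mapping.lookup v j"
  proof (cases "j \<in> {1..d}")
    case True
    then obtain i where "j = Suc i" "i < d" by (cases j) auto
    then show ?thesis by (simp add: lookup_point_of gap_Suc)
  next
    case False
    then show ?thesis using assms by (auto simp: lookup_point_of in_keys_iff)
  qed
qed

lemma gap_scale: "m \<noteq> 0 \<Longrightarrow> gap m d (m *\<^sub>R v) k = m * gap 1 d v k"
  by (simp add: gap_def sum_distrib_left right_diff_distrib)

lemma feasible_scale: "m > 0 \<Longrightarrow> feasible m d (\<lambda>k. m * y k) \<longleftrightarrow> feasible 1 d y"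
proof -
  assume m: "m > 0"
  have "2 * (m * a) - 2 * m \<le> m * b + m * c \<longleftrightarrow> 2 * a - 2 * 1 \<le> b + c" for a b c :: real
  proof -
    have "2 * (m * a) - 2 * m \<le> m * b + m * c \<longleftrightarrow> m * (2 * a - 2) \<le> m * (b + c)"
      by (simp add: algebra_simps)
    then show ?thesis using m by simp
  qed
  then show ?thesis using m by (simp add: feasible_def zero_le_mult_iff)
qed

section \<open>Points of avoiding permutations satisfy the inequalities\<close>

lemma contains_pattern_tripleI:
  assumes "1 \<le> i" "i < j" "j < k" "k \<le> d"
    and "\<And>a b. a < 3 \<Longrightarrow> b < 3 \<Longrightarrow> p ([i, j, k] ! a) < p ([i, j, k] ! b) \<longleftrightarrow> s ! a < s ! b"
    and "length s = 3"
  shows "contains_pattern d p s"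
  unfolding contains_pattern_def
proof (intro exI[of _ "\<lambda>a. [i, j, k] ! a"] conjI)
  have three: "{..<3 :: nat} = {0, 1, 2}" by auto
  show "strict_mono_on {..<length s} ((!) [i, j, k])"
    unfolding assms(6) three strict_mono_on_def using assms by (auto simp: numeral_2_eq_2)
  show "(!) [i, j, k] ` {..<length s} \<subseteq> {1..d}"
    unfolding assms(6) three using assms by (auto simp: numeral_2_eq_2)
qed (use assms in auto)

lemma contains_pattern_tripleE:
  assumes "contains_pattern d p s" "length s = 3"
  obtains i j k where "1 \<le> i" "i < j" "j < k" "k \<le> d"
    "p i < p j \<longleftrightarrow> s ! 0 < s ! 1" "p j < p k \<longleftrightarrow> s ! 1 < s ! 2" "p i < p k \<longleftrightarrow> s ! 0 < s ! 2"
    "p j < p i \<longleftrightarrow> s ! 1 < s ! 0" "p k < p j \<longleftrightarrow> s ! 2 < s ! 1" "p k < p i \<longleftrightarrow> s ! 2 < s ! 0"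
proof -
  from assms obtain f where f: "strict_mono_on {..<3} f" "f ` {..<3} \<subseteq> {1..d}"
    "\<And>a b. a < 3 \<Longrightarrow> b < 3 \<Longrightarrow> p (f a) < p (f b) \<longleftrightarrow> s ! a < s ! b"
    unfolding contains_pattern_def by metis
  have "f 0 < f 1" "f 1 < f 2" using f(1) by (auto simp: strict_mono_on_def)
  moreover have "f 0 \<in> {1..d}" "f 2 \<in> {1..d}" by (rule subsetD[OF f(2)], simp)+
  ultimately show ?thesis by (intro that[of "f 0" "f 1" "f 2"]) (auto simp: f(3))
qed

text \<open>A larger ascent skips the value \<open>p k + 1\<close>. If this value stands to the left
  of the ascent it completes a 213, if to the right a 132.\<close>

lemma avoiding_imp_ascent_le_1:
  assumes p: "p \<in> avoiding_perms d {[1, 3, 2], [2, 1, 3]}" and k: "1 \<le> k" "k < d"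
  shows "p (Suc k) \<le> p k + 1"
proof (rule ccontr)
  assume "\<not> ?thesis"
  then have lt: "p k + 1 < p (Suc k)" by simp
  have perm: "p permutes {1..d}" and av: "\<not> contains_pattern d p [1, 3, 2]" "\<not> contains_pattern d p [2, 1, 3]"
    using p by (auto simp: avoiding_perms_def)
  have "p (Suc k) \<in> {1..d}" using permutes_in_image[OF perm] k by auto
  then have "p k + 1 \<in> {1..d}" using lt by auto
  then obtain l where l: "l \<in> {1..d}" "p l = p k + 1"
    using permutes_image[OF perm] by (metis imageE)
  have "l \<noteq> k" "l \<noteq> Suc k" using l lt by auto
  then consider "l < k" | "Suc k < l" by linarith
  then show False
  proof cases
    case 1
    have "contains_pattern d p [2, 1, 3]"
      by (rule contains_pattern_tripleI[of l k "Suc k"])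
         (use 1 l k lt in \<open>auto simp: less_Suc_eq numeral_3_eq_3\<close>)
    with av show False by simp
  next
    case 2
    have "contains_pattern d p [1, 3, 2]"
      by (rule contains_pattern_tripleI[of k "Suc k" l])
         (use 2 l k lt in \<open>auto simp: less_Suc_eq numeral_3_eq_3\<close>)
    with av show False by simp
  qed
qed

lemma sum_le_sum_top:
  assumes "finite A" "A \<subseteq> {1..d :: nat}"
  shows "\<Sum>A \<le> (\<Sum>i<card A. d - i)"
  using assms
proof (induction "card A" arbitrary: A d)
  case 0
  then show ?case by simp
next
  case (Suc n)
  then have ne: "A \<noteq> {}" by auto
  let ?M = "Max A"
  have M: "?M \<in> A" using Suc.prems ne by simp
  have card: "card (A - {?M}) = n" using Suc M by simp
  have sub: "A - {?M} \<subseteq> {1..d - 1}"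
  proof
    fix a assume a: "a \<in> A - {?M}"
    then have "a < ?M" using Suc.prems by (metis DiffE Max_ge insertI1 le_neq_implies_less)
    moreover have "?M \<le> d" "a \<ge> 1" using M a Suc.prems by auto
    ultimately show "a \<in> {1..d - 1}" by auto
  qed
  have "\<Sum>(A - {?M}) \<le> (\<Sum>i<n. (d - 1) - i)"
    using Suc.hyps(1)[of "A - {?M}" "d - 1"] card sub Suc.prems by simp
  moreover have "\<Sum>A = ?M + \<Sum>(A - {?M})" using M Suc.prems by (simp add: sum.remove)
  moreover have "?M \<le> d" using M Suc.prems by auto
  moreover have "(\<Sum>i<card A. d - i) = d + (\<Sum>i<n. (d - 1) - i)"
    unfolding Suc.hyps(2)[symmetric] by (subst sum.lessThan_Suc_shift) simp
  ultimately show ?case by linarith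
qed

text \<open>Gaps are nonnegative because \<open>k\<close> distinct values sum to at most the
  \<open>k\<close> largest ones. The bound -2 on second differences is -1 from the decreasing
  reference sequence and -1 from ascents being at most 1.\<close>

lemma feasible_gap_perm_point:
  assumes p: "p \<in> avoiding_perms d {[1, 3, 2], [2, 1, 3]}"
  shows "feasible 1 d (gap 1 d (perm_point d p))"
proof -
  have perm: "p permutes {1..d}" using p by (simp add: avoiding_perms_def)
  have g: "gap 1 d (perm_point d p) k = real (\<Sum>i<k. d - i) - real (\<Sum>(p ` {1..k}))" if "k \<le> d" for k
  proof -
    have "gap 1 d (perm_point d p) k = (\<Sum>i<k. real (d - i) - real (p (Suc i)))"
      unfolding gap_def by (rule sum.cong) (use that in \<open>auto simp: lookup_perm_point\<close>)
    also have "\<dots> = real (\<Sum>i<k. d - i) - real (\<Sum>i<k. p (Suc i))" by (simp add: sum_subtractf)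
    also have "(\<Sum>i<k. p (Suc i)) = (\<Sum>i\<in>{1..k}. p i)"
      by (rule sum.reindex_bij_witness[of _ "\<lambda>i. i - 1" Suc]) auto
    also have "\<dots> = \<Sum>(p ` {1..k})"
      using permutes_inj[OF perm] by (subst sum.reindex) (auto intro: inj_on_subset)
    finally show ?thesis .
  qed
  have top: "(\<Sum>i<d. d - i) = \<Sum>{1..d}"
    by (rule sum.reindex_bij_witness[of _ "\<lambda>j. d - j" "\<lambda>i. d - i"]) auto
  have "0 \<le> gap 1 d (perm_point d p) k" if "k \<le> d" for k
  proof -
    have "card (p ` {1..k}) = k"
      using permutes_inj[OF perm] by (subst card_image) (auto intro: inj_on_subset)
    moreover have "p ` {1..k} \<subseteq> {1..d}" using permutes_image[OF perm] that by fastforce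
    ultimately have "\<Sum>(p ` {1..k}) \<le> (\<Sum>i<k. d - i)" using sum_le_sum_top[of "p ` {1..k}" d] by simp
    then show ?thesis unfolding g[OF that] by linarith
  qed
  moreover have "gap 1 d (perm_point d p) d = 0"
    unfolding g[OF order_refl] top permutes_image[OF perm] by simp
  moreover have "2 * gap 1 d (perm_point d p) (Suc k) - 2 * 1
      \<le> gap 1 d (perm_point d p) (Suc (Suc k)) + gap 1 d (perm_point d p) k" if "Suc k < d" for k
  proof -
    have "real (p (Suc (Suc k))) \<le> real (p (Suc k)) + 1"
      using avoiding_imp_ascent_le_1[OF p, of "Suc k"] that by simp
    moreover have "real (d - k) = real (d - Suc k) + 1" using that by simp
    ultimately show ?thesis using that by (simp add: gap_Suc lookup_perm_point del: of_nat_diff)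
  qed
  ultimately show ?thesis by (simp add: feasible_def gap_def)
qed

section \<open>The polytope as the solution set of the inequalities\<close>

lemma gap_convex_comb:
  assumes "u + v = 1"
  shows "gap 1 d (u *\<^sub>R x + v *\<^sub>R y) k = u * gap 1 d x k + v * gap 1 d y k"
proof -
  have r: "real (d - i) = u * real (d - i) + v * real (d - i)" for i
    using assms by (metis distrib_right mult_1)
  have "1 * real (d - i) - (u * s + v * t) = u * (1 * real (d - i) - s) + v * (1 * real (d - i) - t)"
    for i s t
    unfolding right_diff_distrib mult_1 using r[of i] by linarith
  then show ?thesis
    unfolding gap_def sum_distrib_left sum.distrib[symmetric]
    by (intro sum.cong refl) (simp only: lookup_add lookup_scaleR)
qed

lemma feasible_convex_comb:
  assumes x: "feasible 1 d x" and y: "feasible 1 d y" and uv: "u \<ge> 0" "v \<ge> 0" "u + v = 1"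
  shows "feasible 1 d (\<lambda>k. u * x k + v * y k)"
  unfolding feasible_def
proof (intro conjI allI impI)
  fix k assume "Suc k < d"
  then have "2 * x (Suc k) - 2 * 1 \<le> x (Suc (Suc k)) + x k" "2 * y (Suc k) - 2 * 1 \<le> y (Suc (Suc k)) + y k"
    using x y by (auto simp: feasible_def)
  then have "u * (2 * x (Suc k) - 2 * 1) + v * (2 * y (Suc k) - 2 * 1)
      \<le> u * (x (Suc (Suc k)) + x k) + v * (y (Suc (Suc k)) + y k)"
    using uv by (intro add_mono mult_left_mono) auto
  moreover have "u * (2 * x (Suc k) - 2 * 1) + v * (2 * y (Suc k) - 2 * 1)
      = 2 * (u * x (Suc k) + v * y (Suc k)) - 2 * (u + v)" by (simp add: algebra_simps)
  ultimately show "2 * (u * x (Suc k) + v * y (Suc k)) - 2 * 1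
      \<le> u * x (Suc (Suc k)) + v * y (Suc (Suc k)) + (u * x k + v * y k)"
    unfolding uv(3) by (simp add: algebra_simps)
qed (use x y uv in \<open>auto simp: feasible_def\<close>)

lemma polytope_imp_feasible:
  assumes "v \<in> P_132_213 d"
  shows "Poly_Mapping.keys v \<subseteq> {1..d}" "feasible 1 d (gap 1 d v)"
proof -
  let ?Q = "{v :: finvec. (\<forall>i. i \<notin> {1..d} \<longrightarrow> Poly_Mapping.lookup v i = 0) \<and> feasible 1 d (gap 1 d v)}"
  have "convex ?Q"
  proof (rule convexI)
    fix x y :: finvec and u v :: real
    assume *: "x \<in> ?Q" "y \<in> ?Q" "0 \<le> u" "0 \<le> v" "u + v = 1"
    have "gap 1 d (u *\<^sub>R x + v *\<^sub>R y) = (\<lambda>k. u * gap 1 d x k + v * gap 1 d y k)"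
      using gap_convex_comb[OF *(5)] by auto
    then show "u *\<^sub>R x + v *\<^sub>R y \<in> ?Q"
      using * feasible_convex_comb[of d "gap 1 d x" "gap 1 d y" u v] by (auto simp: lookup_add)
  qed
  moreover have "perm_point d ` avoiding_perms d {[1, 3, 2], [2, 1, 3]} \<subseteq> ?Q"
    by (auto simp: feasible_gap_perm_point lookup_perm_point)
  ultimately have "P_132_213 d \<subseteq> ?Q"
    unfolding P_132_213_def pattern_polytope_def by (intro hull_minimal)
  with assms have "v \<in> ?Q" by blast
  then show "Poly_Mapping.keys v \<subseteq> {1..d}" "feasible 1 d (gap 1 d v)"
    by (auto simp: in_keys_iff)
qed

text \<open>A feasible point at which every position is tight in one of the two constraints is the
  parabola \<open>(k - a) (b - k)\<close> between consecutive zeros \<open>a < b\<close>.\<close>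

lemma tight_point_in_polytope:
  assumes y: "feasible 1 d y"
    and tight: "\<And>k. Suc k < d \<Longrightarrow> y (Suc k) = 0 \<or> y (Suc (Suc k)) + y k = 2 * y (Suc k) - 2"
  shows "point_of d y \<in> P_132_213 d"
proof -
  have y0: "y 0 = 0" "y d = 0" using y by (auto simp: feasible_def)
  define a where "a i = Max {k. k < i \<and> y k = 0}" for i
  define b where "b i = (LEAST k. i \<le> k \<and> y k = 0)" for i
  have a: "a i < i" "y (a i) = 0" "\<And>k. a i < k \<Longrightarrow> k < i \<Longrightarrow> y k \<noteq> 0" if "0 < i" for i
  proof -
    let ?A = "{k. k < i \<and> y k = 0}"
    have "finite ?A" "0 \<in> ?A" using that y0 by auto
    then have "Max ?A \<in> ?A" by (intro Max_in) auto
    then show "a i < i" "y (a i) = 0" unfolding a_def by auto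
    fix k assume "a i < k" "k < i"
    show "y k \<noteq> 0"
    proof
      assume "y k = 0"
      then have "k \<le> a i" unfolding a_def using \<open>finite ?A\<close> \<open>k < i\<close> by (intro Max_ge) auto
      with \<open>a i < k\<close> show False by simp
    qed
  qed
  have b: "i \<le> b i" "y (b i) = 0" "b i \<le> d" "\<And>k. i \<le> k \<Longrightarrow> k < b i \<Longrightarrow> y k \<noteq> 0" if "i \<le> d" for i
  proof -
    have ex: "i \<le> d \<and> y d = 0" using that y0 by simp
    show "i \<le> b i" "y (b i) = 0" unfolding b_def using LeastI[of "\<lambda>k. i \<le> k \<and> y k = 0", OF ex] by auto
    show "b i \<le> d" unfolding b_def using Least_le[of "\<lambda>k. i \<le> k \<and> y k = 0", OF ex] .
    fix k assume k: "i \<le> k" "k < b i"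
    show "y k \<noteq> 0" using not_less_Least[OF k(2)[unfolded b_def]] k(1) by auto
  qed
  have blk: "real (d - (i - 1)) - (y i - y (i - 1)) = real d + real i - real (a i) - real (b i)"
    if i: "1 \<le> i" "i \<le> d" for i
  proof -
    define A B where "A = a i" and "B = b i"
    note ai = a[of i, folded A_def] and bi = b[of i, folded B_def]
    have ab: "A < B" "B \<le> d" using ai bi i by auto
    have nz: "y k \<noteq> 0" if "A < k" "k < B" for k
      using ai(3)[of k] bi(4)[of k] that i by (cases "k < i") auto
    \<comment> \<open>The initial slope \<open>c\<close> parametrizes the solutions of the tight
      recursion from the zero \<open>A\<close>; the zero at \<open>B\<close> fixes it to
      \<open>L - 1\<close>. The induction carries two consecutive values because the recursion has
      order two.\<close>
    define c where "c = y (Suc A)"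
    have step: "y (A + j) = real j * c - real j * (real j - 1) \<and>
        (Suc j \<le> B - A \<longrightarrow> y (A + Suc j) = real (Suc j) * c - real (Suc j) * real j)"
      if "j \<le> B - A" for j
      using that
    proof (induction j)
      case 0
      then show ?case using ai i by (simp add: c_def)
    next
      case (Suc j)
      then have 1: "y (A + j) = real j * c - real j * (real j - 1)"
        "y (A + Suc j) = real (Suc j) * c - real (Suc j) * real j" by auto
      have "y (A + Suc (Suc j)) = real (Suc (Suc j)) * c - real (Suc (Suc j)) * real (Suc j)"
        if "Suc (Suc j) \<le> B - A"
      proof -
        have "y (Suc (A + j)) \<noteq> 0" using nz[of "A + Suc j"] that by simp
        then have "y (Suc (Suc (A + j))) + y (A + j) = 2 * y (Suc (A + j)) - 2"
          using tight[of "A + j"] that ab by auto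
        then show ?thesis using 1 by (simp add: algebra_simps)
      qed
      with 1 show ?case by simp
    qed
    define L where "L = B - A"
    have L: "L > 0" "B = A + L" using ab by (auto simp: L_def)
    have Lle: "L \<le> B - A" by (simp add: L_def)
    have "y (A + L) = 0" unfolding L(2)[symmetric] using bi(2) i by simp
    moreover have "real L * (c - (real L - 1)) = real L * c - real L * (real L - 1)"
      by (rule right_diff_distrib)
    ultimately have "real L * (c - (real L - 1)) = 0" using step[OF Lle] by linarith
    then have c: "c = real L - 1" using L(1) by simp
    have "A < i" "i \<le> B" using ai bi i by auto
    then obtain j where j: "i = A + Suc j" "Suc j \<le> L" using L
      by (intro that[of "i - Suc A"]) auto
    have "y i = real (Suc j) * c - real (Suc j) * real j" "y (i - 1) = real j * c - real j * (real j - 1)"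
      using step[of j] j(2) Lle unfolding j(1) by auto
    moreover have "real (d - (i - 1)) = real d - real A - real j" using i unfolding j(1) by simp
    moreover have "real i = real A + real j + 1" unfolding j(1) by simp
    moreover have "real B = real A + real L" unfolding L(2) by simp
    ultimately show ?thesis unfolding c A_def[symmetric] B_def[symmetric] by (simp add: algebra_simps)
  qed
  have ab_le: "i \<le> b i" "a i < i" "b i \<le> d" if "1 \<le> i" "i \<le> d" for i using a[of i] b[of i] that by auto
  \<comment> \<open>A block consists of the positions \<open>a < i \<le> b\<close>
    (\<open>a i\<close> lies strictly before \<open>i\<close>, \<open>b i\<close> may equal
    \<open>i\<close>). It carries the values \<open>d - b + 1, ..., d - a\<close> in increasing
    order, and later blocks have smaller values.\<close>
  define p where "p i = (if i \<in> {1..d} then d + i - a i - b i else i)" for i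
  have sep: "(a i = a j \<and> b i = b j) \<or> b i \<le> a j" if "1 \<le> i" "i < j" "j \<le> d" for i j
  proof (cases "b i < j")
    case True
    have "b i \<le> a j"
    proof (rule ccontr)
      assume "\<not> b i \<le> a j"
      then show False using a(3)[of j "b i"] b(2)[of i] True that by auto
    qed
    then show ?thesis ..
  next
    case False
    have nzk: "y k \<noteq> 0" if "i \<le> k" "k < j" for k using b(4)[of i k] that False \<open>j \<le> d\<close> \<open>i < j\<close> by auto
    have ij: "0 < i" "0 < j" using that by auto
    have aj: "a j < i" using nzk[of "a j"] a(1,2)[OF ij(2)] by (meson linorder_not_less)
    have "a i = a j"
    proof (rule antisym)
      have "a i < j" using a(1)[OF ij(1)] that by simp
      then show "a i \<le> a j" using a(2)[OF ij(1)] a(3)[OF ij(2), of "a i"] by (meson linorder_not_less)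
      show "a j \<le> a i" using a(2)[OF ij(2)] a(3)[OF ij(1), of "a j"] aj by (meson linorder_not_less)
    qed
    moreover have "b i = b j"
    proof (rule antisym)
      have bj: "j \<le> b j" "y (b j) = 0" using b[of j] that by auto
      show "b i \<le> b j" unfolding b_def[of i] by (rule Least_le) (use bj that in auto)
      show "b j \<le> b i" unfolding b_def[of j] by (rule Least_le) (use False b[of i] that in auto)
    qed
    ultimately show ?thesis by blast
  qed
  have plt: "p i < p j \<and> p j = p i + (j - i) \<and> b i = b j \<or> p j < p i \<and> b i < j" if "1 \<le> i" "i < j" "j \<le> d" for i j
    using sep[OF that] ab_le[of i] ab_le[of j] that by (auto simp: p_def)
  have range: "p i \<in> {1..d}" if "i \<in> {1..d}" for i using that ab_le[of i] by (auto simp: p_def)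
  have inj: "inj_on p {1..d}"
    by (rule linorder_inj_onI) (use plt in fastforce)+
  have perm: "p permutes {1..d}"
  proof (rule bij_imp_permutes)
    show "bij_betw p {1..d} {1..d}"
      unfolding bij_betw_def using inj endo_inj_surj[of "{1..d}" p] range by blast
  qed (auto simp: p_def)
  \<comment> \<open>An increasing pair lies inside one block, hence so does everything between, in
    increasing order. Both 132 and 213 increase from the first to the last entry but not
    throughout.\<close>
  have same_block: "p i < p j \<and> p j < p k" if "1 \<le> i" "i < j" "j < k" "k \<le> d" "p i < p k" for i j k
  proof -
    have "b i = b k" using plt[of i k] that by auto
    moreover have "k \<le> b k" using ab_le[of k] that by auto
    ultimately have "j < b i" using that by auto
    then have "p i < p j \<and> b i = b j" using plt[of i j] that by auto
    moreover have "p j < p k" using plt[of j k] that \<open>b i = b k\<close> \<open>k \<le> b k\<close> calculation by auto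
    ultimately show ?thesis by blast
  qed
  have "p \<in> avoiding_perms d {[1, 3, 2], [2, 1, 3]}"
  proof -
    have "\<not> contains_pattern d p [1, 3, 2]"
    proof
      assume c: "contains_pattern d p [1, 3, 2]"
      obtain i j k where "1 \<le> i" "i < j" "j < k" "k \<le> d" and lt: "p i < p k" "p k < p j"
        by (rule contains_pattern_tripleE[OF c]) auto
      with same_block[of i j k] show False by simp
    qed
    moreover have "\<not> contains_pattern d p [2, 1, 3]"
    proof
      assume c: "contains_pattern d p [2, 1, 3]"
      obtain i j k where "1 \<le> i" "i < j" "j < k" "k \<le> d" and lt: "p i < p k" "p j < p i"
        by (rule contains_pattern_tripleE[OF c]) auto
      with same_block[of i j k] show False by simp
    qed
    ultimately show ?thesis using perm by (simp add: avoiding_perms_def)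
  qed
  moreover have "perm_point d p = point_of d y"
  proof (rule poly_mapping_eqI)
    fix i
    show "Poly_Mapping.lookup (perm_point d p) i = Poly_Mapping.lookup (point_of d y) i"
      using blk[of i] ab_le[of i] by (auto simp: lookup_perm_point lookup_point_of p_def)
  qed
  ultimately show ?thesis
    unfolding P_132_213_def pattern_polytope_def by (metis hull_inc imageI)
qed


lemma point_of_convex_comb:
  assumes "u + v = 1"
  shows "point_of d (\<lambda>k. u * x k + v * y k) = u *\<^sub>R point_of d x + v *\<^sub>R point_of d y"
proof (rule poly_mapping_eqI)
  fix j
  have "r - ((u * a + v * b) - (u * a' + v * b')) = u * (r - (a - a')) + v * (r - (b - b'))"
    for r a b a' b' :: real
  proof -
    have "u * (r - (a - a')) + v * (r - (b - b')) = (u + v) * r - ((u * a + v * b) - (u * a' + v * b'))"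
      by (simp add: algebra_simps)
    then show ?thesis unfolding assms by simp
  qed
  then show "Poly_Mapping.lookup (point_of d (\<lambda>k. u * x k + v * y k)) j
      = Poly_Mapping.lookup (u *\<^sub>R point_of d x + v *\<^sub>R point_of d y) j"
    unfolding lookup_add lookup_scaleR lookup_point_of by auto
qed

text \<open>Moving along the tent function \<open>z\<close> with kink at \<open>j\<close> between the neighbouring zeros
  \<open>a < b\<close> of \<open>y\<close> creates a new tight constraint in either direction.\<close>

definition nonzeros :: "nat \<Rightarrow> (nat \<Rightarrow> real) \<Rightarrow> nat set" where
  "nonzeros d y = {k. 0 < k \<and> k < d \<and> y k \<noteq> 0}"

definition loose :: "nat \<Rightarrow> (nat \<Rightarrow> real) \<Rightarrow> nat set" where
  "loose d y = {k. 0 < k \<and> k < d \<and> y k \<noteq> 0 \<and> y (Suc k) + y (k - 1) \<noteq> 2 * y k - 2}"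

text \<open>Both counts are used: moving up turns \<open>j\<close> from loose to tight, while moving
  down creates a zero at a position \<open>l\<close> that may already have been tight in the
  second-difference constraint.\<close>

definition slack :: "nat \<Rightarrow> (nat \<Rightarrow> real) \<Rightarrow> nat" where
  "slack d y = card (nonzeros d y) + card (loose d y)"

lemma slack_less:
  assumes "nonzeros d y' \<subseteq> nonzeros d y" and "loose d y' \<subseteq> loose d y"
    and "nonzeros d y' \<noteq> nonzeros d y \<or> loose d y' \<noteq> loose d y"
  shows "slack d y' < slack d y"
proof -
  have fin: "finite (nonzeros d y)" "finite (loose d y)"
    by (rule finite_subset[of _ "{..<d}"]; auto simp: nonzeros_def loose_def)+
  have "card (nonzeros d y') \<le> card (nonzeros d y)" "card (loose d y') \<le> card (loose d y)"
    using assms fin by (auto intro: card_mono)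
  moreover have "card (nonzeros d y') < card (nonzeros d y) \<or> card (loose d y') < card (loose d y)"
    using assms fin by (meson psubset_card_mono psubsetI)
  ultimately show ?thesis unfolding slack_def by linarith
qed

text \<open>Induction in place of extreme points: a sequence with a loose position lies strictly
  between two feasible sequences of smaller slack, so only the fully tight ones have to be
  recognised as permutations.\<close>

lemma feasible_imp_polytope:
  assumes "feasible 1 d y"
  shows "point_of d y \<in> P_132_213 d"
  using assms
proof (induction "slack d y" arbitrary: y rule: less_induct)
  case less
  show ?case
  proof (cases "\<forall>k. Suc k < d \<longrightarrow> y (Suc k) = 0 \<or> y (Suc (Suc k)) + y k = 2 * y (Suc k) - 2")
    case True
    then show ?thesis using tight_point_in_polytope[OF less.prems] by blast
  next
    case False
    then obtain j' where j': "Suc j' < d" "y (Suc j') \<noteq> 0"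
      "y (Suc (Suc j')) + y j' \<noteq> 2 * y (Suc j') - 2" by blast
    define j where "j = Suc j'"
    have j: "0 < j" "j < d" "y j \<noteq> 0" "y (Suc j) + y (j - 1) \<noteq> 2 * y j - 2"
      using j' by (auto simp: j_def)
    have y0: "y 0 = 0" "y d = 0" and ypos: "\<And>k. k \<le> d \<Longrightarrow> 0 \<le> y k"
      and yc: "\<And>k. 0 < k \<Longrightarrow> k < d \<Longrightarrow> 2 * y k - 2 \<le> y (Suc k) + y (k - 1)"
    proof -
      show "y 0 = 0" "y d = 0" "\<And>k. k \<le> d \<Longrightarrow> 0 \<le> y k" using less.prems by (auto simp: feasible_def)
      show "2 * y k - 2 \<le> y (Suc k) + y (k - 1)" if "0 < k" "k < d" for k
        using less.prems that by (cases k) (auto simp: feasible_def)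
    qed
    define a where "a = Max {k. k < j \<and> y k = 0}"
    have "finite {k. k < j \<and> y k = 0}" "0 \<in> {k. k < j \<and> y k = 0}" using j y0 by auto
    then have "a \<in> {k. k < j \<and> y k = 0}" unfolding a_def by (intro Max_in) auto
    then have a: "a < j" "y a = 0" by auto
    have anz: "y k \<noteq> 0" if "a < k" "k < j" for k
    proof
      assume "y k = 0"
      then have "k \<le> a" unfolding a_def using that by (intro Max_ge) auto
      then show False using that by simp
    qed
    define b where "b = (LEAST k. j < k \<and> y k = 0)"
    have ex: "j < d \<and> y d = 0" using j y0 by simp
    have b: "j < b" "y b = 0" unfolding b_def using LeastI[of "\<lambda>k. j < k \<and> y k = 0", OF ex] by auto
    have bd: "b \<le> d" unfolding b_def using Least_le[of "\<lambda>k. j < k \<and> y k = 0", OF ex] .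
    have bnz: "y k \<noteq> 0" if "j < k" "k < b" for k
      using not_less_Least[OF that(2)[unfolded b_def]] that(1) by auto
    have nz: "y k > 0" if "a < k" "k < b" for k
      using anz[of k] bnz[of k] j(3) ypos[of k] that bd
      by (cases k j rule: linorder_cases) (auto simp: less_le)
    define z where "z k = (if k \<le> a \<or> b \<le> k then 0
      else if k \<le> j then (real k - real a) * (real b - real j)
      else (real b - real k) * (real j - real a))" for k
    have zpos: "z k > 0" if "a < k" "k < b" for k using that a b by (auto simp: z_def)
    have z0: "z k = 0" if "k \<le> a \<or> b \<le> k" for k using that by (simp add: z_def)
    have zge: "z k \<ge> 0" for k using zpos[of k] z0[of k] by (cases "a < k \<and> k < b") auto
    have zj: "z (Suc j) + z (j - 1) = 2 * z j - (real b - real a)"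
    proof -
      have 1: "z j = (real j - real a) * (real b - real j)" using a b by (simp add: z_def)
      have 2: "z (Suc j) = (real b - real j - 1) * (real j - real a)"
        using a b by (cases "Suc j = b") (auto simp: z_def algebra_simps)
      have 3: "z (j - 1) = (real j - 1 - real a) * (real b - real j)"
        using a b j by (cases "j - 1 = a") (auto simp: z_def of_nat_diff)
      show ?thesis unfolding 1 2 3 by (simp add: algebra_simps)
    qed
    have zlin: "z (Suc k) + z (k - 1) = 2 * z k" if kk: "0 < k" "k \<noteq> a" "k \<noteq> b" "k \<noteq> j" for k
    proof -
      consider "k < a" | "b < k" | "a < k" "k < j" | "j < k" "k < b" using kk by linarith
      then show ?thesis
      proof cases
        case 3
        have "z (k - 1) = (real k - 1 - real a) * (real b - real j)"
          using 3 a b that by (cases "k - 1 = a") (auto simp: z_def of_nat_diff)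
        moreover have "z k = (real k - real a) * (real b - real j)"
          "z (Suc k) = (real k + 1 - real a) * (real b - real j)"
          using 3 a b that by (auto simp: z_def)
        ultimately show ?thesis by (simp add: algebra_simps)
      next
        case 4
        have "z (Suc k) = (real b - real k - 1) * (real j - real a)"
          using 4 a b by (cases "Suc k = b") (auto simp: z_def algebra_simps)
        moreover have "z k = (real b - real k) * (real j - real a)"
          "z (k - 1) = (real b - real k + 1) * (real j - real a)"
        proof -
          show "z k = (real b - real k) * (real j - real a)" using 4 a by (simp add: z_def)
          show "z (k - 1) = (real b - real k + 1) * (real j - real a)"
            using 4 a b by (cases "k - 1 = j") (auto simp: z_def of_nat_diff algebra_simps)
        qed
        ultimately show ?thesis by (simp add: algebra_simps)
      qed (auto simp: z_def)
    qed
    \<comment> \<open>Largest move upwards: the multiple of \<open>z\<close> that makes the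
      constraint at \<open>j\<close> tight, as the kink of \<open>z\<close> there has size
      \<open>b - a\<close>.\<close>
    define p where "p = (y (Suc j) + y (j - 1) - (2 * y j - 2)) / (real b - real a)"
    have ba: "real b - real a > 0" using a b by simp
    have p: "p > 0" "p * (real b - real a) = y (Suc j) + y (j - 1) - (2 * y j - 2)"
      using yc[OF j(1,2)] j(4) ba by (auto simp: p_def)
    \<comment> \<open>Largest move downwards: the multiple of \<open>z\<close> at which some
      \<open>y l\<close> first reaches 0.\<close>
    define q where "q = Min ((\<lambda>k. y k / z k) ` {a<..<b})"
    have ne: "{a<..<b} \<noteq> {}" using a b by auto
    have "q \<in> (\<lambda>k. y k / z k) ` {a<..<b}" unfolding q_def using ne by (intro Min_in) auto
    then obtain l where l: "a < l" "l < b" "q = y l / z l" by auto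
    have q: "q > 0" using l nz[of l] zpos[of l] by simp
    have qle: "q * z k \<le> y k" if "a < k" "k < b" for k
    proof -
      have "q \<le> y k / z k" unfolding q_def using that by (intro Min_le) auto
      then show ?thesis using zpos[OF that] by (simp add: field_simps)
    qed
    \<comment> \<open>The tent bends upwards at \<open>a\<close> and \<open>b\<close>, so
      subtracting it tightens the constraints there; they hold anyway at a zero of a nonnegative
      sequence.\<close>
    have ab_free: "y' (Suc k) + y' (k - 1) \<ge> 2 * y' k - 2"
      if "k = a \<or> k = b" "0 < k" "k < d" "\<And>k. k \<le> d \<Longrightarrow> 0 \<le> y' k" "y' a = 0" "y' b = 0" for y' :: "nat \<Rightarrow> real" and k
    proof -
      have "0 \<le> y' (Suc k)" "0 \<le> y' (k - 1)" using that(2,3) by (auto intro!: that(4))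
      moreover have "y' k = 0" using that(1,5,6) by auto
      ultimately show ?thesis by linarith
    qed
    define y1 where "y1 k = y k + p * z k" for k
    define y2 where "y2 k = y k - q * z k" for k
    have y1z: "y1 k = 0 \<longleftrightarrow> y k = 0" if "k \<le> d" for k
    proof (cases "a < k \<and> k < b")
      case True
      then have "p * z k > 0" using p zpos by simp
      then show ?thesis using True nz[of k] by (auto simp: y1_def)
    qed (auto simp: y1_def z0)
    have y1c: "y1 (Suc k) + y1 (k - 1) - (2 * y1 k - 2) = y (Suc k) + y (k - 1) - (2 * y k - 2)
        + p * (z (Suc k) + z (k - 1) - 2 * z k)" for k by (simp add: y1_def algebra_simps)
    have y2c: "y2 (Suc k) + y2 (k - 1) - (2 * y2 k - 2) = y (Suc k) + y (k - 1) - (2 * y k - 2)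
        - q * (z (Suc k) + z (k - 1) - 2 * z k)" for k by (simp add: y2_def algebra_simps)
    have y1pos: "0 \<le> y1 k" if "k \<le> d" for k
      unfolding y1_def using ypos[OF that] zge[of k] p by (intro add_nonneg_nonneg mult_nonneg_nonneg) auto
    have y2pos: "0 \<le> y2 k" if "k \<le> d" for k
      using ypos[OF that] qle[of k] z0[of k] by (cases "a < k \<and> k < b") (auto simp: y2_def)
    have yab: "y1 a = 0" "y1 b = 0" "y2 a = 0" "y2 b = 0" using a b z0 by (auto simp: y1_def y2_def)
    have y1j: "y1 (Suc j) + y1 (j - 1) = 2 * y1 j - 2" 
    proof -
      have "z (Suc j) + z (j - 1) - 2 * z j = - (real b - real a)" using zj by simp
      then have "p * (z (Suc j) + z (j - 1) - 2 * z j) = - (p * (real b - real a))"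
        by (simp only: mult_minus_right)
      then show ?thesis using y1c[of j] p(2) by linarith
    qed
    have c1: "2 * y1 k - 2 \<le> y1 (Suc k) + y1 (k - 1)" if "0 < k" "k < d" for k
    proof -
      consider "k = a \<or> k = b" | "k = j" | "k \<noteq> a" "k \<noteq> b" "k \<noteq> j" by blast
      then show ?thesis
      proof cases
        case 1
        then show ?thesis using ab_free[of k y1] that y1pos yab by blast
      next
        case 2
        then show ?thesis using y1j by simp
      next
        case 3
        then show ?thesis using y1c[of k] zlin[of k] yc[of k] that by simp
      qed
    qed
    have c2: "2 * y2 k - 2 \<le> y2 (Suc k) + y2 (k - 1)" if "0 < k" "k < d" for k
    proof -
      consider "k = a \<or> k = b" | "k = j" | "k \<noteq> a" "k \<noteq> b" "k \<noteq> j" by blast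
      then show ?thesis
      proof cases
        case 1
        then show ?thesis using ab_free[of k y2] that y2pos yab by blast
      next
        case 2
        have "q * (real b - real a) > 0" using q ba by simp
        moreover have "z (Suc j) + z (j - 1) - 2 * z j = - (real b - real a)" using zj by simp
        then have "q * (z (Suc j) + z (j - 1) - 2 * z j) = - (q * (real b - real a))"
          by (simp only: mult_minus_right)
        ultimately show ?thesis using y2c[of j] yc[OF that] unfolding 2 by linarith
      next
        case 3
        then show ?thesis using y2c[of k] zlin[of k] yc[of k] that by simp
      qed
    qed
    have feas: "feasible 1 d y'" if "y' 0 = 0" "y' d = 0" "\<And>k. k \<le> d \<Longrightarrow> 0 \<le> y' k"
      "\<And>k. 0 < k \<Longrightarrow> k < d \<Longrightarrow> 2 * y' k - 2 \<le> y' (Suc k) + y' (k - 1)" for y'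
      using that(1-3) that(4)[of "Suc _"] by (simp add: feasible_def)
    have e1: "y1 0 = 0" "y1 d = 0" "y2 0 = 0" "y2 d = 0"
      using y0 z0 bd by (auto simp: y1_def y2_def)
    have f1: "feasible 1 d y1" using feas[of y1] e1 y1pos c1 by blast
    have f2: "feasible 1 d y2" using feas[of y2] e1 y2pos c2 by blast
    have s1: "slack d y1 < slack d y"
    proof (rule slack_less)
      show "nonzeros d y1 \<subseteq> nonzeros d y" using y1z by (auto simp: nonzeros_def)
      show "loose d y1
          \<subseteq> loose d y"
      proof
        fix k assume "k \<in> loose d y1"
        then have k: "0 < k" "k < d" "y1 k \<noteq> 0" "y1 (Suc k) + y1 (k - 1) \<noteq> 2 * y1 k - 2" by (auto simp: loose_def)
        then have "k \<noteq> a" "k \<noteq> b" "k \<noteq> j" using yab y1j by auto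
        then show "k \<in> loose d y"
          using k y1z[of k] y1c[of k] zlin[of k] by (auto simp: loose_def)
      qed
      show "nonzeros d y1 \<noteq> nonzeros d y \<or>
        loose d y1
          \<noteq> loose d y"
        using j y1j by (auto simp: loose_def)
    qed
    have y2z: "y2 k = 0" if "y k = 0" "k \<le> d" for k
      using that nz[of k] z0[of k] by (cases "a < k \<and> k < b") (auto simp: y2_def)
    have y2l: "y2 l = 0" using l zpos[of l] by (simp add: y2_def)
    have s2: "slack d y2 < slack d y"
    proof (rule slack_less)
      show "nonzeros d y2 \<subseteq> nonzeros d y" using y2z by (auto simp: nonzeros_def)
      show "loose d y2
          \<subseteq> loose d y"
      proof
        fix k assume "k \<in> loose d y2"
        then have k: "0 < k" "k < d" "y2 k \<noteq> 0" "y2 (Suc k) + y2 (k - 1) \<noteq> 2 * y2 k - 2" by (auto simp: loose_def)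
        then have "k \<noteq> a" "k \<noteq> b" using yab by auto
        then show "k \<in> loose d y"
          using k y2z[of k] y2c[of k] zlin[of k] j by (cases "k = j") (auto simp: loose_def)
      qed
      have "l \<in> nonzeros d y" using l nz[of l] bd by (auto simp: nonzeros_def)
      moreover have "l \<notin> nonzeros d y2" using y2l by (auto simp: nonzeros_def)
      ultimately show "nonzeros d y2 \<noteq> nonzeros d y \<or>
        loose d y2
          \<noteq> loose d y" by blast
    qed
    have in12: "point_of d y1 \<in> P_132_213 d" "point_of d y2 \<in> P_132_213 d"
      using less.hyps[OF s1 f1] less.hyps[OF s2 f2] by auto
    define u where "u = q / (p + q)"
    define v where "v = p / (p + q)"
    have uv: "u \<ge> 0" "v \<ge> 0" "u + v = 1" "u * p = v * q"
      using p q by (auto simp: u_def v_def add_divide_distrib[symmetric])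
    have "y = (\<lambda>k. u * y1 k + v * y2 k)"
    proof
      fix k
      have "u * y1 k + v * y2 k = (u + v) * y k + (u * p - v * q) * z k"
        by (simp add: y1_def y2_def algebra_simps)
      then show "y k = u * y1 k + v * y2 k" using uv by simp
    qed
    then have "point_of d y = u *\<^sub>R point_of d y1 + v *\<^sub>R point_of d y2"
      using point_of_convex_comb[OF uv(3)] by metis
    moreover have "convex (P_132_213 d)"
      unfolding P_132_213_def pattern_polytope_def by (rule convex_convex_hull)
    ultimately show ?thesis using in12 uv by (simp add: convexD)
  qed
qed

text \<open>For \<open>m > 0\<close> this is rescaling. For \<open>m = 0\<close> the dilate is
  \<open>{0}\<close>, and the right side asks for a nonnegative convex sequence with zero ends,
  which vanishes.\<close>

lemma scaled_polytope_iff: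
  "v \<in> scaleR (real m) ` P_132_213 d \<longleftrightarrow>
    Poly_Mapping.keys v \<subseteq> {1..d} \<and> feasible (real m) d (gap (real m) d v)"
proof (cases "m = 0")
  case True
  have "point_of d (\<lambda>_. 0) \<in> P_132_213 d"
    by (rule feasible_imp_polytope) (simp add: feasible_def)
  then have "scaleR (real m) ` P_132_213 d = {0}" using True by auto
  moreover have "Poly_Mapping.keys v \<subseteq> {1..d} \<and> feasible 0 d (gap 0 d v) \<longleftrightarrow> v = 0"
  proof
    assume *: "Poly_Mapping.keys v \<subseteq> {1..d} \<and> feasible 0 d (gap 0 d v)"
    define y where "y = gap 0 d v"
    have y: "y 0 = 0" "y d = 0" "\<And>k. k \<le> d \<Longrightarrow> 0 \<le> y k"
      "\<And>k. Suc k < d \<Longrightarrow> 2 * y (Suc k) \<le> y (Suc (Suc k)) + y k"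
      using * by (auto simp: feasible_def y_def)
    have mono: "y (Suc i) - y i \<le> y (Suc j) - y j" if "i \<le> j" "j < d" for i j
      using that
    proof (induction j rule: dec_induct)
      case (step k)
      then show ?case using y(4)[of k] by simp
    qed simp
    have zero: "y k = 0" if "k \<le> d" for k
    proof -
      have "y (Suc i) - y i = 0" if "i < d" for i
      proof -
        have "0 \<le> y (Suc 0) - y 0" using y(1) y(3)[of "Suc 0"] that by simp
        moreover have "y (Suc (d - 1)) - y (d - 1) \<le> 0" using y(2) y(3)[of "d - 1"] that by simp
        moreover have "y (Suc 0) - y 0 \<le> y (Suc i) - y i" by (rule mono) (use that in auto)
        moreover have "y (Suc i) - y i \<le> y (Suc (d - 1)) - y (d - 1)" by (rule mono) (use that in auto)
        ultimately show ?thesis by linarith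
      qed
      then show ?thesis using that y(1) by (induction k) (simp_all add: Suc_le_eq)
    qed
    show "v = 0"
    proof (rule poly_mapping_eqI)
      fix j
      show "Poly_Mapping.lookup v j = Poly_Mapping.lookup 0 j"
      proof (cases "j \<in> {1..d}")
        case True
        then obtain i where "j = Suc i" "i < d" by (cases j) auto
        then show ?thesis using gap_Suc[of 0 d v i] zero[of "Suc i"] zero[of i] by (simp add: y_def)
      next
        case False
        then show ?thesis using * by (auto simp: in_keys_iff)
      qed
    qed
  qed (auto simp: feasible_def gap_def)
  ultimately show ?thesis using True by simp
next
  case False
  then have m: "real m > 0" by simp
  have "v \<in> scaleR (real m) ` P_132_213 d \<longleftrightarrow> (1 / real m) *\<^sub>R v \<in> P_132_213 d"
  proof
    assume "(1 / real m) *\<^sub>R v \<in> P_132_213 d"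
    moreover have "v = real m *\<^sub>R ((1 / real m) *\<^sub>R v)" using m by simp
    ultimately show "v \<in> scaleR (real m) ` P_132_213 d" by blast
  qed (use m in auto)
  also have "\<dots> \<longleftrightarrow> Poly_Mapping.keys ((1 / real m) *\<^sub>R v) \<subseteq> {1..d} \<and> feasible 1 d (gap 1 d ((1 / real m) *\<^sub>R v))"
    using polytope_imp_feasible[of _ d] feasible_imp_polytope[of d] point_of_gap[of _ d] by metis
  also have "Poly_Mapping.keys ((1 / real m) *\<^sub>R v) = Poly_Mapping.keys v"
    using m by (auto simp: in_keys_iff)
  also have "feasible 1 d (gap 1 d ((1 / real m) *\<^sub>R v)) \<longleftrightarrow> feasible (real m) d (gap (real m) d v)"
  proof -
    have "gap (real m) d v = (\<lambda>k. real m * gap 1 d ((1 / real m) *\<^sub>R v) k)"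
      using gap_scale[of "real m" d "(1 / real m) *\<^sub>R v"] m by (intro ext) simp
    then show ?thesis using feasible_scale[OF m, of d "gap 1 d ((1 / real m) *\<^sub>R v)"] by simp
  qed
  finally show ?thesis .
qed

text \<open>The steps are the increments of the gaps: \<open>walk\<close> is then the gap itself,
  and the condition on second differences compares consecutive steps.\<close>

lemma card_lattice_points:
  "card (scaleR (real m) ` P_132_213 d \<inter> integer_lattice d) = card (excursions m d)"
proof -
  let ?X = "scaleR (real m) ` P_132_213 d \<inter> integer_lattice d"
  define f where "f v = map (\<lambda>i. int m * int (d - i) - \<lfloor>Poly_Mapping.lookup v (Suc i)\<rfloor>) [0..<d]" for v :: finvec
  define g where "g s = (\<Sum>i<d. Poly_Mapping.single (Suc i) (real m * real (d - i) - real_of_int (s ! i)))" for s :: "int list"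
  have lg: "Poly_Mapping.lookup (g s) j
      = (if j \<in> {1..d} then real m * real (d - (j - 1)) - real_of_int (s ! (j - 1)) else 0)" for s j
  proof -
    have "Poly_Mapping.lookup (g s) j
        = (\<Sum>i<d. if Suc i = j then real m * real (d - i) - real_of_int (s ! i) else 0)"
      by (auto simp: g_def lookup_sum lookup_single when_def intro!: sum.cong)
    also have "\<dots> = (\<Sum>i\<in>{..<d} \<inter> {i. Suc i = j}. real m * real (d - i) - real_of_int (s ! i))"
      by (subst sum.inter_restrict) auto
    also have "{..<d} \<inter> {i. Suc i = j} = (if j \<in> {1..d} then {j - 1} else {})" by auto
    finally show ?thesis by auto
  qed
  have key: "s \<in> excursions m d \<longleftrightarrow> feasible (real m) d (\<lambda>k. real_of_int (walk s k))" if "length s = d" for s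
  proof -
    have "(s ! k - 2 * int m \<le> s ! Suc k) \<longleftrightarrow> 2 * real_of_int (walk s (Suc k)) - 2 * real m
        \<le> real_of_int (walk s (Suc (Suc k))) + real_of_int (walk s k)" if "Suc k < d" for k
      using that \<open>length s = d\<close> by (auto simp: walk_Suc)
    then show ?thesis using that by (auto simp: excursions_def feasible_def)
  qed
  have gw: "gap (real m) d (g s) k = real_of_int (walk s k)" if "length s = d" "k \<le> d" for s k
    using that(2) by (induction k) (simp_all add: gap_Suc lg walk_Suc that(1), simp add: gap_def)
  have fe: "feasible r d y \<longleftrightarrow> feasible r d y'" if "\<And>k. k \<le> d \<Longrightarrow> y k = y' k" for r y y'
    using that by (auto simp: feasible_def)
  have gin: "g s \<in> ?X" if s: "s \<in> excursions m d" for s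
  proof -
    have len: "length s = d" using s by (simp add: excursions_def)
    have "feasible (real m) d (gap (real m) d (g s))"
      using key[OF len] s fe[of "gap (real m) d (g s)" "\<lambda>k. real_of_int (walk s k)"] gw[OF len] by blast
    moreover have k: "Poly_Mapping.keys (g s) \<subseteq> {1..d}" by (auto simp: in_keys_iff lg split: if_splits)
    moreover have "Poly_Mapping.lookup (g s) i \<in> \<int>" for i by (auto simp: lg)
    ultimately show ?thesis by (auto simp: scaled_polytope_iff integer_lattice_def)
  qed
  have gf: "g (f v) = v" if v: "v \<in> ?X" for v
  proof (rule poly_mapping_eqI)
    fix j
    have k: "Poly_Mapping.keys v \<subseteq> {1..d}" and i: "Poly_Mapping.lookup v j \<in> \<int>"
      using v by (auto simp: integer_lattice_def)
    then have fl: "real_of_int \<lfloor>Poly_Mapping.lookup v j\<rfloor> = Poly_Mapping.lookup v j" by (auto elim: Ints_cases)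
    show "Poly_Mapping.lookup (g (f v)) j = Poly_Mapping.lookup v j"
    proof (cases "j \<in> {1..d}")
      case True
      then show ?thesis using fl by (auto simp: lg f_def)
    next
      case False
      then show ?thesis using k by (auto simp: lg in_keys_iff)
    qed
  qed
  have fg: "f (g s) = s" if "length s = d" for s
  proof (rule nth_equalityI)
    fix i assume "i < length (f (g s))"
    then have i: "i < d" by (simp add: f_def)
    have "real m * real (d - i) - real_of_int (s ! i) = real_of_int (int m * int (d - i) - s ! i)"
      by (simp only: of_int_diff of_int_mult of_int_of_nat_eq)
    moreover have "Poly_Mapping.lookup (g s) (Suc i) = real m * real (d - i) - real_of_int (s ! i)"
      using i by (simp add: lg)
    ultimately have "\<lfloor>Poly_Mapping.lookup (g s) (Suc i)\<rfloor> = int m * int (d - i) - s ! i"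
      by (simp only: floor_of_int)
    then show "f (g s) ! i = s ! i" using i by (simp add: f_def)
  qed (simp add: f_def that)
  have fin: "f v \<in> excursions m d" if v: "v \<in> ?X" for v
  proof -
    have len: "length (f v) = d" by (simp add: f_def)
    have "feasible (real m) d (gap (real m) d v)" using v by (auto simp: scaled_polytope_iff)
    then have "feasible (real m) d (gap (real m) d (g (f v)))" using gf[OF v] by simp
    then show ?thesis
      using key[OF len] fe[of "gap (real m) d (g (f v))" "\<lambda>k. real_of_int (walk (f v) k)"] gw[OF len] by blast
  qed
  have "bij_betw f ?X (excursions m d)"
  proof (rule bij_betw_byWitness[where f' = g])
    show "\<forall>v\<in>?X. g (f v) = v" using gf by blast
    show "\<forall>s\<in>excursions m d. f (g s) = s" using fg by (simp add: excursions_def)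
  qed (use fin gin in blast)+
  then show ?thesis by (rule bij_betw_same_card)
qed

section \<open>Eulerian polynomials and their zeros\<close>

text \<open>The operator \<open>t * d/dt\<close> on \<open>p / (1 - t) ^ N\<close>, expressed by
  numerators; the new denominator is \<open>(1 - t) ^ Suc N\<close>.\<close>

definition eul_step :: "nat \<Rightarrow> real poly \<Rightarrow> real poly" where
  "eul_step N p = [:0, 1:] * ([:1, -1:] * pderiv p + smult (real N) p)"

text \<open>Numerator of the series of \<open>m ^ i * (1 + m) ^ j\<close> over
  \<open>(1 - t) ^ Suc (i + j)\<close>, see \<open>fps_eul\<close>; the \<open>A_i\<close> of the
  overview is \<open>eul i (d - 1 - i)\<close>. Multiplication by \<open>1 + m\<close> is
  \<open>t * d/dt + 1\<close>, whence the extra term in the second clause.\<close>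

fun eul :: "nat \<Rightarrow> nat \<Rightarrow> real poly" where
  "eul 0 0 = 1"
| "eul 0 (Suc j) = eul_step (Suc j) (eul 0 j) + [:1, -1:] * eul 0 j"
| "eul (Suc i) j = eul_step (Suc (i + j)) (eul i j)"

lemma eul_step_mult:
  "eul_step (Suc N) ([:1, -1:] * p) = [:1, -1:] * eul_step N p"
proof -
  define w where "w = [:1, -1 :: real:]"
  have w: "pderiv w = -1" by (simp add: w_def pderiv_pCons one_pCons)
  have d: "pderiv (w * p) = w * pderiv p - p" by (simp add: pderiv_mult w)
  have s: "smult (real (Suc N)) q = smult (real N) q + q" for q :: "real poly"
    by (simp add: smult_add_left algebra_simps)
  show ?thesis
    unfolding eul_step_def w_def[symmetric] d s
    by (simp add: algebra_simps smult_add_right del: mult_pCons_left mult_pCons_right)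
qed

lemma eul_step_add: "eul_step N (p + q) = eul_step N p + eul_step N q"
  unfolding eul_step_def by (simp add: pderiv_add smult_add_right algebra_simps)

text \<open>This is \<open>(1 + m) - m = 1\<close> on the level of series; passing to the lower
  level costs a factor \<open>1 - t\<close>.\<close>

lemma eul_diff: "eul i (Suc j) = eul (Suc i) j + [:1, -1:] * eul i j"
proof (induction i)
  case (Suc i)
  have "eul (Suc i) (Suc j) = eul_step (Suc (Suc (i + j))) (eul (Suc i) j + [:1, -1:] * eul i j)"
    using Suc.IH by simp
  then show ?case
    by (simp only: eul_step_add eul_step_mult eul.simps add_Suc)
qed simp

lemma fps_of_poly_eul_step:
  assumes "fps_of_poly p = (1 - fps_X) ^ N * F"
  shows "fps_of_poly (eul_step N p) = (1 - fps_X) ^ Suc N * (fps_X * fps_deriv F)"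
proof -
  define w where "w = (1 - fps_X :: real fps)"
  define c where "c = fps_const (real N)"
  have w: "fps_of_poly [:1, -1:] = w"
    by (simp add: fps_of_poly_pCons w_def)
  have dw: "fps_deriv w = -1" by (simp add: w_def)
  have p: "fps_of_poly p = w ^ N * F" using assms by (simp add: w_def)
  have cw: "w * (c * w ^ (N - 1)) = c * w ^ N"
    by (cases N) (simp_all add: c_def algebra_simps)
  have "fps_deriv (fps_of_poly p) = w ^ N * fps_deriv F - c * w ^ (N - 1) * F"
    unfolding p by (simp add: fps_deriv_power dw c_def[symmetric] algebra_simps)
  then have "w * fps_deriv (fps_of_poly p) = w ^ Suc N * fps_deriv F - w * (c * w ^ (N - 1)) * F"
    by (simp only: right_diff_distrib power_Suc mult.assoc)
  then have "w * fps_deriv (fps_of_poly p) + c * fps_of_poly p = w ^ Suc N * fps_deriv F"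
    unfolding cw by (simp add: p algebra_simps)
  then have "fps_X * (w * fps_deriv (fps_of_poly p) + c * fps_of_poly p)
      = w ^ Suc N * (fps_X * fps_deriv F)"
    by (simp add: algebra_simps)
  moreover have "fps_of_poly (eul_step N p)
      = fps_X * (w * fps_deriv (fps_of_poly p) + c * fps_of_poly p)"
    unfolding eul_step_def fps_of_poly_mult fps_of_poly_add w fps_of_poly_smult c_def
      fps_of_poly_pderiv by (simp add: fps_of_poly_pCons)
  ultimately show ?thesis by (simp add: w_def)
qed

lemma fps_eul:
  "fps_of_poly (eul i j) =
    (1 - fps_X) ^ Suc (i + j) * Abs_fps (\<lambda>m. real m ^ i * (1 + real m) ^ j)"
proof (induction i j rule: eul.induct)
  case 1
  have "(1 - fps_X) * Abs_fps (\<lambda>_. 1) = (1 :: real fps)"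
    by (rule fps_ext) (simp add: algebra_simps)
  then show ?case by simp
next
  case (2 j)
  let ?F = "Abs_fps (\<lambda>m. (1 + real m) ^ j)"
  define w where "w = (1 - fps_X :: real fps)"
  have IH: "fps_of_poly (eul 0 j) = (1 - fps_X) ^ Suc j * ?F" using 2 by simp
  have F: "Abs_fps (\<lambda>m. (1 + real m) ^ Suc j) = fps_X * fps_deriv ?F + ?F"
    by (rule fps_ext) (simp add: algebra_simps)
  have w: "fps_of_poly [:1, -1:] = w"
    by (simp add: fps_of_poly_pCons w_def)
  have "fps_of_poly (eul 0 (Suc j))
      = w ^ Suc (Suc j) * (fps_X * fps_deriv ?F) + w * (w ^ Suc j * ?F)"
    unfolding eul.simps fps_of_poly_add fps_of_poly_mult fps_of_poly_eul_step[OF IH] IH w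
    by (simp add: w_def)
  also have "\<dots> = w ^ Suc (Suc j) * Abs_fps (\<lambda>m. (1 + real m) ^ Suc j)"
    unfolding F by (simp only: distrib_left mult.assoc power_Suc)
  finally show ?case by (simp add: w_def)
next
  case (3 i j)
  let ?F = "Abs_fps (\<lambda>m. real m ^ i * (1 + real m) ^ j)"
  have "fps_X * fps_deriv ?F = Abs_fps (\<lambda>m. real m ^ Suc i * (1 + real m) ^ j)"
    by (rule fps_ext) (simp add: algebra_simps)
  then show ?case
    using fps_of_poly_eul_step[OF 3] by simp
qed

text \<open>The sequence \<open>m ^ Suc D\<close> is \<open>(1 + m) ^ Suc D\<close> shifted by one
  place, because its term at \<open>m = 0\<close> vanishes.\<close>

lemma eul_top: "eul (Suc D) 0 = [:0, 1:] * eul 0 (Suc D)"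
proof -
  have "Abs_fps (\<lambda>m. real m ^ Suc D) = fps_X * Abs_fps (\<lambda>m. (1 + real m) ^ Suc D)"
    by (rule fps_ext) (simp add: fps_X_mult_nth of_nat_diff)
  then have "fps_of_poly (eul (Suc D) 0) = fps_of_poly ([:0, 1:] * eul 0 (Suc D))"
    unfolding fps_of_poly_mult fps_eul by (simp add: fps_of_poly_pCons algebra_simps)
  then show ?thesis by (simp only: fps_of_poly_eq_iff)
qed

lemma coeff_eul_step_0 [simp]: "coeff (eul_step N p) 0 = 0"
  by (simp add: eul_step_def)

lemma coeff_eul_step_Suc:
  "coeff (eul_step N p) (Suc k) = real (Suc k) * coeff p (Suc k) + (real N - real k) * coeff p k"
  by (cases k) (simp_all add: eul_step_def coeff_pderiv algebra_simps)

lemma coeff_one_minus_Suc: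
  "coeff ([:1, -1:] * p) (Suc k) = coeff p (Suc k) - (coeff p k :: real)"
  by simp

lemma coeff_eul_gt: "k > i + j \<or> k = i + j \<and> j > 0 \<Longrightarrow> coeff (eul i j) k = 0"
proof (induction i j arbitrary: k rule: eul.induct)
  case 1
  then show ?case by (cases k) auto
next
  case (2 j)
  then obtain k' where k: "k = Suc k'" "k' \<ge> j" by (cases k) auto
  have a: "coeff (eul 0 j) (Suc k') = 0" using 2 k by simp
  have b: "coeff (eul 0 j) k' = 0" if "k' > j" using 2(1)[of k'] that by auto
  show ?case
  proof (cases "k' = j")
    case True
    then show ?thesis using a by (simp add: k coeff_eul_step_Suc)
  next
    case False
    then have "k' > j" using k by simp
    then show ?thesis using a b k by (simp add: coeff_eul_step_Suc)
  qed
next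
  case (3 i j)
  then obtain k' where k: "k = Suc k'" "k' > i + j \<or> k' = i + j \<and> j > 0" by (cases k) auto
  with 3(1)[of k'] 3(1)[of k] show ?case by (auto simp: coeff_eul_step_Suc)
qed

lemma degree_eul: "degree (eul i j) \<le> i + j"
  by (rule degree_le) (auto intro: coeff_eul_gt)

lemma degree_eul_less: "degree (eul i (Suc j)) \<le> i + j"
proof (rule degree_le, intro allI impI)
  fix k assume "i + j < k"
  then show "coeff (eul i (Suc j)) k = 0" by (intro coeff_eul_gt) auto
qed

lemma coeff_eul_lead: "coeff (eul 0 (Suc j)) j = 1"
proof (induction j)
  case (Suc j)
  have "coeff (eul 0 (Suc j)) (Suc j) = 0" by (rule coeff_eul_gt) simp
  with Suc show ?case
    by (simp only: eul.simps(2)[of "Suc j"] coeff_add coeff_eul_step_Suc coeff_one_minus_Suc) simp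
qed (simp add: eul_step_def)

lemma coeff_eul_0: "coeff (eul 0 j) 0 = 1"
  by (induction j) (simp_all)

lemma coeff_eul_top: "coeff (eul D 0) D = 1"
  by (cases D) (simp_all add: eul_top coeff_eul_lead del: eul.simps(2,3))

declare eul.simps(2,3) [simp del]

text \<open>Telescoping \<open>eul_diff\<close> over level \<open>Suc D\<close> gives
  \<open>1 - t\<close> times the sum. By \<open>eul_top\<close> the last term is \<open>t\<close>
  times the first, so the same factor appears on the left and cancels.\<close>

lemma poly_eul_sum:
  assumes "t < (0 :: real)"
  shows "poly (eul 0 (Suc D)) t = (\<Sum>l\<le>D. poly (eul l (D - l)) t)"
proof -
  have tel: "k \<le> Suc D \<Longrightarrow> poly (eul 0 (Suc D)) t - poly (eul k (Suc D - k)) t =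
      (1 - t) * (\<Sum>l<k. poly (eul l (D - l)) t)" for k
  proof (induction k)
    case (Suc k)
    have "eul k (Suc D - k) = eul (Suc k) (D - k) + [:1, -1:] * eul k (D - k)"
      using eul_diff[of k "D - k"] Suc.prems by (simp add: Suc_diff_le)
    with Suc show ?case by (simp add: algebra_simps)
  qed simp
  have "(1 - t) * poly (eul 0 (Suc D)) t = (1 - t) * (\<Sum>l<Suc D. poly (eul l (D - l)) t)"
    using tel[of "Suc D"] by (simp add: eul_top algebra_simps)
  with assms show ?thesis by (simp add: lessThan_Suc_atMost)
qed

lemma poly_eul_step:
  "poly (eul_step N p) t = t * ((1 - t) * poly (pderiv p) t + real N * poly p t)"
  by (simp add: eul_step_def algebra_simps)

text \<open>The common sign of the values \<open>A\<^sub>i\<close> at a zero of \<open>A\<^sub>0\<close>: differencing lowers the level by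
  one, so a sequence with one sign change is summed to a valley or a hill.\<close>

definition one_change :: "(nat \<Rightarrow> real) \<Rightarrow> nat \<Rightarrow> bool" where
  "one_change a n \<longleftrightarrow> (\<exists>\<sigma> p. (\<sigma> = 1 \<or> \<sigma> = -1) \<and>
     (\<forall>i\<le>n. (i < p \<longrightarrow> \<sigma> * a i \<ge> 0) \<and> (i \<ge> p \<longrightarrow> \<sigma> * a i \<le> 0)))"

lemma one_change_valley:
  assumes "one_change a n" and diff: "\<And>i. i \<le> n \<Longrightarrow> A i - A (Suc i) = c * a i"
    and "c > (0 :: real)"
  shows "\<exists>\<sigma> p. (\<sigma> = 1 \<or> \<sigma> = (-1 :: real)) \<and>
    (\<forall>i j. i \<le> j \<longrightarrow> j \<le> p \<longrightarrow> j \<le> Suc n \<longrightarrow> \<sigma> * A j \<le> \<sigma> * A i) \<and>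
    (\<forall>i j. p \<le> i \<longrightarrow> i \<le> j \<longrightarrow> j \<le> Suc n \<longrightarrow> \<sigma> * A i \<le> \<sigma> * A j)"
proof -
  from assms(1) obtain \<sigma> p where s: "\<sigma> = 1 \<or> \<sigma> = -1"
    and pos: "\<And>i. i \<le> n \<Longrightarrow> i < p \<Longrightarrow> \<sigma> * a i \<ge> 0"
    and neg: "\<And>i. i \<le> n \<Longrightarrow> i \<ge> p \<Longrightarrow> \<sigma> * a i \<le> 0"
    unfolding one_change_def by blast
  have d: "\<sigma> * A i - \<sigma> * A (Suc i) = c * (\<sigma> * a i)" if "i \<le> n" for i
    using diff[OF that] by (metis mult.left_commute right_diff_distrib)
  have dec: "\<sigma> * A (Suc i) \<le> \<sigma> * A i" if "i \<le> n" "i < p" for i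
    using d[OF that(1)] pos[OF that] \<open>c > 0\<close> by (metis diff_ge_0_iff_ge mult_nonneg_nonneg less_imp_le)
  have inc: "\<sigma> * A i \<le> \<sigma> * A (Suc i)" if "i \<le> n" "i \<ge> p" for i
    using d[OF that(1)] neg[OF that] \<open>c > 0\<close>
    by (metis diff_le_0_iff_le mult_nonneg_nonpos less_imp_le)
  show ?thesis
  proof (intro exI[of _ \<sigma>] exI[of _ p] conjI allI impI)
    fix i j assume "i \<le> j" "j \<le> p" "j \<le> Suc n"
    then show "\<sigma> * A j \<le> \<sigma> * A i"
    proof (induction j rule: dec_induct)
      case (step k)
      then show ?case using dec[of k] by auto
    qed simp
  next
    fix i j assume "p \<le> i" "i \<le> j" "j \<le> Suc n"
    from this(2,1,3) show "\<sigma> * A i \<le> \<sigma> * A j"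
    proof (induction j rule: dec_induct)
      case (step k)
      then show ?case using inc[of k] by auto
    qed simp
  qed (fact s)
qed

text \<open>One sign change in the differences makes a valley or a hill. Its ends are
  \<open>A 0\<close> and \<open>z * A 0\<close> with \<open>z < 0\<close>, so it crosses the level 0
  only once.\<close>

lemma one_change_step:
  assumes "one_change a n" and "\<And>i. i \<le> n \<Longrightarrow> A i - A (Suc i) = c * a i"
    and "c > (0 :: real)" and last: "A (Suc n) = z * A 0" and "z < 0"
  shows "one_change A (Suc n)"
proof -
  obtain \<sigma> p where s: "\<sigma> = 1 \<or> \<sigma> = (-1 :: real)"
    and dec: "\<And>i j. i \<le> j \<Longrightarrow> j \<le> p \<Longrightarrow> j \<le> Suc n \<Longrightarrow> \<sigma> * A j \<le> \<sigma> * A i"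
    and inc: "\<And>i j. p \<le> i \<Longrightarrow> i \<le> j \<Longrightarrow> j \<le> Suc n \<Longrightarrow> \<sigma> * A i \<le> \<sigma> * A j"
    using one_change_valley[where A = A, OF assms(1) assms(2) assms(3)] by blast
  have l: "\<sigma> * A (Suc n) = z * (\<sigma> * A 0)" using last by simp
  show ?thesis
  proof (cases "\<sigma> * A 0 \<ge> 0")
    case True
    then have l0: "\<sigma> * A (Suc n) \<le> 0" unfolding l using \<open>z < 0\<close> by (simp add: mult_nonpos_nonneg)
    define q where "q = (LEAST q. q = Suc (Suc n) \<or> \<sigma> * A q < 0)"
    have q1: "q = Suc (Suc n) \<or> \<sigma> * A q < 0" unfolding q_def by (rule LeastI) blast
    have q2: "\<sigma> * A i \<ge> 0" if "i < q" for i
      using not_less_Least[OF that[unfolded q_def]] by auto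
    have "\<sigma> * A i \<le> 0" if "i \<ge> q" "i \<le> Suc n" for i
    proof (cases "i \<ge> p")
      case True
      then show ?thesis using inc[of i "Suc n"] that l0 by linarith
    next
      case False
      then show ?thesis using dec[of q i] that q1 by auto
    qed
    with q2 s show ?thesis unfolding one_change_def by blast
  next
    case False
    then have l0: "\<sigma> * A (Suc n) > 0" unfolding l using \<open>z < 0\<close> by (simp add: mult_neg_neg)
    define q where "q = (LEAST q. q = Suc n \<or> \<sigma> * A q > 0)"
    have q1: "q = Suc n \<or> \<sigma> * A q > 0" unfolding q_def by (rule LeastI) blast
    then have q1: "\<sigma> * A q > 0" using l0 by auto
    have q3: "q \<le> Suc n" unfolding q_def by (rule Least_le) simp
    have q2: "\<sigma> * A i \<le> 0" if "i < q" for i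
      using not_less_Least[OF that[unfolded q_def]] by auto
    have qp: "p < q"
    proof (rule ccontr)
      assume "\<not> p < q"
      then have "\<sigma> * A q \<le> \<sigma> * A 0" using dec[of 0 q] q3 by auto
      then show False using q1 False by linarith
    qed
    have "\<sigma> * A i \<ge> 0" if "i \<ge> q" "i \<le> Suc n" for i
      using inc[of q i] qp that q1 by auto
    with q2 have "\<forall>i\<le>Suc n. (i < q \<longrightarrow> (-\<sigma>) * A i \<ge> 0) \<and> (i \<ge> q \<longrightarrow> (-\<sigma>) * A i \<le> 0)" by auto
    moreover have "-\<sigma> = 1 \<or> -\<sigma> = -1" using s by auto
    ultimately show ?thesis unfolding one_change_def by blast
  qed
qed

lemma one_change_eul:
  assumes "z < 0"
  shows "one_change (\<lambda>i. poly (eul i (D - i)) z) D"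
proof (induction D)
  case 0
  show ?case unfolding one_change_def by (intro exI[of _ 1]) auto
next
  case (Suc D)
  show ?case
  proof (rule one_change_step[OF Suc _ _ _ assms, of _ "1 - z"])
    fix i assume "i \<le> D"
    then show "poly (eul i (Suc D - i)) z - poly (eul (Suc i) (Suc D - Suc i)) z
        = (1 - z) * poly (eul i (D - i)) z"
      by (simp add: Suc_diff_le eul_diff algebra_simps)
  qed (use assms in \<open>simp_all add: eul_top del: eul.simps\<close>)
qed

section \<open>Interlacing zeros of the Eulerian polynomials\<close>

lemma poly_eq_prod_roots:
  fixes p :: "real poly"
  assumes "degree p \<le> card S" "finite S" "\<And>x. x \<in> S \<Longrightarrow> poly p x = 0"
  shows "p = smult (coeff p (card S)) (\<Prod>x\<in>S. [:-x, 1:])"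
proof (rule poly_eqI_degree_lead_coeff[where A = S and n = "card S"])
  have dq: "degree (\<Prod>x\<in>S. [:-x, 1 :: real:]) = card S"
    by (subst degree_prod_eq_sum_degree) auto
  have "lead_coeff (\<Prod>x\<in>S. [:-x, 1 :: real:]) = 1" by (simp add: lead_coeff_prod)
  then show "coeff p (card S) = coeff (smult (coeff p (card S)) (\<Prod>x\<in>S. [:-x, 1:])) (card S)"
    using dq by simp
  show "degree (smult (coeff p (card S)) (\<Prod>x\<in>S. [:-x, 1:])) \<le> card S"
    using degree_smult_le dq by metis
qed (use assms in \<open>auto simp: poly_prod\<close>)

lemma sign_changes_imp_roots:
  fixes p :: "real poly" and x :: "nat \<Rightarrow> real"
  assumes dec: "\<And>k. k < n \<Longrightarrow> x (Suc k) < x k"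
    and sgn: "\<And>k. k \<le> n \<Longrightarrow> (-1) ^ k * poly p (x k) > 0"
  obtains z where "\<And>k. k < n \<Longrightarrow> x (Suc k) < z k \<and> z k < x k \<and> poly p (z k) = 0"
    "inj_on z {..<n}" "\<And>k. Suc k < n \<Longrightarrow> z (Suc k) < z k"
proof -
  have "\<exists>z. x (Suc k) < z \<and> z < x k \<and> poly p z = 0" if "k < n" for k
  proof (cases "even k")
    case True
    then have "poly p (x (Suc k)) < 0" "poly p (x k) > 0"
      using sgn[of k] sgn[of "Suc k"] that by auto
    then show ?thesis using poly_IVT_pos[OF dec[OF that]] by blast
  next
    case False
    then have "poly p (x (Suc k)) > 0" "poly p (x k) < 0"
      using sgn[of k] sgn[of "Suc k"] that by auto
    then show ?thesis using poly_IVT_neg[OF dec[OF that]] by blast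
  qed
  then obtain z where z: "\<And>k. k < n \<Longrightarrow> x (Suc k) < z k \<and> z k < x k \<and> poly p (z k) = 0"
    by metis
  have st: "z (Suc k) < z k" if "Suc k < n" for k
    using z[of k] z[of "Suc k"] that by linarith
  have mono: "z l < z k" if "k < l" "l < n" for k l
    using that
  proof (induction l)
    case (Suc l)
    then show ?case using st[of l] by (cases "k = l") auto
  qed simp
  then have "inj_on z {..<n}"
    by (intro linorder_inj_onI) fastforce+
  with z st show ?thesis using that by blast
qed


lemma pderiv_prod_roots_sign:
  fixes z :: "nat \<Rightarrow> real"
  assumes dec: "\<And>i j. i < j \<Longrightarrow> j < n \<Longrightarrow> z j < z i" and "k < n"
  shows "(-1) ^ k * poly (pderiv (\<Prod>k<n. [:-z k, 1:])) (z k) > 0"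
proof -
  have "poly (pderiv (\<Prod>k<n. [:-z k, 1:])) (z k)
      = (\<Sum>a<n. \<Prod>j\<in>{..<n} - {a}. z k - z j)"
    by (simp add: pderiv_prod poly_sum poly_prod pderiv_pCons)
  also have "\<dots> = (\<Sum>a\<in>{k}. \<Prod>j\<in>{..<n} - {a}. z k - z j)"
  proof (rule sum.mono_neutral_right)
    show "\<forall>a\<in>{..<n} - {k}. (\<Prod>j\<in>{..<n} - {a}. z k - z j) = 0"
      using \<open>k < n\<close> by (auto intro: prod_zero)
  qed (use \<open>k < n\<close> in auto)
  also have "\<dots> = (\<Prod>j\<in>{..<k} \<union> {k<..<n}. z k - z j)"
    using \<open>k < n\<close> by (auto intro!: prod.cong)
  also have "\<dots> = (\<Prod>j<k. z k - z j) * (\<Prod>j\<in>{k<..<n}. z k - z j)"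
    by (rule prod.union_disjoint) auto
  also have "(\<Prod>j<k. z k - z j) = (\<Prod>j<k. (-1) * (z j - z k))" by simp
  also have "\<dots> = (-1) ^ k * (\<Prod>j<k. z j - z k)" by (subst prod.distrib) simp
  finally have "(-1) ^ k * poly (pderiv (\<Prod>k<n. [:-z k, 1:])) (z k)
      = (\<Prod>j<k. z j - z k) * (\<Prod>j\<in>{k<..<n}. z k - z j)"
    by (simp add: power_mult_distrib[symmetric] flip: mult.assoc)
  also have "\<dots> > 0"
    using dec \<open>k < n\<close> by (intro mult_pos_pos prod_pos) auto
  finally show ?thesis .
qed

lemma poly_sign_at_bot:
  fixes p :: "real poly"
  assumes "degree p \<le> n" "coeff p n > 0"
  obtains b where "b < c" "(-1) ^ n * poly p b > 0"
proof -
  have n: "degree p = n" using assms by (simp add: antisym le_degree)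
  let ?q = "smult ((-1) ^ n) (pcompose p [:0, -1:])"
  have "lead_coeff (pcompose p [:0, -1:]) = lead_coeff p * (-1) ^ n"
    by (subst lead_coeff_comp) (auto simp: n)
  then have "lead_coeff ?q = lead_coeff p"
    by (simp add: lead_coeff_smult flip: power_mult_distrib)
  then have "lead_coeff ?q > 0" using n assms by simp
  from poly_pinfty_gt_lc[OF this] obtain m where m: "\<And>x. x \<ge> m \<Longrightarrow> poly ?q x \<ge> lead_coeff ?q"
    by auto
  let ?x = "max m (1 - c)"
  have "poly ?q ?x > 0" using m[of ?x] \<open>lead_coeff ?q > 0\<close> by simp
  then have "(-1) ^ n * poly p (- ?x) > 0" by (simp add: poly_pcompose)
  moreover have "- ?x < c" by simp
  ultimately show ?thesis using that by blast
qed

lemma dec_chain: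
  fixes z :: "nat \<Rightarrow> real"
  assumes "\<And>k. Suc k < n \<Longrightarrow> z (Suc k) < z k" "i < j" "j < n"
  shows "z j < z i"
  using assms(2,3)
proof (induction j)
  case (Suc l)
  then show ?case using assms(1)[of l] by (cases "i = l") auto
qed simp

lemma poly_eul_Suc_at_root:
  assumes "poly (eul 0 j) z = 0"
  shows "poly (eul 0 (Suc j)) z = z * (1 - z) * poly (pderiv (eul 0 j)) z"
  using assms by (simp add: eul.simps(2) poly_eul_step)

text \<open>At a zero \<open>z\<close> of an Eulerian polynomial the next one equals
  \<open>z * (1 - z)\<close> times the derivative, and derivatives at consecutive simple zeros
  alternate in sign.\<close>

lemma eul_next_sign:
  assumes neg: "\<And>k. k < n \<Longrightarrow> z k < 0" and dec: "\<And>k. Suc k < n \<Longrightarrow> z (Suc k) < z k"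
    and fac: "eul 0 (Suc n) = (\<Prod>k<n. [:-z k, 1:])" and "k < n"
  shows "(-1) ^ Suc k * poly (eul 0 (Suc (Suc n))) (z k) > 0"
proof -
  have "poly (eul 0 (Suc n)) (z k) = 0"
    unfolding fac using \<open>k < n\<close> by (auto simp: poly_prod intro: prod_zero)
  then have p: "poly (eul 0 (Suc (Suc n))) (z k)
      = z k * (1 - z k) * poly (pderiv (eul 0 (Suc n))) (z k)"
    by (rule poly_eul_Suc_at_root)
  have "(-1) ^ k * poly (pderiv (eul 0 (Suc n))) (z k) > 0"
    unfolding fac
    by (rule pderiv_prod_roots_sign[OF dec_chain[where z = z and n = n, OF dec] \<open>k < n\<close>])
  moreover have "- z k * (1 - z k) > 0" using neg[OF \<open>k < n\<close>] by (intro mult_pos_pos) auto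
  ultimately have "(- z k * (1 - z k)) * ((-1) ^ k * poly (pderiv (eul 0 (Suc n))) (z k)) > 0"
    by (rule mult_pos_pos[rotated])
  then show ?thesis unfolding p by (simp add: algebra_simps)
qed

text \<open>In the induction step the next polynomial alternates in sign along 0, the
  \<open>n\<close> zeros of the present one, and a point far to the left; this yields
  \<open>n + 1\<close> zeros.\<close>

lemma eulerian_zeros:
  "\<exists>z. (\<forall>k<n. z k < 0) \<and> (\<forall>k. Suc k < n \<longrightarrow> z (Suc k) < z k) \<and>
     eul 0 (Suc n) = (\<Prod>k<n. [:-z k, 1:])"
proof (induction n)
  case 0
  show ?case by (simp add: eul.simps(2) eul_step_def)
next
  case (Suc n)
  then obtain z where neg: "\<And>k. k < n \<Longrightarrow> z k < 0"
    and dec: "\<And>k. Suc k < n \<Longrightarrow> z (Suc k) < z k"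
    and fac: "eul 0 (Suc n) = (\<Prod>k<n. [:-z k, 1:])" by blast
  let ?p = "eul 0 (Suc (Suc n))"
  have deg: "degree ?p \<le> Suc n" using degree_eul_less[of 0 "Suc n"] by simp
  have lead: "coeff ?p (Suc n) = 1" by (rule coeff_eul_lead)
  obtain b where b: "b < (if n = 0 then 0 else z (n - 1))" "(-1) ^ Suc n * poly ?p b > 0"
    using poly_sign_at_bot[OF deg, of "if n = 0 then 0 else z (n - 1)"] lead by auto
  define x where "x k = (if k = 0 then 0 else if k = Suc n then b else z (k - 1))" for k
  have sgn: "(-1) ^ Suc k * poly ?p (z k) > 0" if "k < n" for k
    using eul_next_sign[OF neg dec fac that] .
  have xdec: "x (Suc k) < x k" if "k < Suc n" for k
  proof (cases "k = n")
    case True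
    then show ?thesis using b(1) by (auto simp: x_def)
  next
    case False
    with that have "k < n" by simp
    then show ?thesis using neg[of k] dec[of "k - 1"] by (cases k) (auto simp: x_def)
  qed
  have xsgn: "(-1) ^ k * poly ?p (x k) > 0" if kle: "k \<le> Suc n" for k
  proof -
    consider "k = 0" | "k = Suc n" | k' where "k = Suc k'" "k' < n"
      using kle by (cases k) (auto simp: le_less)
    then show ?thesis
    proof cases
      case 1
      then show ?thesis using coeff_eul_0[of "Suc (Suc n)"] by (simp add: x_def poly_0_coeff_0)
    next
      case 2
      then show ?thesis using b(2) by (simp add: x_def)
    next
      case 3
      then show ?thesis using sgn[of k'] by (simp add: x_def)
    qed
  qed
  obtain y where y: "\<And>k. k < Suc n \<Longrightarrow> x (Suc k) < y k \<and> y k < x k \<and> poly ?p (y k) = 0"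
    "inj_on y {..<Suc n}" "\<And>k. Suc k < Suc n \<Longrightarrow> y (Suc k) < y k"
    using sign_changes_imp_roots[of "Suc n" x ?p, OF xdec xsgn] by blast
  have c: "card (y ` {..<Suc n}) = Suc n" using y(2) by (simp add: card_image)
  have "?p = smult (coeff ?p (card (y ` {..<Suc n}))) (\<Prod>x\<in>y ` {..<Suc n}. [:-x, 1:])"
    by (rule poly_eq_prod_roots) (use deg c y(1) in auto)
  then have "?p = (\<Prod>k<Suc n. [:-y k, 1:])"
    unfolding c lead using y(2) by (simp add: prod.reindex)
  moreover have "y k < 0" if "k < Suc n" for k
  proof -
    have "x k \<le> 0" using neg[of "k - 1"] that by (cases k) (auto simp: x_def)
    then show ?thesis using y(1)[OF that] by linarith
  qed
  ultimately show ?case using y(3) by blast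
qed

lemma eul_root_neq:
  assumes "poly (eul 0 (Suc n)) z = 0"
  shows "z < 0" and "poly (pderiv (eul 0 (Suc n))) z \<noteq> 0"
proof -
  obtain y where neg: "\<And>k. k < n \<Longrightarrow> y k < 0"
    and dec: "\<And>k. Suc k < n \<Longrightarrow> y (Suc k) < y k"
    and fac: "eul 0 (Suc n) = (\<Prod>k<n. [:-y k, 1:])" using eulerian_zeros[of n] by blast
  from assms obtain k where k: "k < n" "z = y k" unfolding fac by (auto simp: poly_prod)
  show "z < 0" using neg k by simp
  show "poly (pderiv (eul 0 (Suc n))) z \<noteq> 0"
    using pderiv_prod_roots_sign[where z = y and n = n and k = k,
        OF dec_chain[where z = y and n = n, OF dec] k(1)] k(2) unfolding fac by auto
qed

text \<open>Both ends of the level vanish at \<open>z\<close>, so a valley stays below 0; the sum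
  over the level is the next Eulerian polynomial and tells the sign. An inner zero would spread to
  \<open>A 1\<close> or \<open>A n\<close>, which vanish together, and \<open>A 1 = 0\<close> would
  make \<open>z\<close> a multiple zero of \<open>eul 0 n\<close>.\<close>

lemma eul_same_sign:
  assumes root: "poly (eul 0 (Suc n)) z = 0" and s: "s = 1 \<or> s = (-1 :: real)"
    and pos: "s * poly (eul 0 (Suc (Suc n))) z > 0"
  shows "poly (eul (Suc n) 0) z = 0"
    and "poly (eul n 1) z = - z * poly (eul 1 n) z"
    and "\<And>i. 0 < i \<Longrightarrow> i \<le> n \<Longrightarrow> s * poly (eul i (Suc n - i)) z > 0"
proof -
  have z: "z < 0" using eul_root_neq[OF root] by simp
  define A where "A i = poly (eul i (Suc n - i)) z" for i
  have A0: "A 0 = 0" using root by (simp add: A_def)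
  show top: "poly (eul (Suc n) 0) z = 0" using root by (simp add: eul_top)
  then have AD: "A (Suc n) = 0" by (simp add: A_def)
  have n0: "n > 0"
  proof (rule ccontr)
    assume "\<not> n > 0"
    moreover have "poly (eul 0 (Suc 0)) z = 1" by (simp add: eul.simps(2) eul_step_def)
    ultimately show False using root by simp
  qed
  have diff: "A i - A (Suc i) = (1 - z) * poly (eul i (n - i)) z" if "i \<le> n" for i
    using that eul_diff[of i "n - i"]
    by (simp add: A_def Suc_diff_le algebra_simps)
  show A1: "poly (eul n 1) z = - z * poly (eul 1 n) z"
  proof -
    have "A n - A (Suc n) = (1 - z) * poly (eul n 0) z" using diff[of n] by simp
    also have "\<dots> = z * ((1 - z) * poly (eul 0 n) z)"
      using n0 by (cases n) (simp_all add: eul_top)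
    also have "(1 - z) * poly (eul 0 n) z = A 0 - A 1" using diff[of 0] by simp
    finally show ?thesis using A0 AD by (simp add: A_def)
  qed
  have z1: "1 - z > 0" using z by simp
  obtain \<sigma> p where sg: "\<sigma> = 1 \<or> \<sigma> = (-1 :: real)"
    and dec: "\<And>i j. i \<le> j \<Longrightarrow> j \<le> p \<Longrightarrow> j \<le> Suc n \<Longrightarrow> \<sigma> * A j \<le> \<sigma> * A i"
    and inc: "\<And>i j. p \<le> i \<Longrightarrow> i \<le> j \<Longrightarrow> j \<le> Suc n \<Longrightarrow> \<sigma> * A i \<le> \<sigma> * A j"
    using one_change_valley[where A = A, OF one_change_eul[OF z, of n] diff z1] by blast
  have le0: "\<sigma> * A i \<le> 0" if "i \<le> Suc n" for i
    using dec[of 0 i] inc[of i "Suc n"] that A0 AD by (cases "i \<le> p") auto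
  have "s * (\<Sum>l\<le>Suc n. A l) > 0"
    using pos poly_eul_sum[OF z, of "Suc n"] by (simp add: A_def)
  moreover have "\<sigma> * (\<Sum>l\<le>Suc n. A l) \<le> 0"
    unfolding sum_distrib_left by (rule sum_nonpos) (use le0 in auto)
  ultimately have s': "s = - \<sigma>" using s sg by auto
  have A1nz: "A 1 \<noteq> 0"
  proof
    assume "A 1 = 0"
    then have r: "poly (eul 0 n) z = 0" using diff[of 0] A0 z by simp
    obtain n' where n': "n = Suc n'" using n0 gr0_implies_Suc by blast
    have "z * (1 - z) * poly (pderiv (eul 0 n)) z = 0"
      using poly_eul_Suc_at_root[OF r] root by simp
    then have "poly (pderiv (eul 0 n)) z = 0" using z by simp
    then show False using eul_root_neq(2)[of n' z] r n' by simp
  qed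
  fix i assume i: "0 < i" "i \<le> n"
  have "A i \<noteq> 0"
  proof
    assume "A i = 0"
    show False
    proof (cases "i \<le> p")
      case True
      have "\<sigma> * A i \<le> \<sigma> * A 1" using dec[of 1 i] True i by auto
      then show False using le0[of 1] A1nz \<open>A i = 0\<close> sg by auto
    next
      case False
      have "\<sigma> * A i \<le> \<sigma> * A n" using inc[of i n] False i by auto
      then have "A n = 0" using le0[of n] \<open>A i = 0\<close> sg by auto
      then show False using A1 A1nz z by (simp add: A_def)
    qed
  qed
  moreover have "\<sigma> \<noteq> 0" using sg by auto
  ultimately have "\<sigma> * A i \<noteq> 0" by simp
  moreover have "\<sigma> * A i \<le> 0" using i by (intro le0) simp
  ultimately have "\<sigma> * A i < 0" by linarith
  then show "s * poly (eul i (Suc n - i)) z > 0"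
    unfolding s' A_def by simp
qed


text \<open>Real zeros are the input for Laguerre's inequality. For \<open>i, j > 0\<close> the
  alternating values at the Eulerian zeros enclose all zeros except the one at 0.\<close>

lemma eul_splits:
  "\<exists>S c. finite S \<and> (\<forall>x\<in>S. x \<le> 0) \<and> eul i j = smult c (\<Prod>x\<in>S. [:-x, 1:])"
proof -
  have col: "\<exists>S. finite S \<and> (\<forall>x\<in>S. x < 0) \<and> eul 0 (Suc n) = (\<Prod>x\<in>S. [:-x, 1:])" for n
  proof -
    obtain z where z: "\<And>k. k < n \<Longrightarrow> z k < 0" "\<And>k. Suc k < n \<Longrightarrow> z (Suc k) < z k"
      "eul 0 (Suc n) = (\<Prod>k<n. [:-z k, 1:])" using eulerian_zeros[of n] by blast
    have "inj_on z {..<n}"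
      by (intro linorder_inj_onI) (use dec_chain[where z = z and n = n, OF z(2)] in fastforce)+
    then have "eul 0 (Suc n) = (\<Prod>x\<in>z ` {..<n}. [:-x, 1:])" using z(3) by (simp add: prod.reindex)
    then show ?thesis using z(1) by (intro exI[of _ "z ` {..<n}"]) auto
  qed
  consider "i = 0" "j = 0" | j' where "i = 0" "j = Suc j'" | i' where "i = Suc i'" "j = 0"
    | i' j' where "i = Suc i'" "j = Suc j'" by (cases i; cases j) auto
  then show ?thesis
  proof cases
    case 1
    then show ?thesis by (intro exI[of _ "{}"] exI[of _ 1]) auto
  next
    case 2
    then show ?thesis using col[of j'] by (metis less_imp_le smult_1_left)
  next
    case 3
    from col[of i'] obtain S where S: "finite S" "\<forall>x\<in>S. x < 0"
      "eul 0 (Suc i') = (\<Prod>x\<in>S. [:-x, 1:])" by blast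
    then have "0 \<notin> S" by auto
    then have "eul i j = smult 1 (\<Prod>x\<in>insert 0 S. [:-x, 1:])"
      using S 3 by (simp add: eul_top)
    then show ?thesis using S by (intro exI[of _ "insert 0 S"] exI[of _ 1]) auto
  next
    case 4
    define n where "n = Suc (i' + j')"
    have ij: "i + j = Suc n" using 4 by (simp add: n_def)
    obtain z where neg: "\<And>k. k < n \<Longrightarrow> z k < 0" and dec: "\<And>k. Suc k < n \<Longrightarrow> z (Suc k) < z k"
      and fac: "eul 0 (Suc n) = (\<Prod>k<n. [:-z k, 1:])" using eulerian_zeros[of n] by blast
    \<comment> \<open>The value at the largest Eulerian zero is negative, hence the change of
      sign.\<close>
    have sgn: "(-1) ^ k * poly (- eul i j) (z k) > 0" if "k \<le> n - 1" for k
    proof -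
      have k: "k < n" using that by (simp add: n_def)
      have "poly (eul 0 (Suc n)) (z k) = 0"
        unfolding fac using k by (auto simp: poly_prod intro: prod_zero)
      from eul_same_sign(3)[OF this _ eul_next_sign[OF neg dec fac k], of i]
      have "(-1) ^ Suc k * poly (eul i (Suc n - i)) (z k) > 0"
        using 4 by (cases "even k") (auto simp: n_def)
      then show ?thesis using ij by (metis add_diff_cancel_left' mult_minus_left mult_minus_right
            poly_minus power_Suc mult_1)
    qed
    obtain y where y: "\<And>k. k < n - 1 \<Longrightarrow> z (Suc k) < y k \<and> y k < z k \<and> poly (- eul i j) (y k) = 0"
      "inj_on y {..<n - 1}"
      using sign_changes_imp_roots[of "n - 1" z "- eul i j", OF _ sgn] dec by force
    let ?S = "insert 0 (y ` {..<n - 1})"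
    have yneg: "y k < 0" if "k < n - 1" for k using y(1)[OF that] neg[of k] that by linarith
    then have "0 \<notin> y ` {..<n - 1}" by force
    then have c: "card ?S = n" using y(2) by (simp add: card_image n_def)
    have "poly (eul i j) 0 = 0" using 4 by (simp add: eul.simps(3) poly_eul_step)
    then have "eul i j = smult (coeff (eul i j) (card ?S)) (\<Prod>x\<in>?S. [:-x, 1:])"
      using y(1) c degree_eul_less[of i j'] 4
      by (intro poly_eq_prod_roots) (auto simp: n_def)
    moreover have "\<forall>x\<in>?S. x \<le> 0" using yneg by force
    ultimately show ?thesis by (intro exI[of _ ?S]) blast
  qed
qed

text \<open>Laguerre's inequality for \<open>\<theta> = t d/dt\<close>: the quadratic form \<open>p \<theta>\<^sup>2p - (\<theta>p)\<^sup>2\<close>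
  is a derivation up to squares, so it suffices to check linear factors.\<close>

lemma laguerre_prod_roots:
  fixes S :: "real set"
  assumes "finite S" "\<And>x. x \<in> S \<Longrightarrow> x \<le> 0" "t < 0"
  defines "p \<equiv> \<Prod>x\<in>S. [:-x, 1:]"
  shows "poly p t * (t * poly (pderiv p) t + t\<^sup>2 * poly (pderiv (pderiv p)) t)
      \<le> (t * poly (pderiv p) t)\<^sup>2"
  using assms(1,2) unfolding p_def
proof (induction S rule: finite_induct)
  case empty
  show ?case by simp
next
  case (insert x S)
  let ?q = "\<Prod>x\<in>S. [:-x, 1 :: real:]"
  define a b c where "a = poly ?q t" and "b = poly (pderiv ?q) t" and "c = poly (pderiv (pderiv ?q)) t"
  have IH: "a * (t * b + t\<^sup>2 * c) \<le> (t * b)\<^sup>2"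
    using insert by (simp add: a_def b_def c_def)
  have p: "(\<Prod>x\<in>insert x S. [:-x, 1:]) = [:-x, 1:] * ?q" using insert by simp
  have dl: "pderiv [:-x, 1:] = 1" by (simp add: pderiv_pCons one_pCons)
  have p1: "pderiv ([:-x, 1:] * ?q) = [:-x, 1:] * pderiv ?q + ?q"
    unfolding pderiv_mult dl by simp
  have p2: "pderiv (pderiv ([:-x, 1:] * ?q)) = [:-x, 1:] * pderiv (pderiv ?q) + 2 * pderiv ?q"
    unfolding p1 pderiv_add pderiv_mult dl by simp
  have v1: "poly ([:-x, 1:] * ?q) t = (t - x) * a" by (simp add: a_def algebra_simps)
  have v2: "poly (pderiv ([:-x, 1:] * ?q)) t = (t - x) * b + a"
    unfolding p1 by (simp add: a_def b_def algebra_simps)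
  have v3: "poly (pderiv (pderiv ([:-x, 1:] * ?q))) t = (t - x) * c + 2 * b"
    unfolding p2 by (simp add: b_def c_def algebra_simps)
  note v = v1 v2 v3
  have "(t * ((t - x) * b + a))\<^sup>2 - (t - x) * a * (t * ((t - x) * b + a) + t\<^sup>2 * ((t - x) * c + 2 * b))
      = (t - x)\<^sup>2 * ((t * b)\<^sup>2 - a * (t * b + t\<^sup>2 * c)) + x * t * a\<^sup>2"
    by (simp add: power2_eq_square algebra_simps)
  moreover have "x * t * a\<^sup>2 \<ge> 0"
    using insert.prems[of x] \<open>t < 0\<close> by (intro mult_nonneg_nonneg mult_nonpos_nonpos) auto
  moreover have "(t - x)\<^sup>2 * ((t * b)\<^sup>2 - a * (t * b + t\<^sup>2 * c)) \<ge> 0"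
    using IH by (intro mult_nonneg_nonneg) auto
  ultimately show ?case unfolding p v by linarith
qed

text \<open>With \<open>a = eul i j\<close> and \<open>u\<close>, \<open>v\<close> its first and
  second image under \<open>t * d/dt\<close>, Laguerre's inequality gives
  \<open>u\<^sup>2 - a * v \<ge> 0\<close>. Expressing the three neighbours of level
  \<open>i + j + 2\<close> by \<open>eul_diff\<close> only multiplies this form by
  \<open>(1 - t)\<^sup>2\<close>.\<close>

lemma eul_log_concave:
  assumes "t < 0"
  shows "poly (eul i (Suc (Suc j))) t * poly (eul (Suc (Suc i)) j) t \<le> (poly (eul (Suc i) (Suc j)) t)\<^sup>2"
proof -
  let ?p = "eul i j"
  define N where "N = real (Suc (i + j))"
  define a b c where "a = poly ?p t" and "b = poly (pderiv ?p) t" and "c = poly (pderiv (pderiv ?p)) t"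
  obtain S k where S: "finite S" "\<forall>x\<in>S. x \<le> 0" "?p = smult k (\<Prod>x\<in>S. [:-x, 1:])"
    using eul_splits[of i j] by blast
  have "k\<^sup>2 * (poly (\<Prod>x\<in>S. [:-x, 1:]) t * (t * poly (pderiv (\<Prod>x\<in>S. [:-x, 1:])) t
      + t\<^sup>2 * poly (pderiv (pderiv (\<Prod>x\<in>S. [:-x, 1:]))) t))
      \<le> k\<^sup>2 * (t * poly (pderiv (\<Prod>x\<in>S. [:-x, 1:])) t)\<^sup>2"
    using laguerre_prod_roots[of S t] S assms by (intro mult_left_mono) auto
  then have lag: "a * (t * b + t\<^sup>2 * c) \<le> (t * b)\<^sup>2"
    unfolding a_def b_def c_def S(3)
    by (simp add: pderiv_smult power2_eq_square algebra_simps)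
  define u where "u = poly (eul (Suc i) j) t"
  define v where "v = poly (eul (Suc (Suc i)) j) t"
  have u: "u = t * ((1 - t) * b + N * a)"
    by (simp add: u_def eul.simps(3) poly_eul_step a_def b_def N_def)
  have "pderiv (eul (Suc i) j) = ([:1, -1:] * pderiv ?p + smult N ?p)
     + [:0, 1:] * (pderiv ([:1, -1:] * pderiv ?p) + smult N (pderiv ?p))"
    unfolding eul.simps eul_step_def N_def pderiv_mult[of "[:0, 1:]"] pderiv_add pderiv_smult
    by (simp add: pderiv_pCons)
  moreover have "pderiv ([:1, -1:] * pderiv ?p) = [:1, -1:] * pderiv (pderiv ?p) - pderiv ?p"
    unfolding pderiv_mult by (simp add: pderiv_pCons)
  ultimately have du: "poly (pderiv (eul (Suc i) j)) t
      = ((1 - t) * b + N * a) + t * ((1 - t) * c - b + N * b)"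
    by (simp only: poly_add poly_mult poly_smult poly_diff a_def[symmetric] b_def[symmetric] c_def[symmetric])
       (simp add: algebra_simps)
  have v: "v = t * ((1 - t) * poly (pderiv (eul (Suc i) j)) t + (N + 1) * u)"
    unfolding v_def u_def N_def eul.simps(3)[of "Suc i"] by (simp add: poly_eul_step algebra_simps)
  have e1: "poly (eul (Suc i) (Suc j)) t = v + (1 - t) * u"
    unfolding eul_diff by (simp add: u_def v_def algebra_simps)
  have e2: "poly (eul i (Suc (Suc j))) t = (v + (1 - t) * u) + (1 - t) * (u + (1 - t) * a)"
    unfolding eul_diff[of i "Suc j"] poly_add poly_mult e1 eul_diff[of i j]
    by (simp add: u_def v_def a_def algebra_simps)
  have "u\<^sup>2 - a * v = (1 - t)\<^sup>2 * ((t * b)\<^sup>2 - a * (t * b + t\<^sup>2 * c)) - N * t * a\<^sup>2"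
    unfolding v du u by (simp add: power2_eq_square algebra_simps)
  moreover have "\<dots> \<ge> 0"
  proof -
    have "(1 - t)\<^sup>2 * ((t * b)\<^sup>2 - a * (t * b + t\<^sup>2 * c)) \<ge> 0" using lag by simp
    moreover have "N * t * a\<^sup>2 \<le> 0"
      using assms by (simp add: N_def mult_nonneg_nonpos mult_nonneg_nonpos2)
    ultimately show ?thesis by linarith
  qed
  ultimately have "0 \<le> (1 - t)\<^sup>2 * (u\<^sup>2 - a * v)" by simp
  also have "\<dots> = (v + (1 - t) * u)\<^sup>2 - ((v + (1 - t) * u) + (1 - t) * (u + (1 - t) * a)) * v"
    by (simp add: power2_eq_square algebra_simps)
  finally show ?thesis unfolding e1 e2 v_def[symmetric] by simp
qed

text \<open>Log-concavity makes ratios of neighbours monotone, so only the two ends matter.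
  Positivity in \<open>e2\<close> bounds both by 4. For the bound 3: if
  \<open>\<alpha> 2 > \<alpha> 1\<close>, then \<open>e2\<close> gives it already for the last
  ratio; otherwise \<open>\<alpha> 3 \<le> \<alpha> 2 \<le> \<alpha> 1\<close> and \<open>e3\<close>
  is estimated directly.\<close>

lemma log_concave_ratio_bounds:
  fixes \<alpha> :: "nat \<Rightarrow> real"
  assumes D: "D \<ge> 6" and pos: "\<And>i. 0 < i \<Longrightarrow> i < D \<Longrightarrow> \<alpha> i > 0"
    and lc: "\<And>i. Suc (Suc i) \<le> D \<Longrightarrow> \<alpha> i * \<alpha> (Suc (Suc i)) \<le> (\<alpha> (Suc i))\<^sup>2"
    and tau: "\<tau> > 0" and e1: "\<alpha> (D - 1) = \<tau> * \<alpha> 1" and e2: "\<alpha> (D - 2) = \<tau> * (4 * \<alpha> 1 - \<alpha> 2)"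
    and e3: "\<alpha> (D - 3) = \<tau> * (12 * \<alpha> 1 - 6 * \<alpha> 2 + \<alpha> 3)"
  shows "\<And>i. 0 < i \<Longrightarrow> i < D - 1 \<Longrightarrow> \<alpha> i \<le> 4 * \<alpha> (Suc i)"
    and "\<And>i. 0 < i \<Longrightarrow> i < D - 1 \<Longrightarrow> \<alpha> (Suc i) \<le> 4 * \<alpha> i"
    and "\<And>i. 0 < i \<Longrightarrow> i < D - 2 \<Longrightarrow> \<alpha> i \<le> 3 * \<alpha> (Suc i)"
proof -
  have tp: "\<alpha> i * \<alpha> (Suc j) \<le> \<alpha> (Suc i) * \<alpha> j" if "0 < i" "i \<le> j" "j < D - 1" for i j
    using that(2,3)
  proof (induction j rule: dec_induct)
    case (step k)
    have p: "\<alpha> i > 0" "\<alpha> (Suc i) > 0" "\<alpha> k > 0" "\<alpha> (Suc k) > 0" "\<alpha> (Suc (Suc k)) > 0"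
      using pos step that by auto
    have "\<alpha> i * \<alpha> (Suc k) \<le> \<alpha> (Suc i) * \<alpha> k" using step by auto
    moreover have "\<alpha> k * \<alpha> (Suc (Suc k)) \<le> (\<alpha> (Suc k))\<^sup>2" using lc[of k] step by auto
    ultimately have "(\<alpha> i * \<alpha> (Suc k)) * (\<alpha> k * \<alpha> (Suc (Suc k)))
        \<le> (\<alpha> (Suc i) * \<alpha> k) * (\<alpha> (Suc k))\<^sup>2" by (rule mult_mono) (use p in auto)
    then have "(\<alpha> k * \<alpha> (Suc k)) * (\<alpha> i * \<alpha> (Suc (Suc k))) \<le> (\<alpha> k * \<alpha> (Suc k)) * (\<alpha> (Suc i) * \<alpha> (Suc k))"
      by (simp add: power2_eq_square mult_ac)
    moreover have "\<alpha> k * \<alpha> (Suc k) > 0" using p by simp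
    ultimately show ?case by (simp only: mult_le_cancel_left_pos)
  qed simp
  have idx: "Suc (D - 2) = D - 1" "Suc (D - 3) = D - 2" "D - 2 > 0" "D - 3 > 0" using D by auto
  have p: "\<alpha> 1 > 0" "\<alpha> 2 > 0" "\<alpha> 3 > 0" "\<alpha> (D - 1) > 0" "\<alpha> (D - 2) > 0" "\<alpha> (D - 3) > 0" using pos D by auto
  have t4: "\<alpha> (D - 2) \<le> 4 * \<alpha> (D - 1)" unfolding e1 e2 using tau p by simp
  have a21: "\<alpha> 2 \<le> 4 * \<alpha> 1" using p(5) tau unfolding e2 by (simp add: zero_less_mult_iff)
  have t3: "\<alpha> (D - 3) \<le> 3 * \<alpha> (D - 2)"
  proof (cases "\<alpha> 2 > \<alpha> 1")
    case True
    have "\<alpha> (D - 3) * \<alpha> (D - 1) \<le> \<alpha> (D - 2) * \<alpha> (D - 2)"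
      using tp[of "D - 3" "D - 2"] idx D by auto
    also have "\<dots> \<le> \<alpha> (D - 2) * (3 * \<alpha> (D - 1))"
      unfolding e1 using True tau p by (intro mult_left_mono) (auto simp: e2)
    finally have "\<alpha> (D - 1) * \<alpha> (D - 3) \<le> \<alpha> (D - 1) * (3 * \<alpha> (D - 2))" by (simp add: mult_ac)
    then show ?thesis by (simp only: mult_le_cancel_left_pos[OF p(4)])
  next
    case False
    have "\<alpha> 1 * \<alpha> 3 \<le> \<alpha> 2 * \<alpha> 2" using tp[of 1 2] D by (simp add: numeral_eq_Suc)
    also have "\<dots> \<le> \<alpha> 1 * \<alpha> 2" using False p by (intro mult_right_mono) auto
    finally have "\<alpha> 3 \<le> \<alpha> 2" by (simp only: mult_le_cancel_left_pos[OF p(1)])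
    then have "12 * \<alpha> 1 - 6 * \<alpha> 2 + \<alpha> 3 \<le> 3 * (4 * \<alpha> 1 - \<alpha> 2)" using p(2) by argo
    then have "\<tau> * (12 * \<alpha> 1 - 6 * \<alpha> 2 + \<alpha> 3) \<le> \<tau> * (3 * (4 * \<alpha> 1 - \<alpha> 2))"
      using tau by (intro mult_left_mono) auto
    then show ?thesis unfolding e2 e3 by (simp add: mult_ac)
  qed
  fix i :: nat assume i: "0 < i"
  {
    assume "i < D - 1"
    have "\<alpha> i * \<alpha> (D - 1) \<le> \<alpha> (Suc i) * \<alpha> (D - 2)" using tp[of i "D - 2"] i \<open>i < D - 1\<close> idx by auto
    also have "\<dots> \<le> \<alpha> (Suc i) * (4 * \<alpha> (D - 1))"
      by (rule mult_left_mono[OF t4], rule less_imp_le, rule pos) (use \<open>i < D - 1\<close> in linarith)+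
    finally have "\<alpha> (D - 1) * \<alpha> i \<le> \<alpha> (D - 1) * (4 * \<alpha> (Suc i))" by (simp add: mult_ac)
    then show "\<alpha> i \<le> 4 * \<alpha> (Suc i)" by (simp only: mult_le_cancel_left_pos[OF p(4)])
  next
    assume "i < D - 1"
    have "\<alpha> 1 * \<alpha> (Suc i) \<le> \<alpha> 2 * \<alpha> i"
      using tp[of 1 i] i \<open>i < D - 1\<close> by (simp add: numeral_2_eq_2)
    also have "\<dots> \<le> (4 * \<alpha> 1) * \<alpha> i"
      by (rule mult_right_mono[OF a21], rule less_imp_le, rule pos) (use i \<open>i < D - 1\<close> in linarith)+
    finally have "\<alpha> 1 * \<alpha> (Suc i) \<le> \<alpha> 1 * (4 * \<alpha> i)" by (simp add: mult_ac)
    then show "\<alpha> (Suc i) \<le> 4 * \<alpha> i" by (simp only: mult_le_cancel_left_pos[OF p(1)])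
  next
    assume "i < D - 2"
    have "\<alpha> i * \<alpha> (D - 2) \<le> \<alpha> (Suc i) * \<alpha> (D - 3)" using tp[of i "D - 3"] i \<open>i < D - 2\<close> idx by auto
    also have "\<dots> \<le> \<alpha> (Suc i) * (3 * \<alpha> (D - 2))"
      by (rule mult_left_mono[OF t3], rule less_imp_le, rule pos) (use \<open>i < D - 2\<close> in linarith)+
    finally have "\<alpha> (D - 2) * \<alpha> i \<le> \<alpha> (D - 2) * (3 * \<alpha> (Suc i))" by (simp add: mult_ac)
    then show "\<alpha> i \<le> 3 * \<alpha> (Suc i)" by (simp only: mult_le_cancel_left_pos[OF p(5)])
  }
qed

text \<open>At a zero of \<open>A\<^sub>0\<close> the reflection \<open>A\<^sub>D = t A\<^sub>0\<close>, applied on the three preceding levels, ties the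
  top of the sequence to its bottom.\<close>

lemma eul_ratio_bounds:
  assumes D: "D \<ge> 6" and root: "poly (eul 0 D) z = 0" and s: "s = 1 \<or> s = (-1 :: real)"
    and pos: "s * poly (eul 0 (Suc D)) z > 0"
  defines "\<alpha> \<equiv> \<lambda>i. s * poly (eul i (D - i)) z"
  shows "\<alpha> 0 = 0" and "\<alpha> D = 0" and "\<And>i. 0 < i \<Longrightarrow> i < D \<Longrightarrow> \<alpha> i > 0"
    and "\<And>i. 0 < i \<Longrightarrow> i < D - 1 \<Longrightarrow> \<alpha> i \<le> 4 * \<alpha> (Suc i)"
    and "\<And>i. 0 < i \<Longrightarrow> i < D - 1 \<Longrightarrow> \<alpha> (Suc i) \<le> 4 * \<alpha> i"
    and "\<And>i. 0 < i \<Longrightarrow> i < D - 2 \<Longrightarrow> \<alpha> i \<le> 3 * \<alpha> (Suc i)"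
proof -
  obtain n where n: "D = Suc n" using D by (cases D) auto
  note same = eul_same_sign[of n z s, OF root[unfolded n] s pos[unfolded n]]
  have z: "z < 0" using eul_root_neq[of n z] root n by simp
  show a0: "\<alpha> 0 = 0" using root by (simp add: \<alpha>_def)
  show aD: "\<alpha> D = 0" using same(1) by (simp add: \<alpha>_def n)
  show apos: "\<alpha> i > 0" if "0 < i" "i < D" for i
    using same(3)[of i] that by (simp add: \<alpha>_def n)
  have lc: "\<alpha> i * \<alpha> (Suc (Suc i)) \<le> (\<alpha> (Suc i))\<^sup>2" if "Suc (Suc i) \<le> D" for i
  proof -
    have "D - i = Suc (Suc (D - Suc (Suc i)))" "D - Suc i = Suc (D - Suc (Suc i))" using that by auto
    moreover have "s * s = 1" using s by auto
    ultimately show ?thesis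
      using eul_log_concave[OF z, of i "D - Suc (Suc i)"]
      by (simp add: \<alpha>_def power2_eq_square mult_ac) (metis mult.left_commute mult_1_right)
  qed
  define A where "A i j = poly (eul i j) z" for i j
  have dif: "(1 - z) * A i j = A i (Suc j) - A (Suc i) j" for i j
    unfolding A_def eul_diff by (simp add: algebra_simps)
  have top: "A (Suc M) 0 = z * A 0 (Suc M)" for M
    by (simp add: A_def eul_top)
  \<comment> \<open>Taking two, and then three, differences of \<open>top\<close> raises the
    reflection to level \<open>D\<close>, since each difference costs one factor
    \<open>1 - z\<close> on both sides.\<close>
  have second: "A (Suc M) 2 - 2 * A (Suc M + 1) 1 + A (Suc M + 2) 0
      = z * (A 0 (Suc M + 2) - 2 * A 1 (Suc M + 1) + A 2 (Suc M))" for M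
  proof -
    have "(1 - z) * ((1 - z) * A (Suc M) 0) = z * ((1 - z) * ((1 - z) * A 0 (Suc M)))"
      by (simp add: top)
    then show ?thesis by (simp add: dif right_diff_distrib distrib_left numeral_2_eq_2)
  qed
  have third: "A (Suc M) 3 - 3 * A (Suc M + 1) 2 + 3 * A (Suc M + 2) 1 - A (Suc M + 3) 0
      = z * (A 0 (Suc M + 3) - 3 * A 1 (Suc M + 2) + 3 * A 2 (Suc M + 1) - A 3 (Suc M))" for M
  proof -
    have "(1 - z) * ((1 - z) * ((1 - z) * A i j))
        = A i (j + 3) - 3 * A (i + 1) (j + 2) + 3 * A (i + 2) (j + 1) - A (i + 3) j" for i j
    proof -
      have "(1 - z) * ((1 - z) * ((1 - z) * A i j))
          = (1 - z) * A i (j + 2) - 2 * ((1 - z) * A (i + 1) (j + 1)) + (1 - z) * A (i + 2) j"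
        by (simp only: dif right_diff_distrib) simp
      then show ?thesis unfolding dif by (simp add: numeral_3_eq_3)
    qed
    moreover have "(1 - z) * ((1 - z) * ((1 - z) * A (Suc M) 0))
        = z * ((1 - z) * ((1 - z) * ((1 - z) * A 0 (Suc M))))"
      by (simp add: top)
    ultimately show ?thesis by (simp add: numeral_3_eq_3 numeral_2_eq_2)
  qed
  define \<tau> where "\<tau> = - z"
  have tau: "\<tau> > 0" using z by (simp add: \<tau>_def)
  obtain M where M: "D = Suc M + 3" using D by (intro that[of "D - 4"]) auto
  have A0: "A 0 D = 0" "A D 0 = 0" using root same(1) by (simp_all add: A_def n)
  have e1: "A (D - 1) 1 = \<tau> * A 1 (D - 1)" using same(2) by (simp add: A_def n \<tau>_def)
  have e2: "A (D - 2) 2 = \<tau> * (4 * A 1 (D - 1) - A 2 (D - 2))"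
    using second[of "Suc M"] A0 e1 by (simp add: M \<tau>_def algebra_simps numeral_eq_Suc)
  have e3: "A (D - 3) 3 = \<tau> * (12 * A 1 (D - 1) - 6 * A 2 (D - 2) + A 3 (D - 3))"
    using third[of M] A0 e1 e2 by (simp add: M \<tau>_def algebra_simps numeral_eq_Suc)
  have al: "\<alpha> i = s * A i (D - i)" for i by (simp add: \<alpha>_def A_def)
  have d: "D - (D - 1) = 1" "D - (D - 2) = 2" "D - (D - 3) = 3" using D by auto
  have "\<alpha> (D - 1) = \<tau> * \<alpha> 1" "\<alpha> (D - 2) = \<tau> * (4 * \<alpha> 1 - \<alpha> 2)"
    "\<alpha> (D - 3) = \<tau> * (12 * \<alpha> 1 - 6 * \<alpha> 2 + \<alpha> 3)"
    unfolding al d e1 e2 e3 by (simp_all add: algebra_simps)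
  from log_concave_ratio_bounds[of D \<alpha> \<tau>, OF D apos lc tau this]
  show "\<And>i. 0 < i \<Longrightarrow> i < D - 1 \<Longrightarrow> \<alpha> i \<le> 4 * \<alpha> (Suc i)"
    and "\<And>i. 0 < i \<Longrightarrow> i < D - 1 \<Longrightarrow> \<alpha> (Suc i) \<le> 4 * \<alpha> i"
    and "\<And>i. 0 < i \<Longrightarrow> i < D - 2 \<Longrightarrow> \<alpha> i \<le> 3 * \<alpha> (Suc i)" by blast+
qed

section \<open>Central binomial coefficients and the exponential formula\<close>

definition cbin :: "nat \<Rightarrow> real" where
  "cbin n = real ((2 * n) choose n) / 4 ^ n"

lemma cbin_0 [simp]: "cbin 0 = 1"
  by (simp add: cbin_def)

lemma cbin_Suc: "cbin (Suc n) = cbin n * (2 * real n + 1) / (2 * real n + 2)"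
proof -
  have c: "cbin m = fact (2 * m) / (fact m * fact m * 4 ^ m)" for m
    unfolding cbin_def by (subst binomial_fact) (simp_all add: mult_2)
  have f: "fact (2 * Suc n) = (2 * real n + 2) * ((2 * real n + 1) * fact (2 * n))"
    by (simp add: algebra_simps)
  have g: "fact (Suc n) = (real n + 1) * fact n" by (simp add: algebra_simps)
  have nz: "fact n \<noteq> (0 :: real)" "(4 :: real) ^ n \<noteq> 0" "real n + 1 \<noteq> 0" "2 * real n + 2 \<noteq> 0" by auto
  show ?thesis unfolding c f g power_Suc using nz by (simp add: divide_simps) (simp add: algebra_simps)
qed

lemma cbin_pos: "cbin n > 0"
  by (simp add: cbin_def zero_less_binomial)

lemma cbin_antimono: "m \<le> n \<Longrightarrow> cbin n \<le> cbin m"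
proof (induction n rule: dec_induct)
  case (step n)
  have "cbin (Suc n) \<le> cbin n * 1"
    unfolding cbin_Suc times_divide_eq_right[symmetric]
    using cbin_pos[of n] by (intro mult_left_mono) auto
  with step show ?case by simp
qed simp

lemma cbin_le_half: "n > 0 \<Longrightarrow> cbin n \<le> 1 / 2"
  using cbin_antimono[of 1 n] by (simp add: cbin_Suc)

text \<open>Elementary substitute for the asymptotics \<open>1 / sqrt (pi * n)\<close> of
  \<open>cbin n\<close>.\<close>

lemma cbin_square_mono:
  assumes "m \<le> n"
  shows "(cbin m)\<^sup>2 * real m \<le> (cbin n)\<^sup>2 * real n"
  using assms
proof (induction n rule: dec_induct)
  case (step n)
  have "(2 * real n + 2)\<^sup>2 * real n \<le> (2 * real n + 1)\<^sup>2 * (real n + 1)"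
    by (simp add: power2_eq_square algebra_simps)
  then have "real n \<le> (2 * real n + 1)\<^sup>2 * (real n + 1) / (2 * real n + 2)\<^sup>2"
    by (subst pos_le_divide_eq) (auto simp: mult.commute)
  then have "(cbin n)\<^sup>2 * real n \<le> (cbin n)\<^sup>2 * ((2 * real n + 1)\<^sup>2 * (real n + 1) / (2 * real n + 2)\<^sup>2)"
    by (intro mult_left_mono) auto
  also have "\<dots> = (cbin (Suc n))\<^sup>2 * real (Suc n)"
    by (simp add: cbin_Suc power_divide power_mult_distrib add.commute)
  finally show ?case using step by simp
qed simp

text \<open>The natural factor is the square root of \<open>n / m\<close>; it is coarsened to
  \<open>n / m\<close>, which costs little when \<open>m\<close> is close to
  \<open>n\<close>.\<close>

lemma cbin_le_scaled:
  assumes "0 < m" "m \<le> n"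
  shows "cbin m \<le> cbin n * (real n / real m)"
proof (rule power2_le_imp_le)
  have r: "real n / real m \<ge> 1" using assms by simp
  have "(cbin m)\<^sup>2 \<le> (cbin n)\<^sup>2 * (real n / real m)"
    using cbin_square_mono[OF assms(2)] assms by (simp add: field_simps)
  also have "\<dots> \<le> (cbin n)\<^sup>2 * (real n / real m)\<^sup>2"
    using r by (intro mult_left_mono self_le_power) auto
  finally show "(cbin m)\<^sup>2 \<le> (cbin n * (real n / real m))\<^sup>2" by (simp only: power_mult_distrib)
  show "0 \<le> cbin n * (real n / real m)" using cbin_pos[of n] by simp
qed

lemma cbin_lower:
  assumes "0 < n"
  shows "1 / 4 \<le> (cbin n)\<^sup>2 * real n"
  using cbin_square_mono[of 1 n] assms by (simp add: cbin_Suc power2_eq_square)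

text \<open>\<open>cbin j / (j + 1)\<close> is twice the drop from \<open>cbin j\<close> to
  \<open>cbin (Suc j)\<close>, so a telescoping sum dominates.\<close>

lemma sum_cbin_div: "(\<Sum>j=1..N. cbin j / real j) \<le> 2"
proof -
  have "cbin (Suc j) / real (Suc j) \<le> 2 * (cbin j - cbin (Suc j))" for j
  proof -
    have "2 * (cbin j - cbin (Suc j)) = cbin j / (real j + 1)"
      by (simp add: cbin_Suc field_simps)
    then show ?thesis using cbin_antimono[of j "Suc j"] by (simp add: divide_right_mono add.commute)
  qed
  then have "(\<Sum>j<N. cbin (Suc j) / real (Suc j)) \<le> (\<Sum>j<N. 2 * (cbin j - cbin (Suc j)))"
    by (intro sum_mono)
  also have "\<dots> = 2 * (cbin 0 - cbin N)"
    unfolding sum_distrib_left[symmetric] by (subst sum_lessThan_telescope') simp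
  also have "\<dots> \<le> 2" using cbin_pos[of N] by simp
  also have "(\<Sum>j<N. cbin (Suc j) / real (Suc j)) = (\<Sum>j=1..N. cbin j / real j)"
    by (rule sum.reindex_bij_witness[of _ "\<lambda>j. j - 1" Suc]) auto
  finally show ?thesis .
qed

text \<open>The weight of a piece of length \<open>j\<close>, at the evaluation point \<open>1/3\<close> and scaled by its
  exponential growth; the summand \<open>k = j\<close> dominates.\<close>

definition pweight :: "nat \<Rightarrow> real" where
  "pweight j = (\<Sum>k=1..j. real ((2 * gcd k j) choose gcd k j) / 2 ^ gcd k j) / (2 ^ j * (real j)\<^sup>2)"

definition pweight_rest :: "nat \<Rightarrow> real" where
  "pweight_rest j = pweight j - cbin j / (real j)\<^sup>2"

text \<open>For \<open>k < j\<close> the gcd is a proper divisor of \<open>j\<close>, hence at most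
  \<open>j div 2\<close>, and the term is exponentially small against \<open>k = j\<close>.\<close>

lemma pweight_rest_bounds:
  assumes j: "0 < j"
  shows "0 \<le> pweight_rest j" "pweight_rest j \<le> 1 / (2 * real j * 2 ^ (j - j div 2))"
proof -
  have two: "(2 :: real) ^ n * 2 ^ n = 4 ^ n" for n by (simp flip: power_mult_distrib)
  have v: "real ((2 * g) choose g) / 2 ^ g / 2 ^ j = cbin g * (2 ^ g / 2 ^ j)" for g
    using two[of g] by (simp add: cbin_def field_simps)
  have "{1..j} = insert j {1..<j}" using j by auto
  then have "pweight j = (real ((2 * j) choose j) / 2 ^ j
      + (\<Sum>k=1..<j. real ((2 * gcd k j) choose gcd k j) / 2 ^ gcd k j)) / 2 ^ j / (real j)\<^sup>2"
    by (simp add: pweight_def)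
  also have "\<dots> = (cbin j + (\<Sum>k=1..<j. cbin (gcd k j) * (2 ^ gcd k j / 2 ^ j))) / (real j)\<^sup>2"
    unfolding add_divide_distrib[of _ _ "2 ^ j"] sum_divide_distrib v by simp
  finally have r: "pweight_rest j = (\<Sum>k=1..<j. cbin (gcd k j) * (2 ^ gcd k j / 2 ^ j)) / (real j)\<^sup>2"
    by (simp add: pweight_rest_def add_divide_distrib)
  show "0 \<le> pweight_rest j"
    unfolding r using cbin_pos by (intro divide_nonneg_nonneg sum_nonneg) (auto intro: less_imp_le)
  have "cbin (gcd k j) * (2 ^ gcd k j / 2 ^ j) \<le> 1 / 2 * (1 / 2 ^ (j - j div 2))" if "k \<in> {1..<j}" for k
  proof -
    have g: "gcd k j > 0" using j by simp
    have "gcd k j \<noteq> j" using that by (metis atLeastLessThan_iff gcd_dvd1 nat_dvd_not_less zero_less_one less_le_trans)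
    then obtain q where q: "j = gcd k j * q" "q \<noteq> 1" "q \<noteq> 0"
      using j by (metis dvdE gcd_dvd2 mult.right_neutral mult_0_right less_irrefl)
    then have "2 \<le> q" by linarith
    then have "gcd k j * 2 \<le> j" using q(1) by (metis mult_le_mono2)
    then have gle: "gcd k j \<le> j div 2" by linarith
    have "(2 :: real) ^ gcd k j / 2 ^ j \<le> 2 ^ (j div 2) / 2 ^ j"
      using gle by (intro divide_right_mono power_increasing) auto
    also have "\<dots> = 1 / 2 ^ (j - j div 2)" by (simp add: power_diff)
    finally show ?thesis using cbin_le_half[OF g] cbin_pos[of "gcd k j"] by (intro mult_mono) auto
  qed
  then have "(\<Sum>k=1..<j. cbin (gcd k j) * (2 ^ gcd k j / 2 ^ j)) \<le> (\<Sum>k=1..<j. 1 / 2 * (1 / 2 ^ (j - j div 2)))"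
    by (rule sum_mono)
  also have "\<dots> \<le> real j * (1 / 2 * (1 / 2 ^ (j - j div 2)))" by (simp add: field_simps)
  finally have "pweight_rest j \<le> real j * (1 / 2 * (1 / 2 ^ (j - j div 2))) / (real j)\<^sup>2"
    unfolding r by (intro divide_right_mono) auto
  also have "\<dots> = 1 / (2 * real j * 2 ^ (j - j div 2))"
    using j by (simp add: power2_eq_square field_simps)
  finally show "pweight_rest j \<le> 1 / (2 * real j * 2 ^ (j - j div 2))" .
qed

lemma pweight_eq: "pweight j = cbin j / (real j)\<^sup>2 + pweight_rest j"
  by (simp add: pweight_rest_def)

lemma pweight_nonneg: "0 \<le> pweight j"
proof (cases "j = 0")
  case False
  then show ?thesis
    unfolding pweight_eq using pweight_rest_bounds(1)[of j] cbin_pos[of j]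
    by (intro add_nonneg_nonneg) (auto intro: less_imp_le)
qed (simp add: pweight_def)

lemma four_le_power_half: "5 \<le> j \<Longrightarrow> 4 * j \<le> 3 * 2 ^ (j - j div 2)"
proof (induction j rule: less_induct)
  case (less j)
  show ?case
  proof (cases "j < 7")
    case True
    with less.prems have "j = 5 \<or> j = 6" by auto
    then show ?thesis by auto
  next
    case False
    then have "4 * (j - 2) \<le> 3 * 2 ^ ((j - 2) - (j - 2) div 2)" using less.IH[of "j - 2"] by simp
    moreover have "j - j div 2 = Suc ((j - 2) - (j - 2) div 2)" using False by linarith
    moreover have "4 * j \<le> 2 * (4 * (j - 2))" using False by linarith
    ultimately show ?thesis by simp
  qed
qed

text \<open>63/256 is \<open>cbin 5\<close>; 3/8 arises when \<open>four_le_power_half\<close> turns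
  the exponential bound on the rest into an inverse square.\<close>

lemma pweight_le_tail:
  assumes "5 \<le> j"
  shows "pweight j \<le> (63 / 256 + 3 / 8) / (real j)\<^sup>2"
proof -
  have "cbin 5 = 63 / 256" by (simp add: cbin_Suc eval_nat_numeral)
  then have "cbin j \<le> 63 / 256" using cbin_antimono[OF assms] by simp
  then have "cbin j / (real j)\<^sup>2 \<le> 63 / 256 / (real j)\<^sup>2" by (rule divide_right_mono) simp
  moreover have "pweight_rest j \<le> 3 / 8 / (real j)\<^sup>2"
  proof -
    have "real (4 * j) \<le> real (3 * 2 ^ (j - j div 2))"
      using four_le_power_half[OF assms] by (simp only: of_nat_le_iff)
    then have "4 * real j \<le> 3 * 2 ^ (j - j div 2)" by simp
    then have "real j * (4 * real j) \<le> real j * (3 * 2 ^ (j - j div 2))" by (rule mult_left_mono) simp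
    then have "1 / (2 * real j * 2 ^ (j - j div 2)) \<le> 3 / 8 / (real j)\<^sup>2"
      using assms by (simp add: power2_eq_square divide_simps)
    then show ?thesis using pweight_rest_bounds(2)[of j] assms by simp
  qed
  ultimately show ?thesis unfolding pweight_eq by (simp add: add_divide_distrib)
qed

lemma pweight_small: "pweight 1 = 1 / 2" "pweight 2 = 5 / 32" "pweight 3 = 1 / 16" "pweight 4 = 63 / 2048"
proof -
  have s: "{1..1} = {1::nat}" "{1..2} = {1, 2::nat}" "{1..3} = {1, 2, 3::nat}" "{1..4} = {1, 2, 3, 4::nat}" by auto
  have g: "gcd 2 (3::nat) = 1" "gcd 2 (4::nat) = 2" "gcd 3 (4::nat) = 1" by (simp_all add: gcd_non_0_nat)
  have b: "(2 choose 1) = (2::nat)" "(4 choose 2) = (6::nat)" "(6 choose 3) = (20::nat)" "(8 choose 4) = (70::nat)"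
    by (simp_all add: eval_nat_numeral)
  show "pweight 1 = 1 / 2" "pweight 2 = 5 / 32" "pweight 3 = 1 / 16" "pweight 4 = 63 / 2048"
    unfolding pweight_def s by (simp_all add: g b power2_eq_square)
qed

lemma pweight_le_inverse_square:
  assumes "0 < j"
  shows "pweight j \<le> 1 / (real j)\<^sup>2"
proof (cases "5 \<le> j")
  case True
  have "(63 / 256 + 3 / 8) / (real j)\<^sup>2 \<le> 1 / (real j)\<^sup>2" by (rule divide_right_mono) simp_all
  then show ?thesis using pweight_le_tail[OF True] by simp
next
  case False
  then have "j = 1 \<or> j = 2 \<or> j = 3 \<or> j = 4" using assms by auto
  then show ?thesis using pweight_small by (auto simp: power2_eq_square)
qed

text \<open>Four exact terms sum to about 0.75. The inverse squares of the tail telescope against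
  \<open>2 / (2 * M + 1)\<close> and add less than 0.14.\<close>

lemma sum_pweight_le: "(\<Sum>j=1..N. pweight j) \<le> 89 / 100"
proof -
  have tail: "(\<Sum>j=5..M. pweight j) \<le> (63 / 256 + 3 / 8) * (2 / 9 - 2 / (2 * real M + 1))" if "4 \<le> M" for M
    using that
  proof (induction M rule: dec_induct)
    case base
    show ?case by simp
  next
    case (step M)
    have "1 / (real (Suc M))\<^sup>2 \<le> 2 / (2 * real M + 1) - 2 / (2 * real (Suc M) + 1)"
    proof -
      have "2 / (2 * real M + 1) - 2 / (2 * real (Suc M) + 1) = 4 / ((2 * real M + 1) * (2 * real M + 3))"
        by (simp add: divide_simps)
      moreover have "4 / (4 * (real (Suc M))\<^sup>2) \<le> 4 / ((2 * real M + 1) * (2 * real M + 3))"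
      proof (rule divide_left_mono)
        show "(2 * real M + 1) * (2 * real M + 3) \<le> 4 * (real (Suc M))\<^sup>2"
          by (simp add: power2_eq_square algebra_simps)
        show "0 < 4 * (real (Suc M))\<^sup>2 * ((2 * real M + 1) * (2 * real M + 3))"
          by (intro mult_pos_pos) auto
      qed simp
      ultimately show ?thesis by simp
    qed
    then have "(63 / 256 + 3 / 8) * (1 / (real (Suc M))\<^sup>2)
        \<le> (63 / 256 + 3 / 8) * (2 / (2 * real M + 1) - 2 / (2 * real (Suc M) + 1))"
      by (rule mult_left_mono) simp
    moreover have "pweight (Suc M) \<le> (63 / 256 + 3 / 8) * (1 / (real (Suc M))\<^sup>2)"
      using pweight_le_tail[of "Suc M"] step by simp
    moreover have "(\<Sum>j=5..Suc M. pweight j) = (\<Sum>j=5..M. pweight j) + pweight (Suc M)"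
      using step by simp
    moreover have "(63 / 256 + 3 / 8) * (2 / 9 - 2 / (2 * real (Suc M) + 1))
        = (63 / 256 + 3 / 8) * (2 / 9 - 2 / (2 * real M + 1))
          + (63 / 256 + 3 / 8) * (2 / (2 * real M + 1) - 2 / (2 * real (Suc M) + 1))"
      by (simp only: distrib_left[symmetric]) simp
    ultimately show ?case using step.IH by linarith
  qed
  let ?M = "max N 4"
  have "(\<Sum>j=1..N. pweight j) \<le> (\<Sum>j=1..?M. pweight j)"
    by (rule sum_mono2) (auto simp: pweight_nonneg)
  also have "{1..?M} = {1, 2, 3, 4} \<union> {5..?M}" by auto
  also have "(\<Sum>j\<in>{1, 2, 3, 4} \<union> {5..?M}. pweight j) = (\<Sum>j\<in>{1, 2, 3, 4}. pweight j) + (\<Sum>j=5..?M. pweight j)"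
    by (rule sum.union_disjoint) auto
  also have "(\<Sum>j\<in>{1, 2, 3, 4}. pweight j) = 1 / 2 + 5 / 32 + 1 / 16 + 63 / 2048"
    using pweight_small by simp
  also have "(\<Sum>j=5..?M. pweight j) \<le> (63 / 256 + 3 / 8) * (2 / 9)"
    using tail[of ?M] by (rule order_trans) (auto simp: algebra_simps)
  finally show ?thesis by simp
qed

text \<open>Of the 11/4, 2 comes from \<open>sum_cbin_div\<close> and 3/4 from the rest. The bounds
  on the rest occur in equal pairs of a geometric series, whence the parity in the auxiliary
  estimate.\<close>

lemma sum_index_pweight_le: "(\<Sum>j=1..N. real j * pweight j) \<le> 11 / 4"
proof -
  have h: "(\<Sum>j=2..M. 1 / 2 ^ (j - j div 2 + 1)) \<le> 3 / 4 - (if even M then 1 else 3 / 4) * (1 / 2 ^ (M div 2) :: real)"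
    if "1 \<le> M" for M :: nat
    using that
  proof (induction M rule: dec_induct)
    case (step M)
    show ?case
    proof (cases "even M")
      case True
      then obtain q where q: "M = 2 * q" by blast
      then have "Suc M - Suc M div 2 + 1 = q + 2" "M div 2 = q" "Suc M div 2 = q" by auto
      moreover have "1 / 2 ^ (q + 2) = 1 / 4 * (1 / 2 ^ q :: real)" by simp
      moreover have "2 \<le> Suc M" using step by simp
      ultimately show ?thesis using step.IH True by simp
    next
      case False
      then obtain q where q: "M = 2 * q + 1" using oddE by blast
      then have "Suc M - Suc M div 2 + 1 = q + 2" "M div 2 = q" "Suc M div 2 = Suc q" by auto
      moreover have "1 / 2 ^ (q + 2) = 1 / 4 * (1 / 2 ^ q :: real)" by simp
      moreover have "2 \<le> Suc M" using step by simp
      ultimately show ?thesis using step.IH False by simp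
    qed
  qed simp
  have "(\<Sum>j=1..N. real j * pweight j) = (\<Sum>j=1..N. cbin j / real j) + (\<Sum>j=1..N. real j * pweight_rest j)"
    unfolding pweight_eq sum.distrib[symmetric]
    by (rule sum.cong) (auto simp: power2_eq_square algebra_simps)
  moreover have "(\<Sum>j=1..N. real j * pweight_rest j) \<le> 3 / 4"
  proof (cases "N = 0")
    case False
    have r1: "pweight_rest 1 = 0" unfolding pweight_rest_def pweight_small(1) by (simp add: cbin_Suc)
    have "{1..N} = insert 1 {2..N}" using False by auto
    then have "(\<Sum>j=1..N. real j * pweight_rest j) = (\<Sum>j=2..N. real j * pweight_rest j)"
      using r1 by simp
    also have "\<dots> \<le> (\<Sum>j=2..N. 1 / 2 ^ (j - j div 2 + 1))"
    proof (rule sum_mono)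
      fix j assume "j \<in> {2..N}"
      then have j: "0 < j" by auto
      have "real j * pweight_rest j \<le> real j * (1 / (2 * real j * 2 ^ (j - j div 2)))"
        by (rule mult_left_mono[OF pweight_rest_bounds(2)[OF j]]) simp
      then show "real j * pweight_rest j \<le> 1 / 2 ^ (j - j div 2 + 1)" using j by simp
    qed
    also have "\<dots> \<le> 3 / 4 - (if even N then 1 else 3 / 4) * (1 / 2 ^ (N div 2))" using h[of N] False by simp
    also have "\<dots> \<le> 3 / 4" by simp
    finally show ?thesis .
  qed simp
  ultimately show ?thesis using sum_cbin_div[of N] by linarith
qed


lemma sum_convolution_le:
  fixes a b :: "nat \<Rightarrow> real"
  assumes "\<And>j. 0 \<le> a j" "\<And>i. 0 \<le> b i"
  shows "(\<Sum>n=1..N. \<Sum>j=1..n. a j * b (n - j)) \<le> (\<Sum>j=1..N. a j) * (\<Sum>i\<le>N. b i)"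
proof -
  have "(\<Sum>n=1..N. \<Sum>j=1..n. a j * b (n - j)) = (\<Sum>(n, j)\<in>(SIGMA n : {1..N}. {1..n}). a j * b (n - j))"
    by (subst sum.Sigma) auto
  also have "\<dots> = (\<Sum>(j, i)\<in>(\<lambda>(n, j). (j, n - j)) ` (SIGMA n : {1..N}. {1..n}). a j * b i)"
    by (subst sum.reindex) (auto simp: inj_on_def case_prod_beta)
  also have "\<dots> \<le> (\<Sum>(j, i)\<in>{1..N} \<times> {..N}. a j * b i)"
    by (rule sum_mono2) (use assms in auto)
  also have "\<dots> = (\<Sum>j=1..N. a j) * (\<Sum>i\<le>N. b i)"
    by (simp add: sum_product sum.cartesian_product)
  finally show ?thesis .
qed

text \<open>The coefficients of \<open>\<Phi> = exp S\<close>, where \<open>S\<close> is the generating function of \<open>pweight\<close>; the recursion is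
  \<open>\<Phi>' = S' \<Phi>\<close>.\<close>

locale exp_sequence =
  fixes \<phi> :: "nat \<Rightarrow> real"
  assumes \<phi>_0: "\<phi> 0 = 1"
    and \<phi>_rec: "\<And>n. 0 < n \<Longrightarrow> real n * \<phi> n = (\<Sum>j=1..n. real j * pweight j * \<phi> (n - j))"
begin

lemma \<phi>_nonneg: "0 \<le> \<phi> n"
proof (induction n rule: less_induct)
  case (less n)
  show ?case
  proof (cases "n = 0")
    case False
    have "0 \<le> (\<Sum>j=1..n. real j * pweight j * \<phi> (n - j))"
      using less False by (intro sum_nonneg mult_nonneg_nonneg pweight_nonneg) auto
    then have "0 \<le> real n * \<phi> n" using \<phi>_rec[of n] False by simp
    then show ?thesis using False by (simp add: zero_le_mult_iff)
  qed (simp add: \<phi>_0)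
qed

text \<open>For the truncated series, \<open>S' * F\<close> contains all terms of \<open>F'\<close>
  and further nonnegative ones. Hence \<open>F * exp (- S)\<close> does not increase on
  \<open>[0, 1]\<close>, and it starts at 1.\<close>

lemma sum_\<phi>_le_exp: "(\<Sum>n\<le>N. \<phi> n) \<le> exp (\<Sum>j=1..N. pweight j)"
proof -
  define F where "F x = (\<Sum>n\<le>N. \<phi> n * x ^ n)" for x :: real
  define S where "S x = (\<Sum>j=1..N. pweight j * x ^ j)" for x :: real
  define F' where "F' x = (\<Sum>n\<le>N. \<phi> n * (real n * x ^ (n - 1)))" for x :: real
  define S' where "S' x = (\<Sum>j=1..N. pweight j * (real j * x ^ (j - 1)))" for x :: real
  have dF: "(F has_real_derivative F' x) (at x)" for x
    unfolding F_def F'_def by (auto intro!: derivative_eq_intros sum.cong simp: mult_ac)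
  have dS: "(S has_real_derivative S' x) (at x)" for x
    unfolding S_def S'_def by (auto intro!: derivative_eq_intros sum.cong simp: mult_ac)
  have le: "F' x \<le> S' x * F x" if x: "0 \<le> x" for x
  proof -
    have "F' x = (\<Sum>n=1..N. real n * \<phi> n * x ^ (n - 1))"
      unfolding F'_def by (intro sum.mono_neutral_cong_right) auto
    also have "\<dots> = (\<Sum>n=1..N. \<Sum>j=1..n. (pweight j * (real j * x ^ (j - 1))) * (\<phi> (n - j) * x ^ (n - j)))"
    proof (rule sum.cong[OF refl])
      fix n assume "n \<in> {1..N}"
      then have n: "0 < n" by auto
      show "real n * \<phi> n * x ^ (n - 1)
          = (\<Sum>j=1..n. (pweight j * (real j * x ^ (j - 1))) * (\<phi> (n - j) * x ^ (n - j)))"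
        unfolding \<phi>_rec[OF n] sum_distrib_right
      proof (rule sum.cong[OF refl])
        fix j assume "j \<in> {1..n}"
        then have "n - 1 = (j - 1) + (n - j)" by auto
        then show "real j * pweight j * \<phi> (n - j) * x ^ (n - 1)
            = pweight j * (real j * x ^ (j - 1)) * (\<phi> (n - j) * x ^ (n - j))"
          by (simp add: power_add)
      qed
    qed
    also have "\<dots> \<le> S' x * F x"
      unfolding S'_def F_def using x pweight_nonneg \<phi>_nonneg by (intro sum_convolution_le) auto
    finally show ?thesis .
  qed
  have "F 1 * exp (- S 1) \<le> F 0 * exp (- S 0)"
  proof (rule DERIV_nonpos_imp_nonincreasing[of 0 1 "\<lambda>x. F x * exp (- S x)"])
    fix x :: real assume "0 \<le> x" "x \<le> 1"
    have "((\<lambda>x. F x * exp (- S x)) has_real_derivative (F' x - S' x * F x) * exp (- S x)) (at x)"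
      using dF[of x] dS[of x] by (auto intro!: derivative_eq_intros simp: algebra_simps)
    moreover have "(F' x - S' x * F x) * exp (- S x) \<le> 0"
      using le[OF \<open>0 \<le> x\<close>] by (intro mult_nonpos_nonneg) auto
    ultimately show "\<exists>y. ((\<lambda>x. F x * exp (- S x)) has_real_derivative y) (at x) \<and> y \<le> 0" by blast
  qed simp
  moreover have "F 0 = 1"
  proof -
    have "F 0 = (\<Sum>n\<in>{0}. \<phi> n * 0 ^ n)" unfolding F_def by (intro sum.mono_neutral_right) auto
    then show ?thesis by (simp add: \<phi>_0)
  qed
  moreover have "S 0 = 0" unfolding S_def by (intro sum.neutral) auto
  ultimately have "F 1 * exp (- S 1) \<le> 1" by simp
  then have "F 1 \<le> exp (S 1)" by (simp add: exp_minus field_simps)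
  then show ?thesis by (simp add: F_def S_def)
qed

lemma sum_\<phi>_le: "(\<Sum>n\<le>N. \<phi> n) \<le> 491 / 200"
proof -
  have "(\<Sum>n\<le>N. \<phi> n) \<le> exp (89 / 100)"
    using sum_\<phi>_le_exp[of N] sum_pweight_le[of N] by (meson exp_le_cancel_iff order_trans)
  \<comment> \<open>The exponent is cut into 64 parts to make \<open>exp x \<le> 1 / (1 - x)\<close>
    sharp enough; 6400/6311 is \<open>1 / (1 - 89/6400)\<close>.\<close>
  also have "exp (89 / 100 :: real) = exp (of_nat 64 * (89 / 6400))" by simp
  also have "\<dots> = exp (89 / 6400) ^ 64" by (rule exp_of_nat_mult)
  also have "\<dots> \<le> (6400 / 6311) ^ 64"
  proof (rule power_mono)
    have "1 + - (89 / 6400) \<le> exp (- (89 / 6400) :: real)" by (rule exp_ge_add_one_self)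
    then show "exp (89 / 6400 :: real) \<le> 6400 / 6311" by (simp add: exp_minus field_simps)
  qed simp
  also have "\<dots> \<le> 491 / 200" by (simp add: field_simps)
  finally show ?thesis .
qed

lemma \<phi>_le: "\<phi> n \<le> 491 / 200"
  using member_le_sum[of n "{..n}" \<phi>] \<phi>_nonneg sum_\<phi>_le[of n] by auto

lemma \<phi>_le_inverse:
  assumes "0 < n"
  shows "real n * \<phi> n \<le> 34 / 5"
proof -
  have "real n * \<phi> n \<le> (\<Sum>j=1..n. real j * pweight j * (491 / 200))"
    unfolding \<phi>_rec[OF assms]
    using \<phi>_le pweight_nonneg by (intro sum_mono mult_left_mono) auto
  also have "\<dots> = (\<Sum>j=1..n. real j * pweight j) * (491 / 200)" by (simp only: sum_distrib_right)
  also have "\<dots> \<le> 11 / 4 * (491 / 200)" using sum_index_pweight_le[of n] by (intro mult_right_mono) auto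
  finally show ?thesis by simp
qed

text \<open>In each half of the recursion one factor is small: \<open>\<phi> (n - j)\<close> for
  \<open>2 * j \<le> n\<close>, by the preceding bound, and \<open>pweight j\<close>
  otherwise.\<close>

lemma \<phi>_le_inverse_square:
  assumes n: "0 < n"
  shows "(real n)\<^sup>2 * \<phi> n \<le> 43"
proof -
  have piece: "real n * (real j * pweight j * \<phi> (n - j))
      \<le> 68 / 5 * (real j * pweight j) + 2 * \<phi> (n - j)" if j: "j \<in> {1..n}" for j
  proof (cases "2 * j \<le> n")
    case True
    then have nj: "0 < n - j" "real n \<le> 2 * real (n - j)" using j by auto
    have "real n * \<phi> (n - j) \<le> 2 * real (n - j) * \<phi> (n - j)"
      using nj(2) \<phi>_nonneg by (intro mult_right_mono) auto
    also have "\<dots> \<le> 68 / 5" using \<phi>_le_inverse[OF nj(1)] by simp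
    finally have "real n * \<phi> (n - j) \<le> 68 / 5" .
    then have "(real j * pweight j) * (real n * \<phi> (n - j)) \<le> (real j * pweight j) * (68 / 5)"
      using pweight_nonneg by (intro mult_left_mono) auto
    moreover have "0 \<le> 2 * \<phi> (n - j)" using \<phi>_nonneg by simp
    ultimately show ?thesis by (simp add: mult_ac)
  next
    case False
    then have nj: "real n \<le> 2 * real j" "real j > 0" using j by auto
    have "real n * (real j * pweight j) \<le> 2 * real j * (real j * (1 / (real j)\<^sup>2))"
      using nj pweight_le_inverse_square[of j] pweight_nonneg by (intro mult_mono) auto
    also have "\<dots> = 2" using nj by (simp add: power2_eq_square)
    finally have "(real n * (real j * pweight j)) * \<phi> (n - j) \<le> 2 * \<phi> (n - j)"
      using \<phi>_nonneg by (intro mult_right_mono) auto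
    moreover have "0 \<le> 68 / 5 * (real j * pweight j)" using pweight_nonneg by simp
    ultimately show ?thesis by (simp add: mult_ac)
  qed
  have "(real n)\<^sup>2 * \<phi> n = (\<Sum>j=1..n. real n * (real j * pweight j * \<phi> (n - j)))"
    using \<phi>_rec[OF n] by (simp only: power2_eq_square mult.assoc sum_distrib_left[symmetric])
  also have "\<dots> \<le> (\<Sum>j=1..n. 68 / 5 * (real j * pweight j) + 2 * \<phi> (n - j))"
    by (rule sum_mono) (rule piece)
  also have "\<dots> = 68 / 5 * (\<Sum>j=1..n. real j * pweight j) + 2 * (\<Sum>j=1..n. \<phi> (n - j))"
    by (simp only: sum.distrib sum_distrib_left)
  also have "(\<Sum>j=1..n. \<phi> (n - j)) = (\<Sum>i<n. \<phi> i)"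
    by (rule sum.reindex_bij_witness[of _ "\<lambda>i. n - i" "\<lambda>j. n - j"]) auto
  also have "(\<Sum>i<n. \<phi> i) \<le> (\<Sum>i\<le>n. \<phi> i)" by (rule sum_mono2) (auto simp: \<phi>_nonneg)
  also have "\<dots> \<le> 491 / 200" by (rule sum_\<phi>_le)
  finally show ?thesis using sum_index_pweight_le[of n] by linarith
qed

text \<open>The recursion is split at \<open>j = 99/100 * d\<close>. Above, \<open>pweight j\<close>
  is at most 1.036 times \<open>g\<close>, and the \<open>\<phi>\<close> sum to at most 491/200;
  below, \<open>\<phi> (d - j)\<close> is at most \<open>430000 / d\<^sup>2\<close>. The margin is
  1.036 * 2.455 + 0.0001 < 2.55.\<close>

lemma \<phi>_le_main:
  assumes d: "2 ^ 72 \<le> d"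
  shows "\<phi> d \<le> 51 / 20 * (cbin d / (real d)\<^sup>2)"
proof -
  define g where "g = cbin d / (real d)\<^sup>2"
  have d0: "0 < d" using d by (rule less_le_trans[rotated]) simp
  have rd: "real d \<ge> 2 ^ 72" using d by (metis of_nat_le_iff of_nat_numeral of_nat_power)
  have rd0: "real d > 0" using d0 by simp
  \<comment> \<open>\<open>cbin d * d\<close> is at least half the square root of \<open>d\<close>;
    this is where \<open>2 ^ 72\<close> is used in full.\<close>
  have "2 ^ 70 \<le> real d / 4" using rd by simp
  also have "\<dots> \<le> (cbin d)\<^sup>2 * real d * real d" using mult_right_mono[OF cbin_lower[OF d0], of "real d"] by simp
  finally have "(2 ^ 35)\<^sup>2 \<le> (cbin d * real d)\<^sup>2" by (simp add: power2_eq_square mult_ac)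
  then have big: "2 ^ 35 \<le> cbin d * real d"
    by (rule power2_le_imp_le) (use cbin_pos[of d] rd0 in simp)
  have g0: "g > 0" using cbin_pos[of d] rd0 by (simp add: g_def)
  have gbig: "2 ^ 35 / real d ^ 3 \<le> g"
    using big rd0 by (simp add: g_def power3_eq_cube power2_eq_square divide_simps) 
  \<comment> \<open>The ratio \<open>d / j \<le> 100/99\<close> enters three times, twice from the
    square and once from \<open>cbin_le_scaled\<close>, and its cube is below 1.035; 1/1000 is left
    for \<open>pweight_rest\<close>.\<close>
  have pw: "pweight j \<le> 1036 / 1000 * g" if j: "99 * d \<le> 100 * j" "j \<le> d" for j
  proof -
    have j0: "0 < j" using j d0 by auto
    have rj: "real d \<le> 100 / 99 * real j" using j(1) by linarith
    have "cbin j / (real j)\<^sup>2 \<le> cbin d * (real d / real j) / (real j)\<^sup>2"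
      using cbin_le_scaled[OF j0 j(2)] by (intro divide_right_mono) auto
    also have "\<dots> = g * (real d / real j) ^ 3"
      using j0 rd0 by (simp add: g_def power3_eq_cube power2_eq_square field_simps)
    also have "\<dots> \<le> g * (100 / 99) ^ 3"
      using rj j0 g0 by (intro mult_left_mono power_mono) (auto simp: field_simps)
    also have "\<dots> \<le> g * (1035 / 1000)" using g0 by (intro mult_left_mono) (auto simp: power3_eq_cube)
    finally have 1: "cbin j / (real j)\<^sup>2 \<le> g * (1035 / 1000)" .
    define h where "h = j - j div 2"
    have h: "real d \<le> 3 * real h"
    proof -
      have "j \<le> 2 * h" unfolding h_def by linarith
      then have "99 * d \<le> 200 * h" using j(1) by linarith
      then show ?thesis by linarith
    qed
    have "real h ^ 4 \<le> 2 ^ h"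
    proof -
      have "48 \<le> real d" using rd by (rule order_trans[rotated]) simp
      then have "16 \<le> h" using h by linarith
      then have "h ^ 4 \<le> 2 ^ h"
      proof (induction h rule: dec_induct)
        case (step h)
        have "(Suc h) ^ 4 * 16 ^ 4 \<le> (17 * h) ^ 4"
          unfolding power_mult_distrib[symmetric] by (rule power_mono) (use step in auto)
        also have "\<dots> = 17 ^ 4 * h ^ 4" by (simp only: power_mult_distrib)
        also have "\<dots> \<le> (2 * 16 ^ 4) * h ^ 4" by simp
        finally have "(Suc h) ^ 4 \<le> 2 * h ^ 4" by simp
        then show ?case using step by simp
      qed simp
      then show ?thesis by (metis of_nat_le_iff of_nat_numeral of_nat_power)
    qed
    then have "(real d / 3) ^ 4 \<le> 2 ^ h"
      using h rd0 by (intro order_trans[OF power_mono[of "real d / 3" "real h" 4]]) auto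
    then have e: "real d ^ 4 / 81 \<le> 2 ^ h" by (simp add: power_divide)
    have "pweight_rest j \<le> 1 / (2 * real j * 2 ^ h)"
      unfolding h_def by (rule pweight_rest_bounds(2)[OF j0])
    also have "\<dots> \<le> 1 / (1 * (real d ^ 4 / 81))"
      using e j0 rd0 by (intro divide_left_mono mult_mono) auto
    also have "\<dots> = 81 / real d * (1 / real d ^ 3)" using rd0 by (simp add: power3_eq_cube power4_eq_xxxx field_simps)
    also have "\<dots> \<le> 1 * (1 / real d ^ 3)"
      using rd rd0 by (intro mult_right_mono) auto
    also have "\<dots> \<le> g * (1 / 1000)"
    proof -
      have "1000 * (1 / real d ^ 3) \<le> 2 ^ 35 / real d ^ 3" using rd0 by (simp add: divide_right_mono)
      then show ?thesis using gbig by linarith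
    qed
    finally have "pweight_rest j \<le> g * (1 / 1000)" .
    then show ?thesis unfolding pweight_eq using 1 g0 by linarith
  qed
  have piece: "real j * pweight j * \<phi> (d - j)
      \<le> real d * (1036 / 1000 * g) * \<phi> (d - j) + 430000 / (real d)\<^sup>2 * (real j * pweight j)"
    if j: "j \<in> {1..d}" for j
  proof (cases "99 * d \<le> 100 * j")
    case True
    have "real j * pweight j * \<phi> (d - j) \<le> real d * (1036 / 1000 * g) * \<phi> (d - j)"
      using j pw[OF True] pweight_nonneg \<phi>_nonneg by (intro mult_right_mono mult_mono) auto
    moreover have "0 \<le> 430000 / (real d)\<^sup>2 * (real j * pweight j)" using pweight_nonneg by simp
    ultimately show ?thesis by linarith
  next
    case False
    then have i: "0 < d - j" "real d \<le> 100 * real (d - j)" using j by (auto simp: of_nat_diff)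
    have "(real d)\<^sup>2 * \<phi> (d - j) \<le> (100 * real (d - j))\<^sup>2 * \<phi> (d - j)"
      using i(2) \<phi>_nonneg by (intro mult_right_mono power_mono) auto
    also have "\<dots> = 10000 * ((real (d - j))\<^sup>2 * \<phi> (d - j))" by (simp add: power_mult_distrib)
    also have "\<dots> \<le> 10000 * 43" using \<phi>_le_inverse_square[OF i(1)] by (intro mult_left_mono) auto
    finally have "\<phi> (d - j) \<le> 430000 / (real d)\<^sup>2" using rd0 by (simp add: field_simps)
    then have "(real j * pweight j) * \<phi> (d - j) \<le> (real j * pweight j) * (430000 / (real d)\<^sup>2)"
      using pweight_nonneg by (intro mult_left_mono) auto
    moreover have "0 \<le> real d * (1036 / 1000 * g) * \<phi> (d - j)" using g0 \<phi>_nonneg by simp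
    ultimately show ?thesis by (simp add: mult_ac)
  qed
  have "real d * \<phi> d \<le> (\<Sum>j=1..d. real d * (1036 / 1000 * g) * \<phi> (d - j) + 430000 / (real d)\<^sup>2 * (real j * pweight j))"
    unfolding \<phi>_rec[OF d0] by (rule sum_mono) (rule piece)
  also have "\<dots> = real d * (1036 / 1000 * g) * (\<Sum>j=1..d. \<phi> (d - j))
      + 430000 / (real d)\<^sup>2 * (\<Sum>j=1..d. real j * pweight j)"
    by (simp only: sum.distrib sum_distrib_left)
  also have "(\<Sum>j=1..d. \<phi> (d - j)) = (\<Sum>i<d. \<phi> i)"
    by (rule sum.reindex_bij_witness[of _ "\<lambda>i. d - i" "\<lambda>j. d - j"]) auto
  also have "real d * (1036 / 1000 * g) * (\<Sum>i<d. \<phi> i) \<le> real d * (1036 / 1000 * g) * (491 / 200)"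
  proof (rule mult_left_mono)
    have "(\<Sum>i<d. \<phi> i) \<le> (\<Sum>i\<le>d. \<phi> i)" by (rule sum_mono2) (auto simp: \<phi>_nonneg)
    also have "\<dots> \<le> 491 / 200" by (rule sum_\<phi>_le)
    finally show "(\<Sum>i<d. \<phi> i) \<le> 491 / 200" .
  qed (use g0 in auto)
  also have "430000 / (real d)\<^sup>2 * (\<Sum>j=1..d. real j * pweight j) \<le> 430000 / (real d)\<^sup>2 * (11 / 4)"
    using sum_index_pweight_le[of d] by (intro mult_left_mono) auto
  also have "430000 / (real d)\<^sup>2 * (11 / 4) = real d * (430000 * 11 / 4 / real d ^ 3)"
    using rd0 by (simp add: power3_eq_cube power2_eq_square field_simps)
  also have "\<dots> \<le> real d * (g * (1 / 10000))"
  proof (rule mult_left_mono)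
    have "(430000 * 11 / 4 / real d ^ 3) * 10000 \<le> 2 ^ 35 / real d ^ 3"
      using rd0 by (simp add: divide_right_mono)
    then show "430000 * 11 / 4 / real d ^ 3 \<le> g * (1 / 10000)" using gbig by linarith
  qed simp
  finally have "real d * \<phi> d \<le> real d * (1036 / 1000 * g * (491 / 200) + g * (1 / 10000))"
    by (simp add: algebra_simps)
  then have "\<phi> d \<le> 1036 / 1000 * g * (491 / 200) + g * (1 / 10000)" using rd0 by (simp only: mult_le_cancel_left_pos)
  also have "\<dots> \<le> 51 / 20 * g" using g0 by simp
  finally show ?thesis by (simp add: g_def)
qed

end

section \<open>Likelihood ratio order of products of linear factors\<close>

definition linprod :: "real list \<Rightarrow> real poly" where
  "linprod xs = (\<Prod>x\<leftarrow>xs. [:1, x:])"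

lemma linprod_Nil [simp]: "linprod [] = 1"
  and linprod_Cons: "linprod (x # xs) = [:1, x:] * linprod xs"
  and linprod_append: "linprod (xs @ ys) = linprod xs * linprod ys"
  by (simp_all add: linprod_def)

lemma linprod_sort: "linprod (sort xs) = linprod xs"
proof -
  have "linprod ys = prod_mset (image_mset (\<lambda>x. [:1, x:]) (mset ys))" for ys
    by (simp add: linprod_def flip: prod_mset_prod_list)
  then show ?thesis by simp
qed

lemma coeff_linear_mult:
  "coeff ([:1, x:] * p) 0 = (coeff p 0 :: real)"
  "coeff ([:1, x:] * p) (Suc k) = coeff p (Suc k) + x * coeff p k"
  by simp_all

lemma coeff_linprod_nonneg: "(\<And>x. x \<in> set xs \<Longrightarrow> 0 \<le> x) \<Longrightarrow> 0 \<le> coeff (linprod xs) k"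
proof (induction xs arbitrary: k)
  case Nil
  then show ?case by (cases k) auto
next
  case (Cons x xs)
  then show ?case unfolding linprod_Cons by (cases k) (auto simp: coeff_linear_mult simp del: mult_pCons_left)
qed

lemma degree_linprod: "degree (linprod xs) \<le> length xs"
proof (induction xs)
  case (Cons x xs)
  have "degree (linprod (x # xs)) \<le> degree [:1, x:] + degree (linprod xs)"
    unfolding linprod_Cons by (rule degree_mult_le)
  also have "\<dots> \<le> 1 + length xs" by (rule add_mono) (use Cons in auto)
  finally show ?case by simp
qed simp

lemma coeff_linprod_0: "coeff (linprod xs) 0 = 1"
  by (induction xs) (simp_all add: linprod_Cons)

lemma coeff_linprod_top: "coeff (linprod xs) (length xs) = prod_list xs"
proof (induction xs)
  case (Cons x xs)
  have "coeff (linprod xs) (Suc (length xs)) = 0"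
    by (rule coeff_eq_0) (use degree_linprod[of xs] in linarith)
  then show ?case using Cons by (simp add: linprod_Cons)
qed simp

lemma poly_linprod: "poly (linprod xs) z = (\<Prod>x\<leftarrow>xs. 1 + x * z)"
  by (induction xs) (simp_all add: linprod_Cons algebra_simps)

text \<open>A likelihood ratio order on coefficient sequences. The shifted form is what makes the
  induction over pairs of linear factors go through.\<close>

definition lr :: "real poly \<Rightarrow> real poly \<Rightarrow> bool" where
  "lr p q \<longleftrightarrow> (\<forall>i a b. coeff p (i + a + b) * coeff q i \<le> coeff p (i + a) * coeff q (i + b))"

text \<open>The shift \<open>P\<close>, \<open>Q\<close> with value 0 in front removes the special
  case of the constant coefficient. Pure terms are instances of the hypothesis. Mixed terms compare
  only jointly, through \<open>A + B \<le> A' + B'\<close> with weight \<open>x\<close> and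
  \<open>A \<le> B'\<close> with weight \<open>y - x \<ge> 0\<close>.\<close>

lemma lr_linear_mult:
  assumes lr: "lr p q" and xy: "0 \<le> x" "x \<le> y" and p: "\<And>k. 0 \<le> coeff p k" and q: "\<And>k. 0 \<le> coeff q k"
  shows "lr ([:1, x:] * p) ([:1, y:] * q)"
proof -
  define P where "P k = (case k of 0 \<Rightarrow> 0 | Suc k \<Rightarrow> coeff p k)" for k
  define Q where "Q k = (case k of 0 \<Rightarrow> 0 | Suc k \<Rightarrow> coeff q k)" for k
  have P0: "0 \<le> P k" and Q0: "0 \<le> Q k" for k using p q by (auto simp: P_def Q_def split: nat.split)
  have cp: "coeff ([:1, x:] * p) k = P (Suc k) + x * P k" for k
    by (cases k) (simp_all add: P_def)
  have cq: "coeff ([:1, y:] * q) k = Q (Suc k) + y * Q k" for k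
    by (cases k) (simp_all add: Q_def)
  have L: "P (i + a + b) * Q i \<le> P (i + a) * Q (i + b)" for i a b
  proof (cases i)
    case 0
    then show ?thesis using P0 Q0 by (simp add: Q_def)
  next
    case (Suc i')
    then show ?thesis using lr by (simp add: lr_def P_def Q_def)
  qed
  show ?thesis
    unfolding lr_def cp cq
  proof (intro allI)
    fix i a b
    show "(P (Suc (i + a + b)) + x * P (i + a + b)) * (Q (Suc i) + y * Q i)
        \<le> (P (Suc (i + a)) + x * P (i + a)) * (Q (Suc (i + b)) + y * Q (i + b))"
    proof (cases "a = 0 \<and> b = 0")
      case False
      define A where "A = P (Suc (i + a + b)) * Q i"
      define B where "B = P (i + a + b) * Q (Suc i)"
      define A' where "A' = P (i + a) * Q (Suc (i + b))"
      define B' where "B' = P (Suc (i + a)) * Q (i + b)"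
      have AB': "A \<le> B'" using L[of i "Suc a" b] by (simp add: A_def B'_def)
      have AA': "A \<le> A'" using L[of i a "Suc b"] by (simp add: A_def A'_def)
      have sum: "A + B \<le> A' + B'"
      proof (cases "b = 0")
        case True
        then obtain a' where "a = Suc a'" using False by (cases a) auto
        then have "B \<le> A'" using L[of "Suc i" a' b] by (simp add: B_def A'_def)
        then show ?thesis using AB' by linarith
      next
        case False
        then obtain b' where "b = Suc b'" by (cases b) auto
        then have "B \<le> B'" using L[of "Suc i" a b'] by (simp add: B_def B'_def)
        then show ?thesis using AA' by linarith
      qed
      have "x * (A + B) \<le> x * (A' + B')" using sum xy by (intro mult_left_mono) auto
      moreover have "(y - x) * A \<le> (y - x) * B'" using AB' xy by (intro mult_left_mono) auto
      moreover have "y * A + x * B = x * (A + B) + (y - x) * A" "y * B' + x * A' = x * (A' + B') + (y - x) * B'"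
        by (simp_all add: algebra_simps)
      ultimately have cross: "y * A + x * B \<le> y * B' + x * A'" by linarith
      have "P (Suc (i + a + b)) * Q (Suc i) \<le> P (Suc (i + a)) * Q (Suc (i + b))"
        using L[of "Suc i" a b] by simp
      moreover have "(x * y) * (P (i + a + b) * Q i) \<le> (x * y) * (P (i + a) * Q (i + b))"
        using L[of i a b] xy by (intro mult_left_mono) auto
      moreover have "(P (Suc (i + a + b)) + x * P (i + a + b)) * (Q (Suc i) + y * Q i)
          = P (Suc (i + a + b)) * Q (Suc i) + (y * A + x * B) + (x * y) * (P (i + a + b) * Q i)"
        by (simp add: A_def B_def algebra_simps)
      moreover have "(P (Suc (i + a)) + x * P (i + a)) * (Q (Suc (i + b)) + y * Q (i + b))
          = P (Suc (i + a)) * Q (Suc (i + b)) + (y * B' + x * A') + (x * y) * (P (i + a) * Q (i + b))"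
        by (simp add: A'_def B'_def algebra_simps)
      ultimately show ?thesis using cross by linarith
    qed simp
  qed
qed

lemma lr_linprod:
  assumes "list_all2 (\<le>) xs ys" "\<And>x. x \<in> set xs \<Longrightarrow> 0 \<le> x"
  shows "lr (linprod xs) (linprod ys)"
  using assms
proof (induction rule: list_all2_induct)
  case Nil
  show ?case by (auto simp: lr_def coeff_pCons one_pCons split: nat.split)
next
  case (Cons x xs y ys)
  have "0 \<le> y'" if y': "y' \<in> set ys" for y'
  proof -
    obtain k where k: "k < length ys" "y' = ys ! k" using y' by (auto simp: in_set_conv_nth)
    then have "xs ! k \<le> ys ! k" "xs ! k \<in> set xs"
      using Cons.hyps(2) by (auto simp: list_all2_conv_all_nth)
    then show ?thesis using Cons.prems[of "xs ! k"] k by auto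
  qed
  then show ?case
    unfolding linprod_Cons using Cons by (intro lr_linear_mult coeff_linprod_nonneg) auto
qed

lemma list_all2_sorted_le:
  fixes xs ys :: "'a :: linorder list"
  assumes "sorted xs" "sorted ys" and len: "length xs = length ys"
    and cnt: "\<And>\<theta>. length (filter (\<lambda>x. \<theta> \<le> x) xs) \<le> length (filter (\<lambda>x. \<theta> \<le> x) ys)"
  shows "list_all2 (\<le>) xs ys"
proof -
  have "xs ! i \<le> ys ! i" if i: "i < length xs" for i
  proof (rule ccontr)
    assume "\<not> xs ! i \<le> ys ! i"
    then have lt: "ys ! i < xs ! i" by simp
    have "{i..<length xs} \<subseteq> {k. k < length xs \<and> xs ! i \<le> xs ! k}"
      using assms(1) by (auto intro: sorted_nth_mono)
    then have "card {i..<length xs} \<le> card {k. k < length xs \<and> xs ! i \<le> xs ! k}" by (rule card_mono[rotated]) simp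
    then have 1: "length xs - i \<le> length (filter (\<lambda>x. xs ! i \<le> x) xs)" by (simp add: length_filter_conv_card)
    have "{k. k < length ys \<and> xs ! i \<le> ys ! k} \<subseteq> {Suc i..<length ys}"
    proof
      fix k assume k: "k \<in> {k. k < length ys \<and> xs ! i \<le> ys ! k}"
      have "\<not> k \<le> i"
      proof
        assume "k \<le> i"
        then have "ys ! k \<le> ys ! i" using assms(2) i len by (auto intro: sorted_nth_mono)
        then show False using k lt by auto
      qed
      then show "k \<in> {Suc i..<length ys}" using k by auto
    qed
    then have "card {k. k < length ys \<and> xs ! i \<le> ys ! k} \<le> card {Suc i..<length ys}" by (rule card_mono[rotated]) simp
    then have 2: "length (filter (\<lambda>x. xs ! i \<le> x) ys) \<le> length ys - Suc i" by (simp add: length_filter_conv_card)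
    show False using 1 2 cnt[of "xs ! i"] len i by linarith
  qed
  then show ?thesis using len by (simp add: list_all2_conv_all_nth)
qed

section \<open>Merging pieces moves the linear factors up\<close>

text \<open>The binomial coefficient of a piece of size \<open>n\<close> is the product of
  \<open>(1 + m) + x * m\<close> over the entries \<open>x\<close> of this list.\<close>

definition odds :: "nat \<Rightarrow> real list" where
  "odds n = map (\<lambda>i. (2 * real n - real i) / real i) [1..<n]"

lemma length_odds [simp]: "length (odds n) = n - 1"
  by (simp add: odds_def)

lemma odds_ge_1: "x \<in> set (odds n) \<Longrightarrow> 1 \<le> x"
  by (auto simp: odds_def)

text \<open>An entry is at least \<open>\<theta>\<close> exactly if
  \<open>i \<le> 2 / (\<theta> + 1) * n\<close>, and \<open>\<theta> > 1\<close> keeps this bound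
  below \<open>n\<close>.\<close>

lemma count_odds:
  assumes "1 < \<theta>"
  shows "length (filter (\<lambda>x. \<theta> \<le> x) (odds n)) = nat \<lfloor>2 / (\<theta> + 1) * real n\<rfloor>"
proof -
  let ?k = "2 / (\<theta> + 1)"
  have k: "0 < ?k" "?k < 1" using assms by (auto simp: field_simps)
  have iff: "\<theta> \<le> (2 * real n - real i) / real i \<longleftrightarrow> real i \<le> ?k * real n" if "0 < i" for i
    using that assms by (simp add: field_simps)
  have "length (filter (\<lambda>x. \<theta> \<le> x) (odds n))
      = length (filter (\<lambda>i. \<theta> \<le> (2 * real n - real i) / real i) [1..<n])"
    by (simp add: odds_def filter_map o_def)
  also have "\<dots> = card (set (filter (\<lambda>i. \<theta> \<le> (2 * real n - real i) / real i) [1..<n]))"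
    by (rule distinct_card[symmetric]) simp
  also have "set (filter (\<lambda>i. \<theta> \<le> (2 * real n - real i) / real i) [1..<n]) = {1..nat \<lfloor>?k * real n\<rfloor>}"
  proof (intro equalityI subsetI)
    fix i assume "i \<in> set (filter (\<lambda>i. \<theta> \<le> (2 * real n - real i) / real i) [1..<n])"
    then have "1 \<le> i" "real i \<le> ?k * real n" using iff[of i] by auto
    then show "i \<in> {1..nat \<lfloor>?k * real n\<rfloor>}" by (simp add: le_nat_floor)
  next
    fix i assume i: "i \<in> {1..nat \<lfloor>?k * real n\<rfloor>}"
    then have "real i \<le> real (nat \<lfloor>?k * real n\<rfloor>)" by simp
    also have "\<dots> \<le> ?k * real n" using k by (intro of_nat_floor) simp
    finally have le: "real i \<le> ?k * real n" .
    then have n: "real n > 0" using i by (cases n) auto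
    have "?k * real n < 1 * real n" using k n by (intro mult_strict_right_mono) auto
    then have "i < n" using le by simp
    then show "i \<in> set (filter (\<lambda>i. \<theta> \<le> (2 * real n - real i) / real i) [1..<n])"
      using i le iff[of i] by auto
  qed
  finally show ?thesis by simp
qed

definition deg_sum :: "nat list \<Rightarrow> nat" where
  "deg_sum ns = (\<Sum>n\<leftarrow>ns. n - 1)"

text \<open>Linear factors with each \<open>1 - t\<close> of \<open>signed_poly\<close> replaced by
  \<open>1 + t\<close>. This majorizes the coefficients, and 1 is a lower bound for all entries of
  \<open>odds\<close>.\<close>

definition padded :: "nat \<Rightarrow> nat list \<Rightarrow> real list" where
  "padded d ns = replicate (d - 1 - deg_sum ns) 1 @ concat (map odds ns)"

lemma length_concat_odds: "length (concat (map odds ns)) = deg_sum ns"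
  by (induction ns) (simp_all add: deg_sum_def)

lemma padded_ge_1: "x \<in> set (padded d ns) \<Longrightarrow> 1 \<le> x"
  using odds_ge_1 by (auto simp: padded_def)

text \<open>The counts above a threshold are floors of a fixed multiple of the piece size. Floors
  are superadditive, so pieces of total size at most \<open>d\<close> have no more large entries
  than one piece of size \<open>d\<close>.\<close>

lemma lr_padded:
  assumes "sum_list ns \<le> d" "deg_sum ns \<le> d - 1"
  shows "lr (linprod (padded d ns)) (linprod (odds d))"
proof -
  have fs: "length (filter P (sort xs)) = length (filter P xs)" for P and xs :: "real list"
    by (metis mset_filter mset_sort size_mset)
  have len: "length (padded d ns) = d - 1"
    using assms by (simp add: padded_def length_concat_odds)
  have "list_all2 (\<le>) (sort (padded d ns)) (sort (odds d))"
  proof (rule list_all2_sorted_le)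
    fix \<theta>
    show "length (filter (\<lambda>x. \<theta> \<le> x) (sort (padded d ns))) \<le> length (filter (\<lambda>x. \<theta> \<le> x) (sort (odds d)))"
    proof (cases "\<theta> \<le> 1")
      case True
      then have "filter (\<lambda>x. \<theta> \<le> x) (odds d) = odds d"
        by (intro filter_True) (use odds_ge_1 order_trans in blast)
      then show ?thesis
        using length_filter_le[of "\<lambda>x. \<theta> \<le> x" "padded d ns"] len by (simp add: fs)
    next
      case False
      define \<kappa> where "\<kappa> = 2 / (\<theta> + 1)"
      have k: "0 < \<kappa>" using False by (simp add: \<kappa>_def)
      have "length (filter (\<lambda>x. \<theta> \<le> x) (concat (map odds ns))) \<le> nat \<lfloor>\<kappa> * real (sum_list ns)\<rfloor>"
      proof (induction ns)
        case (Cons n ns)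
        have "nat \<lfloor>\<kappa> * real n\<rfloor> + nat \<lfloor>\<kappa> * real (sum_list ns)\<rfloor> \<le> nat \<lfloor>\<kappa> * real (n + sum_list ns)\<rfloor>"
        proof -
          have "0 \<le> \<lfloor>\<kappa> * real n\<rfloor>" "0 \<le> \<lfloor>\<kappa> * real (sum_list ns)\<rfloor>" using k by simp_all
          moreover have "\<lfloor>\<kappa> * real n\<rfloor> + \<lfloor>\<kappa> * real (sum_list ns)\<rfloor> \<le> \<lfloor>\<kappa> * real n + \<kappa> * real (sum_list ns)\<rfloor>"
            by (rule le_floor_add)
          ultimately show ?thesis
            unfolding of_nat_add distrib_left by (metis nat_add_distrib nat_mono)
        qed
        then show ?case using Cons False count_odds[of \<theta> n] by (simp add: \<kappa>_def)
      qed simp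
      also have "\<dots> \<le> nat \<lfloor>\<kappa> * real d\<rfloor>"
        using assms(1) k by (intro nat_mono floor_mono mult_left_mono) auto
      finally show ?thesis
        using False count_odds[of \<theta> d] unfolding fs by (simp add: padded_def \<kappa>_def)
    qed
  qed (use len in simp_all)
  then have "lr (linprod (sort (padded d ns))) (linprod (sort (odds d)))"
    by (rule lr_linprod) (use padded_ge_1 in force)
  then show ?thesis by (simp only: linprod_sort)
qed

lemma lrD:
  assumes "lr p q" "i \<le> j"
  shows "coeff p j * coeff q i \<le> coeff p i * coeff q j"
proof -
  obtain b where "j = i + b" using assms(2) le_Suc_ex by blast
  then show ?thesis using assms(1)[unfolded lr_def, rule_format, of i 0 b] by simp
qed

text \<open>Chebyshev's sum inequality: \<open>p/q\<close> decreases and \<open>r\<^sup>i \<alpha>\<^sub>i\<close> increases up to \<open>L\<close>; beyond \<open>L\<close> only the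
  former is needed.\<close>

lemma lr_chebyshev:
  fixes r :: real
  assumes lr: "lr p q" and L: "L \<le> D" and a: "\<And>i. i \<le> D \<Longrightarrow> 0 \<le> \<alpha> i" and r: "0 < r"
    and inc: "\<And>i j. i \<le> j \<Longrightarrow> j \<le> L \<Longrightarrow> r ^ i * \<alpha> i \<le> r ^ j * \<alpha> j"
  shows "(\<Sum>i\<le>D. coeff p i * \<alpha> i) * (\<Sum>j\<le>L. coeff q j / r ^ j)
    \<le> (\<Sum>j\<le>L. coeff p j / r ^ j) * (\<Sum>i\<le>D. coeff q i * \<alpha> i)"
proof -
  define p' where "p' = coeff p"
  define q' where "q' = coeff q"
  \<comment> \<open>The difference of the two sides is the double sum of \<open>m\<close>. For
    \<open>i, j \<le> L\<close> the terms \<open>m i j\<close> and \<open>m j i\<close> are paired;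
    for \<open>i > L\<close> each term has the right sign alone.\<close>
  define m where "m i j = (p' i * q' j - p' j * q' i) * (\<alpha> i / r ^ j)" for i j
  have X: "(\<Sum>i\<le>D. p' i * \<alpha> i) * (\<Sum>j\<le>L. q' j / r ^ j) - (\<Sum>j\<le>L. p' j / r ^ j) * (\<Sum>i\<le>D. q' i * \<alpha> i)
      = (\<Sum>i\<le>D. \<Sum>j\<le>L. m i j)"
    unfolding sum_product sum.swap[of _ "{..L}" "{..D}"] sum_subtractf[symmetric] m_def
    by (intro sum.cong refl) (simp add: algebra_simps)
  have tail: "m i j \<le> 0" if "i \<in> {Suc L..D}" "j \<in> {..L}" for i j
    unfolding m_def using lrD[OF lr, of j i] that a[of i] r
    by (intro mult_nonpos_nonneg) (auto simp: p'_def q'_def algebra_simps)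
  have sym: "m i j + m j i \<le> 0" if "i \<le> j" "j \<le> L" for i j
  proof -
    have "r ^ i * \<alpha> i / (r ^ i * r ^ j) \<le> r ^ j * \<alpha> j / (r ^ i * r ^ j)"
      using inc[OF that] r by (intro divide_right_mono) auto
    then have "\<alpha> i / r ^ j - \<alpha> j / r ^ i \<le> 0" using r by simp
    moreover have "0 \<le> p' i * q' j - p' j * q' i" using lrD[OF lr that(1)] by (simp add: p'_def q'_def)
    ultimately have "(p' i * q' j - p' j * q' i) * (\<alpha> i / r ^ j - \<alpha> j / r ^ i) \<le> 0"
      by (rule mult_nonneg_nonpos[rotated])
    then show ?thesis by (simp add: m_def algebra_simps)
  qed
  have "(\<Sum>i\<le>D. \<Sum>j\<le>L. m i j) = (\<Sum>i\<in>{..L} \<union> {Suc L..D}. \<Sum>j\<le>L. m i j)"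
    using L by (intro sum.cong) auto
  also have "\<dots> = (\<Sum>i\<le>L. \<Sum>j\<le>L. m i j) + (\<Sum>i=Suc L..D. \<Sum>j\<le>L. m i j)"
    by (rule sum.union_disjoint) auto
  also have "(\<Sum>i=Suc L..D. \<Sum>j\<le>L. m i j) \<le> 0" using tail by (intro sum_nonpos) auto
  also have "(\<Sum>i\<le>L. \<Sum>j\<le>L. m i j) \<le> 0"
  proof -
    have "2 * (\<Sum>i\<le>L. \<Sum>j\<le>L. m i j) = (\<Sum>i\<le>L. \<Sum>j\<le>L. m i j) + (\<Sum>i\<le>L. \<Sum>j\<le>L. m j i)"
      using sum.swap[of m "{..L}" "{..L}"] by simp
    also have "\<dots> = (\<Sum>i\<le>L. \<Sum>j\<le>L. m i j + m j i)" by (simp only: sum.distrib)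
    also have "\<dots> \<le> 0"
    proof (intro sum_nonpos)
      fix i j assume "i \<in> {..L}" "j \<in> {..L}"
      then show "m i j + m j i \<le> 0" using sym[of i j] sym[of j i] by (cases "i \<le> j") auto
    qed
    finally show ?thesis by simp
  qed
  finally show ?thesis using X by (simp add: p'_def q'_def)
qed

lemma abs_coeff_minus_power_le:
  assumes "\<And>i. 0 \<le> coeff W i"
  shows "\<bar>coeff ([:1, -1:] ^ k * W) i\<bar> \<le> coeff ([:1, 1:] ^ k * W) (i :: nat) \<and> 0 \<le> coeff ([:1, 1 :: real:] ^ k * W) i"
proof (induction k arbitrary: i)
  case 0
  then show ?case using assms by simp
next
  case (Suc k)
  show ?case
  proof (cases i)
    case 0
    then show ?thesis using Suc[of 0] by (simp only: power_Suc mult.assoc coeff_linear_mult)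
  next
    case (Suc i')
    have "\<bar>coeff ([:1, -1:] ^ k * W) (Suc i') + (-1) * coeff ([:1, -1:] ^ k * W) i'\<bar>
        \<le> coeff ([:1, 1:] ^ k * W) (Suc i') + 1 * coeff ([:1, 1:] ^ k * W) i'"
      using Suc.IH[of "Suc i'"] Suc.IH[of i'] by linarith
    moreover have "0 \<le> coeff ([:1, 1:] ^ k * W) (Suc i') + 1 * coeff ([:1, 1:] ^ k * W) i'"
      using Suc.IH[of "Suc i'"] Suc.IH[of i'] by linarith
    ultimately show ?thesis by (simp only: Suc power_Suc mult.assoc coeff_linear_mult) 
  qed
qed

text \<open>Moves one linear factor from the polynomial to the sequence; this is how a factor
  \<open>1 - t\<close> becomes a difference of neighbours.\<close>

lemma sum_coeff_linear_mult:
  assumes "degree p < D"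
  shows "(\<Sum>i\<le>D. coeff ([:1, x:] * p) i * \<alpha> i) = (\<Sum>i<D. coeff p i * (\<alpha> i + x * \<alpha> (Suc i)) :: real)"
proof -
  have D: "coeff p D = 0" using assms by (simp add: coeff_eq_0)
  obtain n where n: "D = Suc n" using assms by (cases D) auto
  have "(\<Sum>i\<le>D. coeff ([:1, x:] * p) i * \<alpha> i)
      = coeff p 0 * \<alpha> 0 + (\<Sum>i\<le>n. (coeff p (Suc i) + x * coeff p i) * \<alpha> (Suc i))"
    unfolding n by (subst sum.atMost_Suc_shift) (simp only: coeff_linear_mult)
  also have "\<dots> = (coeff p 0 * \<alpha> 0 + (\<Sum>i\<le>n. coeff p (Suc i) * \<alpha> (Suc i))) + (\<Sum>i\<le>n. coeff p i * (x * \<alpha> (Suc i)))"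
    by (simp add: distrib_right distrib_left sum.distrib mult_ac)
  also have "coeff p 0 * \<alpha> 0 + (\<Sum>i\<le>n. coeff p (Suc i) * \<alpha> (Suc i)) = (\<Sum>i\<le>Suc n. coeff p i * \<alpha> i)"
    by (subst sum.atMost_Suc_shift) simp
  also have "\<dots> = (\<Sum>i\<le>n. coeff p i * \<alpha> i)" using D n by simp
  finally show ?thesis
    by (simp add: n lessThan_Suc_atMost distrib_left sum.distrib)
qed

text \<open>Ratios of neighbouring \<open>\<alpha>\<close> in \<open>[1/4, 4]\<close> give \<open>\<bar>\<alpha>\<^sub>i - \<alpha>\<^sub>i\<^sub>+\<^sub>1\<bar> \<le> 3/5 (\<alpha>\<^sub>i + \<alpha>\<^sub>i\<^sub>+\<^sub>1)\<close>, except at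
  the two ends.\<close>

lemma minus_power_functional_le:
  fixes \<alpha> :: "nat \<Rightarrow> real"
  assumes D: "2 \<le> D" and a0: "\<alpha> 0 = 0" "\<alpha> D = 0" and apos: "\<And>i. i \<le> D \<Longrightarrow> 0 \<le> \<alpha> i"
    and r: "\<And>i. 0 < i \<Longrightarrow> i < D - 1 \<Longrightarrow> \<alpha> i \<le> 4 * \<alpha> (Suc i)"
      "\<And>i. 0 < i \<Longrightarrow> i < D - 1 \<Longrightarrow> \<alpha> (Suc i) \<le> 4 * \<alpha> i"
    and W: "\<And>i. 0 \<le> coeff W i" and deg: "degree ([:1, 1:] ^ k * W) < D" "degree ([:1, -1:] ^ k * W) < D"
  defines "p \<equiv> [:1, 1:] ^ Suc k * W"
  shows "\<bar>\<Sum>i\<le>D. coeff ([:1, -1:] ^ Suc k * W) i * \<alpha> i\<bar>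
    \<le> 3 / 5 * (\<Sum>i\<le>D. coeff p i * \<alpha> i) + 2 / 5 * (coeff p 0 * \<alpha> 1 + coeff p D * \<alpha> (D - 1))"
proof -
  let ?V = "[:1, 1:] ^ k * W" and ?W = "[:1, -1:] ^ k * W"
  have V0: "0 \<le> coeff ?V i" and WV: "\<bar>coeff ?W i\<bar> \<le> coeff ?V i" for i
    using abs_coeff_minus_power_le[OF W, of k i] by auto
  \<comment> \<open>At both ends one neighbour is 0 and the difference is the full value, so 2/5 has
    to be added to 3/5.\<close>
  define e where "e i = (if i = 0 then \<alpha> 1 else 0) + (if i = D - 1 then \<alpha> (D - 1) else 0)" for i
  have diff: "\<bar>\<alpha> i + (-1) * \<alpha> (Suc i)\<bar> \<le> 3 / 5 * (\<alpha> i + 1 * \<alpha> (Suc i)) + 2 / 5 * e i" if i: "i < D" for i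
  proof -
    consider "i = 0" | "i = D - 1" "i \<noteq> 0" | "0 < i" "i < D - 1" using i by linarith
    then show ?thesis
    proof cases
      case 1
      then show ?thesis using D a0 apos[of 1] by (simp add: e_def)
    next
      case 2
      then have "Suc i = D" using i by simp
      then show ?thesis using 2 a0 apos[of "D - 1"] by (simp add: e_def)
    next
      case 3
      then have "e i = 0" by (simp add: e_def)
      moreover have "\<bar>\<alpha> i - \<alpha> (Suc i)\<bar> \<le> 3 / 5 * \<alpha> i + 3 / 5 * \<alpha> (Suc i)"
        by (rule abs_leI) (use r[OF 3] in linarith)+
      ultimately show ?thesis by (simp add: distrib_left)
    qed
  qed
  have p: "p = [:1, 1:] * ?V" by (simp only: p_def power_Suc mult.assoc)
  have p0: "coeff p 0 = coeff ?V 0" unfolding p by (rule coeff_linear_mult)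
  have pD: "coeff p D = coeff ?V (D - 1)"
  proof -
    have "coeff ?V D = 0" using deg by (simp add: coeff_eq_0)
    moreover have "D = Suc (D - 1)" using D by simp
    ultimately show ?thesis unfolding p by (metis coeff_linear_mult(2) add_0 mult_1)
  qed
  have "\<bar>\<Sum>i\<le>D. coeff ([:1, -1:] ^ Suc k * W) i * \<alpha> i\<bar> = \<bar>\<Sum>i<D. coeff ?W i * (\<alpha> i + (-1) * \<alpha> (Suc i))\<bar>"
    by (simp only: power_Suc mult.assoc sum_coeff_linear_mult[OF deg(2)])
  also have "\<dots> \<le> (\<Sum>i<D. \<bar>coeff ?W i * (\<alpha> i + (-1) * \<alpha> (Suc i))\<bar>)" by (rule sum_abs)
  also have "\<dots> \<le> (\<Sum>i<D. coeff ?V i * (3 / 5 * (\<alpha> i + 1 * \<alpha> (Suc i)) + 2 / 5 * e i))"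
    unfolding abs_mult using WV V0 diff by (intro sum_mono mult_mono) auto
  also have "\<dots> = 3 / 5 * (\<Sum>i<D. coeff ?V i * (\<alpha> i + 1 * \<alpha> (Suc i))) + 2 / 5 * (\<Sum>i<D. coeff ?V i * e i)"
    by (simp only: distrib_left sum.distrib sum_distrib_left mult.left_commute)
  also have "(\<Sum>i<D. coeff ?V i * (\<alpha> i + 1 * \<alpha> (Suc i))) = (\<Sum>i\<le>D. coeff p i * \<alpha> i)"
    unfolding p by (rule sum_coeff_linear_mult[OF deg(1), symmetric])
  also have "(\<Sum>i<D. coeff ?V i * e i) = coeff p 0 * \<alpha> 1 + coeff p D * \<alpha> (D - 1)"
  proof -
    have "(\<Sum>i<D. coeff ?V i * e i) = (\<Sum>i<D. if i = 0 then coeff ?V i * \<alpha> 1 else 0)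
        + (\<Sum>i<D. if i = D - 1 then coeff ?V i * \<alpha> (D - 1) else 0)"
      unfolding sum.distrib[symmetric] by (intro sum.cong) (auto simp: e_def distrib_left)
    then show ?thesis using D by (simp add: p0 pD sum.delta)
  qed
  finally show ?thesis .
qed

section \<open>The Ehrhart polynomial as a sum over lists of pieces\<close>

text \<open>\<open>tsum d F\<close> is the coefficient extraction from the exponential formula as a positive linear
  functional: \<open>F\<close> is summed over the lists of piece sizes with their weights.\<close>

function tsum :: "nat \<Rightarrow> (nat list \<Rightarrow> real) \<Rightarrow> real" where
  "tsum d F = (if d = 0 then F [] else
     (\<Sum>s\<in>{1..d}. (\<Sum>k\<in>{1..s}. tsum (d - s) (\<lambda>ns. F (gcd k s # ns))) / real s) / real d)"
  by auto
termination by (relation "Wellfounded.measure fst") auto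

declare tsum.simps [simp del]

lemma tsum_0 [simp]: "tsum 0 F = F []"
  by (subst tsum.simps) simp

lemma tsum_rec:
  assumes "0 < d"
  shows "tsum d F = (\<Sum>s=1..d. (\<Sum>k=1..s. tsum (d - s) (\<lambda>ns. F (gcd k s # ns))) / real s) / real d"
  using assms by (subst tsum.simps) simp

lemma tsum_add: "tsum d (\<lambda>ns. F ns + G ns) = tsum d F + tsum d G"
proof (induction d arbitrary: F G rule: less_induct)
  case (less d)
  show ?case
  proof (cases "d = 0")
    case False
    then have d: "0 < d" by simp
    have "tsum d (\<lambda>ns. F ns + G ns) = (\<Sum>s=1..d. (\<Sum>k=1..s. tsum (d - s) (\<lambda>ns. F (gcd k s # ns))
        + tsum (d - s) (\<lambda>ns. G (gcd k s # ns))) / real s) / real d"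
      unfolding tsum_rec[OF d]
      by (intro arg_cong2[where f = "(/)"] sum.cong refl less.IH) (use d in auto)
    then show ?thesis by (simp add: tsum_rec[OF d] sum.distrib add_divide_distrib)
  qed simp
qed

lemma tsum_cmult: "tsum d (\<lambda>ns. c * F ns) = c * tsum d F"
proof (induction d arbitrary: F rule: less_induct)
  case (less d)
  show ?case
  proof (cases "d = 0")
    case False
    then have d: "0 < d" by simp
    have "tsum d (\<lambda>ns. c * F ns)
        = (\<Sum>s=1..d. (\<Sum>k=1..s. c * tsum (d - s) (\<lambda>ns. F (gcd k s # ns))) / real s) / real d"
      unfolding tsum_rec[OF d]
      by (intro arg_cong2[where f = "(/)"] sum.cong refl less.IH) (use d in auto)
    then show ?thesis by (simp add: tsum_rec[OF d] sum_distrib_left)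
  qed simp
qed

lemma tsum_zero: "tsum d (\<lambda>_. 0) = 0"
  using tsum_cmult[of d 0 "\<lambda>_. 0"] by simp

lemma tsum_sum: "finite A \<Longrightarrow> tsum d (\<lambda>ns. \<Sum>i\<in>A. F i ns) = (\<Sum>i\<in>A. tsum d (F i))"
  by (induction A rule: finite_induct) (simp_all add: tsum_zero tsum_add)

text \<open>The sizes sum to at most \<open>d\<close>, possibly less: a bridge of length
  \<open>s\<close> enters with the size \<open>gcd k s \<le> s\<close>.\<close>

definition valid :: "nat \<Rightarrow> nat list \<Rightarrow> bool" where
  "valid d ns \<longleftrightarrow> (\<forall>n\<in>set ns. 1 \<le> n) \<and> sum_list ns \<le> d \<and> (0 < d \<longrightarrow> ns \<noteq> [])"

lemma valid_Cons:
  assumes "valid (d - s) ns" "s \<in> {1..d}" "k \<in> {1..s}"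
  shows "valid d (gcd k s # ns)"
proof -
  have g: "gcd k s \<le> s" "1 \<le> gcd k s" using assms by (auto intro: gcd_le2_nat simp: Suc_le_eq)
  have "sum_list ns \<le> d - s" using assms by (simp add: valid_def)
  moreover have "s \<le> d" using assms by simp
  ultimately have "gcd k s + sum_list ns \<le> d" using g by linarith
  then show ?thesis using assms g by (auto simp: valid_def)
qed

lemma tsum_mono:
  assumes "\<And>ns. valid d ns \<Longrightarrow> F ns \<le> G ns"
  shows "tsum d F \<le> tsum d G"
  using assms
proof (induction d arbitrary: F G rule: less_induct)
  case (less d)
  show ?case
  proof (cases "d = 0")
    case True
    then show ?thesis using less.prems[of "[]"] by (simp add: valid_def)
  next
    case False
    have "tsum (d - s) (\<lambda>ns. F (gcd k s # ns)) \<le> tsum (d - s) (\<lambda>ns. G (gcd k s # ns))"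
      if "s \<in> {1..d}" "k \<in> {1..s}" for s k
      using that by (intro less.IH less.prems valid_Cons) auto
    then show ?thesis
      unfolding tsum_rec[OF False[unfolded neq0_conv]]
      by (intro divide_right_mono sum_mono) auto
  qed
qed

lemma tsum_cong:
  assumes "\<And>ns. valid d ns \<Longrightarrow> F ns = G ns"
  shows "tsum d F = tsum d G"
  by (rule antisym) (auto intro!: tsum_mono simp: assms)

lemma tsum_nonneg:
  assumes "\<And>ns. valid d ns \<Longrightarrow> 0 \<le> F ns"
  shows "0 \<le> tsum d F"
  using tsum_mono[of d "\<lambda>_. 0" F] assms by (simp add: tsum_zero)

lemma tsum_prod_rec:
  assumes "0 < d"
  shows "real d * tsum d (\<lambda>ns. \<Prod>n\<leftarrow>ns. v n)
    = (\<Sum>s=1..d. (\<Sum>k=1..s. v (gcd k s)) / real s * tsum (d - s) (\<lambda>ns. \<Prod>n\<leftarrow>ns. v n))"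
  using assms by (simp add: tsum_rec tsum_cmult sum_distrib_right)

lemma tsum_one: "tsum d (\<lambda>_. 1) = 1"
proof (induction d rule: less_induct)
  case (less d)
  show ?case
  proof (cases "d = 0")
    case False
    then have d: "0 < d" by simp
    have "tsum d (\<lambda>_. 1) = (\<Sum>s=1..d. (\<Sum>k=1..s. 1) / real s) / real d"
      unfolding tsum_rec[OF d]
      by (intro arg_cong2[where f = "(/)"] sum.cong refl less.IH) (use d in auto)
    also have "\<dots> = (\<Sum>s=1..d. 1) / real d"
      by (intro arg_cong2[where f = "(/)"] sum.cong refl) simp
    finally show ?thesis using d by simp
  qed simp
qed

text \<open>Only \<open>s = d\<close> with \<open>k = d\<close> produces \<open>[d]\<close>; each of
  the two averages contributes \<open>1 / d\<close>.\<close>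

lemma tsum_main:
  assumes d: "0 < d"
  shows "tsum d (\<lambda>ns. if ns = [d] then 1 else 0) = 1 / (real d)\<^sup>2"
proof -
  let ?F = "\<lambda>ns. if ns = [d] then 1 else 0 :: real"
  have "tsum (d - s) (\<lambda>ns. ?F (gcd k s # ns)) = (if s = d \<and> k = d then 1 else 0)"
    if "s \<in> {1..d}" "k \<in> {1..s}" for s k
  proof (cases "s = d")
    case True
    have "gcd k d = d \<longleftrightarrow> k = d"
    proof
      assume "gcd k d = d"
      then have "d dvd k" by (metis gcd_dvd1)
      then show "k = d" using that True by (auto dest: dvd_imp_le)
    qed simp
    then show ?thesis using True by simp
  next
    case False
    then have "tsum (d - s) (\<lambda>ns. ?F (gcd k s # ns)) = tsum (d - s) (\<lambda>_. 0)"
      using that by (intro tsum_cong) (auto simp: valid_def)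
    then show ?thesis using False by (simp add: tsum_zero)
  qed
  then have "tsum d ?F = (\<Sum>s=1..d. (\<Sum>k=1..s. if s = d \<and> k = d then 1 else 0) / real s) / real d"
    unfolding tsum_rec[OF d] by (intro arg_cong2[where f = "(/)"] sum.cong refl) auto
  also have "(\<Sum>s=1..d. (\<Sum>k=1..s. if s = d \<and> k = d then 1 else 0) / real s)
      = (\<Sum>s=1..d. if s = d then 1 / real d else 0)"
  proof (rule sum.cong[OF refl])
    fix s assume "s \<in> {1..d}"
    show "(\<Sum>k=1..s. if s = d \<and> k = d then 1 else 0) / real s = (if s = d then 1 / real d else 0)"
      using d by (cases "s = d") (simp_all add: sum.delta)
  qed
  also have "\<dots> = 1 / real d" using d by (simp add: sum.delta)
  finally show ?thesis by (simp add: power2_eq_square)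
qed

definition trest :: "nat \<Rightarrow> (nat list \<Rightarrow> real) \<Rightarrow> real" where
  "trest d F = tsum d (\<lambda>ns. if ns = [d] then 0 else F ns)"

lemma tsum_split:
  assumes "0 < d"
  shows "tsum d F = F [d] / (real d)\<^sup>2 + trest d F"
proof -
  have "tsum d F = tsum d (\<lambda>ns. F [d] * (if ns = [d] then 1 else 0) + (if ns = [d] then 0 else F ns))"
    by (rule tsum_cong) auto
  then show ?thesis unfolding tsum_add tsum_cmult tsum_main[OF assms] trest_def by simp
qed

lemma trest_add: "trest d (\<lambda>ns. F ns + G ns) = trest d F + trest d G"
proof -
  have "trest d (\<lambda>ns. F ns + G ns) = tsum d (\<lambda>ns. (if ns = [d] then 0 else F ns) + (if ns = [d] then 0 else G ns))"
    unfolding trest_def by (rule tsum_cong) auto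
  then show ?thesis by (simp add: tsum_add trest_def)
qed

lemma trest_cmult: "trest d (\<lambda>ns. c * F ns) = c * trest d F"
proof -
  have "trest d (\<lambda>ns. c * F ns) = tsum d (\<lambda>ns. c * (if ns = [d] then 0 else F ns))"
    unfolding trest_def by (rule tsum_cong) auto
  then show ?thesis by (simp add: tsum_cmult trest_def)
qed

lemma trest_mono:
  assumes "\<And>ns. valid d ns \<Longrightarrow> ns \<noteq> [d] \<Longrightarrow> F ns \<le> G ns"
  shows "trest d F \<le> trest d G"
  unfolding trest_def by (rule tsum_mono) (auto simp: assms)

text \<open>Every list but \<open>[d]\<close> keeps at least one factor \<open>1 - t\<close>, the
  source of the gain 3/5: two pieces lose a degree each, and a single piece is smaller than
  \<open>d\<close>.\<close>

lemma deg_sum_less: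
  assumes "valid d ns" "ns \<noteq> [d]" "0 < d"
  shows "deg_sum ns + 2 \<le> d"
proof -
  have s: "deg_sum ns + length ns = sum_list ns" using assms(1)
  proof (induction ns arbitrary: d)
    case (Cons n ns)
    have "deg_sum ns + length ns = sum_list ns"
      using Cons.IH[of "sum_list ns"] Cons.prems by (cases ns) (auto simp: valid_def deg_sum_def)
    then show ?case using Cons.prems by (auto simp: valid_def deg_sum_def)
  qed (simp add: deg_sum_def)
  obtain n ns' where ns: "ns = n # ns'" using assms by (cases ns) (auto simp: valid_def)
  show ?thesis
  proof (cases ns')
    case Nil
    then have "n \<noteq> d" "n \<le> d" "1 \<le> n" using assms ns by (auto simp: valid_def)
    then show ?thesis using ns Nil by (auto simp: deg_sum_def)
  next
    case (Cons n' ns'')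
    then have "2 \<le> length ns" using ns by simp
    moreover have "sum_list ns \<le> d" using assms by (simp add: valid_def)
    ultimately show ?thesis using s by linarith
  qed
qed

lemma deg_sum_le:
  assumes "valid d ns" "0 < d"
  shows "deg_sum ns \<le> d - 1"
  using deg_sum_less[OF assms(1) _ assms(2)] by (cases "ns = [d]") (auto simp: deg_sum_def)

lemma excursions_0: "excursions m 0 = {[]}"
  by (auto simp: excursions_def)

lemma card_excursions:
  "real (card (excursions m d)) = tsum d (\<lambda>ns. \<Prod>n\<leftarrow>ns. real ((2 * m * n + n - 1) choose (n - 1)))"
proof (induction d rule: less_induct)
  case (less d)
  show ?case
  proof (cases "d = 0")
    case True
    then show ?thesis by (simp add: excursions_0)
  next
    case False
    let ?v = "\<lambda>n. real ((2 * m * n + n - 1) choose (n - 1))"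
    have b: "real (card (bridges m s)) = (\<Sum>k=1..s. ?v (gcd k s)) / real s" if "0 < s" for s
    proof -
      have "real (s * card (bridges m s)) = (\<Sum>k=1..s. ?v (gcd k s))"
        unfolding card_bridges[OF that] by simp
      then show ?thesis using that by (simp add: field_simps)
    qed
    have "real d * real (card (excursions m d))
        = (\<Sum>s=1..d. real (card (bridges m s)) * real (card (excursions m (d - s))))"
      unfolding of_nat_mult[symmetric] card_marked_excursions[OF finite_bridges] by simp
    also have "\<dots> = (\<Sum>s=1..d. (\<Sum>k=1..s. ?v (gcd k s)) / real s * tsum (d - s) (\<lambda>ns. \<Prod>n\<leftarrow>ns. ?v n))"
    proof (rule sum.cong[OF refl])
      fix s assume "s \<in> {1..d}"
      then show "real (card (bridges m s)) * real (card (excursions m (d - s)))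
          = (\<Sum>k=1..s. ?v (gcd k s)) / real s * tsum (d - s) (\<lambda>ns. \<Prod>n\<leftarrow>ns. ?v n)"
        using b[of s] less[of "d - s"] by simp
    qed
    also have "\<dots> = real d * tsum d (\<lambda>ns. \<Prod>n\<leftarrow>ns. ?v n)"
      using False by (intro tsum_prod_rec[symmetric]) simp
    finally show ?thesis using False by simp
  qed
qed

lemma binomial_eq_prod: "real ((N + k) choose k) = (\<Prod>i=1..<Suc k. (real N + real i) / real i)"
proof (induction k)
  case (Suc k)
  have "Suc k * (Suc (N + k) choose Suc k) = Suc (N + k) * ((N + k) choose k)"
    by (simp only: Suc_times_binomial_eq mult.commute)
  then have "real (Suc k) * real ((N + Suc k) choose Suc k) = real (Suc (N + k)) * real ((N + k) choose k)"
    by (metis add_Suc_right of_nat_mult)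
  then have "real ((N + Suc k) choose Suc k) = (real N + real (Suc k)) / real (Suc k) * real ((N + k) choose k)"
    by (simp add: field_simps)
  then show ?case using Suc by simp
qed simp

lemma prod_list_odds: "(\<Prod>x\<leftarrow>odds n. f x) = (\<Prod>i=1..<n. f ((2 * real n - real i) / real i))"
  by (simp add: odds_def o_def prod.distinct_set_conv_list[symmetric] atLeastLessThan_upt[symmetric])

lemma binomial_eq_poly_odds:
  assumes "1 \<le> n"
  shows "real ((2 * m * n + n - 1) choose (n - 1))
    = (1 + real m) ^ (n - 1) * poly (linprod (odds n)) (real m / (1 + real m))"
proof -
  have "real ((2 * m * n + n - 1) choose (n - 1)) = real ((2 * m * n + (n - 1)) choose (n - 1))"
    using assms by simp
  also have "\<dots> = (\<Prod>i=1..<n. (real (2 * m * n) + real i) / real i)"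
    unfolding binomial_eq_prod using assms by simp
  also have "\<dots> = (\<Prod>i=1..<n. (1 + real m) * (1 + (2 * real n - real i) / real i * (real m / (1 + real m))))"
  proof (rule prod.cong[OF refl])
    fix i assume "i \<in> {1..<n}"
    then have i: "real i \<noteq> 0" by simp
    have m: "1 + real m \<noteq> 0" by (metis of_nat_Suc of_nat_neq_0)
    have "(1 + real m) * (1 + q * (real m / (1 + real m))) = (1 + real m) + q * real m" for q
      using m by (simp add: field_simps)
    then have "(1 + real m) * (1 + (2 * real n - real i) / real i * (real m / (1 + real m)))
        = (1 + real m) + (2 * real n - real i) / real i * real m" .
    also have "\<dots> = (real (2 * m * n) + real i) / real i" using i by (simp add: field_simps)
    finally show "(real (2 * m * n) + real i) / real i
        = (1 + real m) * (1 + (2 * real n - real i) / real i * (real m / (1 + real m)))" ..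
  qed
  also have "\<dots> = (1 + real m) ^ (n - 1) * poly (linprod (odds n)) (real m / (1 + real m))"
    unfolding poly_linprod prod_list_odds prod.distrib by simp
  finally show ?thesis .
qed

text \<open>At \<open>t = m / (1 + m)\<close> the factor \<open>1 - t\<close> is
  \<open>1 / (1 + m)\<close>. It thus raises the power of \<open>1 + m\<close> to the common
  \<open>d - 1\<close> without changing the value, see \<open>poly_signed_poly\<close>.\<close>

definition signed_poly :: "nat \<Rightarrow> nat list \<Rightarrow> real poly" where
  "signed_poly d ns = [:1, -1:] ^ (d - 1 - deg_sum ns) * linprod (concat (map odds ns))"

lemma poly_concat_odds:
  assumes "\<And>n. n \<in> set ns \<Longrightarrow> 1 \<le> n"
  shows "(1 + real m) ^ deg_sum ns * poly (linprod (concat (map odds ns))) (real m / (1 + real m))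
    = (\<Prod>n\<leftarrow>ns. real ((2 * m * n + n - 1) choose (n - 1)))"
  using assms
proof (induction ns)
  case (Cons n ns)
  let ?z = "real m / (1 + real m)"
  have d: "deg_sum (n # ns) = (n - 1) + deg_sum ns" by (simp add: deg_sum_def)
  have "(1 + real m) ^ deg_sum (n # ns) * poly (linprod (concat (map odds (n # ns)))) ?z
      = ((1 + real m) ^ (n - 1) * poly (linprod (odds n)) ?z)
        * ((1 + real m) ^ deg_sum ns * poly (linprod (concat (map odds ns))) ?z)"
    by (simp only: d list.map concat.simps linprod_append poly_mult power_add mult_ac)
  also have "(1 + real m) ^ (n - 1) * poly (linprod (odds n)) ?z = real ((2 * m * n + n - 1) choose (n - 1))"
    by (rule binomial_eq_poly_odds[symmetric]) (use Cons.prems in simp)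
  also have "(1 + real m) ^ deg_sum ns * poly (linprod (concat (map odds ns))) ?z
      = (\<Prod>n\<leftarrow>ns. real ((2 * m * n + n - 1) choose (n - 1)))"
    by (rule Cons.IH) (use Cons.prems in simp)
  finally show ?case by simp
qed (simp add: deg_sum_def)

lemma poly_signed_poly:
  assumes "valid d ns" "0 < d"
  shows "(1 + real m) ^ (d - 1) * poly (signed_poly d ns) (real m / (1 + real m))
    = (\<Prod>n\<leftarrow>ns. real ((2 * m * n + n - 1) choose (n - 1)))"
proof -
  let ?z = "real m / (1 + real m)"
  have m: "1 + real m \<noteq> 0" by (metis of_nat_Suc of_nat_neq_0)
  have z: "(1 + real m) * (1 - ?z) = 1" using m by (simp add: field_simps)
  have d: "d - 1 = (d - 1 - deg_sum ns) + deg_sum ns" using deg_sum_le[OF assms] by simp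
  have "(1 + real m) ^ (d - 1) * poly (signed_poly d ns) ?z
      = ((1 + real m) * (1 - ?z)) ^ (d - 1 - deg_sum ns)
        * ((1 + real m) ^ deg_sum ns * poly (linprod (concat (map odds ns))) ?z)"
    by (subst d) (simp add: signed_poly_def poly_power power_add power_mult_distrib)
  also have "\<dots> = (\<Prod>n\<leftarrow>ns. real ((2 * m * n + n - 1) choose (n - 1)))"
    unfolding z using assms by (subst poly_concat_odds) (auto simp: valid_def)
  finally show ?thesis .
qed

lemma degree_signed_poly:
  assumes "valid d ns" "0 < d"
  shows "degree (signed_poly d ns) \<le> d - 1"
proof -
  have "degree (signed_poly d ns) \<le> degree ([:1, -1 :: real:] ^ (d - 1 - deg_sum ns)) + degree (linprod (concat (map odds ns)))"
    unfolding signed_poly_def by (rule degree_mult_le)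
  also have "degree ([:1, -1 :: real:] ^ (d - 1 - deg_sum ns)) \<le> d - 1 - deg_sum ns"
    using degree_power_le[of "[:1, -1 :: real:]" "d - 1 - deg_sum ns"] by simp
  also have "degree (linprod (concat (map odds ns))) \<le> deg_sum ns"
    using degree_linprod[of "concat (map odds ns)"] by (simp only: length_concat_odds)
  finally show ?thesis using deg_sum_le[OF assms] by simp
qed

lemma poly_eq_sum_atMost:
  fixes p :: "real poly"
  assumes "degree p \<le> n"
  shows "poly p x = (\<Sum>i\<le>n. coeff p i * x ^ i)"
  unfolding poly_altdef using assms
  by (intro sum.mono_neutral_left) (auto intro: coeff_eq_0)

text \<open>The coefficients \<open>c_i\<close> of the overview.\<close>

definition magic :: "nat \<Rightarrow> nat \<Rightarrow> real" where
  "magic d i = tsum d (\<lambda>ns. coeff (signed_poly d ns) i)"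

lemma card_excursions_magic:
  assumes d: "0 < d"
  shows "real (card (excursions m d)) = (\<Sum>i\<le>d - 1. magic d i * (real m ^ i * (1 + real m) ^ (d - 1 - i)))"
proof -
  let ?z = "real m / (1 + real m)"
  have m: "1 + real m \<noteq> 0" by (metis of_nat_Suc of_nat_neq_0)
  have "real (card (excursions m d)) = tsum d (\<lambda>ns. (1 + real m) ^ (d - 1) * poly (signed_poly d ns) ?z)"
    unfolding card_excursions by (rule tsum_cong) (rule poly_signed_poly[OF _ d, symmetric])
  also have "\<dots> = tsum d (\<lambda>ns. \<Sum>i\<le>d - 1. (1 + real m) ^ (d - 1) * ?z ^ i * coeff (signed_poly d ns) i)"
  proof (rule tsum_cong)
    fix ns assume "valid d ns"
    then have "poly (signed_poly d ns) ?z = (\<Sum>i\<le>d - 1. coeff (signed_poly d ns) i * ?z ^ i)"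
      by (intro poly_eq_sum_atMost degree_signed_poly d)
    then show "(1 + real m) ^ (d - 1) * poly (signed_poly d ns) ?z
        = (\<Sum>i\<le>d - 1. (1 + real m) ^ (d - 1) * ?z ^ i * coeff (signed_poly d ns) i)"
      by (simp add: sum_distrib_left mult_ac)
  qed
  also have "\<dots> = (\<Sum>i\<le>d - 1. (1 + real m) ^ (d - 1) * ?z ^ i * magic d i)"
    by (simp add: tsum_sum tsum_cmult magic_def)
  also have "\<dots> = (\<Sum>i\<le>d - 1. magic d i * (real m ^ i * (1 + real m) ^ (d - 1 - i)))"
  proof (rule sum.cong[OF refl])
    fix i assume "i \<in> {..d - 1}"
    then have "d - 1 - i + i = d - 1" by simp
    then have "(1 + real m) ^ (d - 1) = (1 + real m) ^ (d - 1 - i) * (1 + real m) ^ i"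
      by (simp only: power_add[symmetric])
    then show "(1 + real m) ^ (d - 1) * ?z ^ i * magic d i = magic d i * (real m ^ i * (1 + real m) ^ (d - 1 - i))"
      using m by (simp add: power_divide)
  qed
  finally show ?thesis .
qed

section \<open>Positivity at the Eulerian zeros\<close>

text \<open>Up to powers of 4/3 and of 2, this is both the value of a piece at 1/3 and its top
  coefficient, so \<open>trest_cweight_le\<close> serves for both.\<close>

definition cweight :: "nat \<Rightarrow> real" where
  "cweight n = real ((2 * n) choose n) / 2 ^ n"

lemma cweight_pos: "0 < cweight n"
  by (simp add: cweight_def zero_less_binomial)

lemma cweight_eq_binomial:
  assumes "1 \<le> n"
  shows "2 ^ (n - 1) * cweight n = real ((n + (n - 1)) choose (n - 1))"
proof -
  obtain k where k: "n = Suc k" using assms by (cases n) auto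
  have "Suc k * (Suc (2 * k + 1) choose Suc k) = Suc (2 * k + 1) * ((2 * k + 1) choose k)"
    by (simp only: Suc_times_binomial_eq mult.commute)
  also have "\<dots> = Suc k * (2 * ((2 * k + 1) choose k))" by simp
  finally have "(Suc (2 * k + 1) choose Suc k) = 2 * ((2 * k + 1) choose k)"
    by (simp only: mult_cancel1) simp
  then have "real (Suc (2 * k + 1) choose Suc k) = 2 * real ((2 * k + 1) choose k)" by simp
  moreover have "2 * n = Suc (2 * k + 1)" "n + (n - 1) = 2 * k + 1" "n - 1 = k" using k by auto
  moreover have "2 ^ k * (2 * c / 2 ^ Suc k) = c" for c :: real by simp
  ultimately show ?thesis by (simp only: cweight_def k)
qed

text \<open>At 1/3 each factor is \<open>2 / 3 * (n + i) / i\<close>, again a binomial product. The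
  point 1/3 belongs to the ratio bound 3 in \<open>eul_ratio_bounds\<close>.\<close>

lemma poly_odds_third:
  assumes "1 \<le> n"
  shows "poly (linprod (odds n)) (1 / 3) = (4 / 3) ^ (n - 1) * cweight n"
proof -
  have "poly (linprod (odds n)) (1 / 3) = (\<Prod>i=1..<n. 2 / 3 * ((real n + real i) / real i))"
    unfolding poly_linprod prod_list_odds by (rule prod.cong) (auto simp: field_simps)
  also have "\<dots> = (2 / 3) ^ (n - 1) * real ((n + (n - 1)) choose (n - 1))"
    unfolding prod.distrib binomial_eq_prod using assms by simp
  also have "\<dots> = ((2 / 3) ^ (n - 1) * 2 ^ (n - 1)) * cweight n"
    unfolding cweight_eq_binomial[OF assms, symmetric] by simp
  also have "(2 / 3) ^ (n - 1) * 2 ^ (n - 1) = (4 / 3 :: real) ^ (n - 1)"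
    by (simp flip: power_mult_distrib)
  finally show ?thesis .
qed

lemma prod_list_odds_eq:
  assumes "1 \<le> n"
  shows "prod_list (odds n) = 2 ^ (n - 1) * cweight n"
proof -
  have "prod_list (odds n) = (\<Prod>i=1..<n. (2 * real n - real i) / real i)"
    using prod_list_odds[of "\<lambda>x. x" n] by simp
  also have "\<dots> = (\<Prod>i=1..<n. 2 * real n - real i) / (\<Prod>i=1..<n. real i)" by (rule prod_dividef)
  also have "(\<Prod>i=1..<n. 2 * real n - real i) = (\<Prod>i=1..<n. real n + real i)"
    by (rule prod.reindex_bij_witness[of _ "\<lambda>i. n - i" "\<lambda>i. n - i"]) (auto simp: of_nat_diff)
  also have "(\<Prod>i=1..<n. real n + real i) / (\<Prod>i=1..<n. real i) = (\<Prod>i=1..<n. (real n + real i) / real i)"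
    by (rule prod_dividef[symmetric])
  also have "\<dots> = real ((n + (n - 1)) choose (n - 1))"
    unfolding binomial_eq_prod using assms by simp
  finally show ?thesis unfolding cweight_eq_binomial[OF assms] .
qed

lemma linprod_padded: "linprod (padded d ns) = [:1, 1:] ^ (d - 1 - deg_sum ns) * linprod (concat (map odds ns))"
proof -
  have "linprod (replicate k 1) = [:1, 1:] ^ k" for k
    by (induction k) (simp_all add: linprod_Cons)
  then show ?thesis by (simp add: padded_def linprod_append)
qed

lemma length_padded:
  assumes "valid d ns" "0 < d"
  shows "length (padded d ns) = d - 1"
  using deg_sum_le[OF assms] by (simp add: padded_def length_concat_odds)

lemma poly_padded_third:
  assumes "valid d ns" "0 < d"
  shows "poly (linprod (padded d ns)) (1 / 3) = (4 / 3) ^ (d - 1) * (\<Prod>n\<leftarrow>ns. cweight n)"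
proof -
  have "poly (linprod (concat (map odds ns))) (1 / 3) = (4 / 3) ^ deg_sum ns * (\<Prod>n\<leftarrow>ns. cweight n)"
    if "\<forall>n\<in>set ns. 1 \<le> n" for ns
    using that
  proof (induction ns)
    case (Cons n ns)
    have "deg_sum (n # ns) = (n - 1) + deg_sum ns" by (simp add: deg_sum_def)
    then show ?case using Cons poly_odds_third[of n]
      by (simp only: list.map concat.simps linprod_append poly_mult power_add) simp
  qed (simp add: deg_sum_def)
  then have "poly (linprod (padded d ns)) (1 / 3)
      = (4 / 3) ^ (d - 1 - deg_sum ns) * ((4 / 3) ^ deg_sum ns * (\<Prod>n\<leftarrow>ns. cweight n))"
    using assms by (simp add: linprod_padded valid_def poly_power)
  also have "\<dots> = (4 / 3) ^ ((d - 1 - deg_sum ns) + deg_sum ns) * (\<Prod>n\<leftarrow>ns. cweight n)"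
    by (simp add: power_add)
  also have "(d - 1 - deg_sum ns) + deg_sum ns = d - 1" using deg_sum_le[OF assms] by simp
  finally show ?thesis .
qed

lemma coeff_padded_top:
  assumes "valid d ns" "0 < d"
  shows "coeff (linprod (padded d ns)) (d - 1) = 2 ^ deg_sum ns * (\<Prod>n\<leftarrow>ns. cweight n)"
proof -
  have "prod_list (concat (map odds ns)) = 2 ^ deg_sum ns * (\<Prod>n\<leftarrow>ns. cweight n)"
    if "\<forall>n\<in>set ns. 1 \<le> n" for ns
    using that
  proof (induction ns)
    case (Cons n ns)
    have "deg_sum (n # ns) = (n - 1) + deg_sum ns" by (simp add: deg_sum_def)
    moreover have "prod_list (odds n) = 2 ^ (n - 1) * cweight n"
      by (rule prod_list_odds_eq) (use Cons.prems in simp)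
    moreover have "prod_list (concat (map odds ns)) = 2 ^ deg_sum ns * (\<Prod>n\<leftarrow>ns. cweight n)"
      by (rule Cons.IH) (use Cons.prems in simp)
    ultimately show ?case
      by (simp only: list.map concat.simps prod_list.append prod_list.Cons power_add mult_ac)
  qed (simp add: deg_sum_def)
  moreover have "prod_list (replicate k (1 :: real)) = 1" for k by (induction k) auto
  ultimately have "prod_list (padded d ns) = 2 ^ deg_sum ns * (\<Prod>n\<leftarrow>ns. cweight n)"
    using assms by (simp add: padded_def valid_def)
  then show ?thesis using coeff_linprod_top[of "padded d ns"] length_padded[OF assms] by simp
qed

text \<open>Divided by \<open>2 ^ n\<close>, the sums of \<open>cweight\<close> products form an
  \<open>exp_sequence\<close>. Removing the list \<open>[d]\<close> turns 51/20 into 31/20.\<close>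

lemma trest_cweight_le:
  assumes d: "2 ^ 72 \<le> d"
  shows "trest d (\<lambda>ns. \<Prod>n\<leftarrow>ns. cweight n) \<le> 31 / 20 * (cweight d / (real d)\<^sup>2)"
proof -
  have d0: "0 < d" using d by (rule less_le_trans[rotated]) simp
  define \<phi> where "\<phi> n = tsum n (\<lambda>ns. \<Prod>n\<leftarrow>ns. cweight n) / 2 ^ n" for n
  interpret exp_sequence \<phi>
  proof
    show "\<phi> 0 = 1" by (simp add: \<phi>_def)
    fix n :: nat assume n: "0 < n"
    have "real n * \<phi> n
        = (\<Sum>s=1..n. (\<Sum>k=1..s. cweight (gcd k s)) / real s * tsum (n - s) (\<lambda>ns. \<Prod>n\<leftarrow>ns. cweight n) / 2 ^ n)"
      unfolding \<phi>_def times_divide_eq_right tsum_prod_rec[OF n] sum_divide_distrib ..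
    also have "\<dots> = (\<Sum>j=1..n. real j * pweight j * \<phi> (n - j))"
    proof (rule sum.cong[OF refl])
      fix j assume j: "j \<in> {1..n}"
      then have "(2 :: real) ^ n = 2 ^ j * 2 ^ (n - j)" by (simp flip: power_add)
      then show "(\<Sum>k=1..j. cweight (gcd k j)) / real j * tsum (n - j) (\<lambda>ns. \<Prod>n\<leftarrow>ns. cweight n) / 2 ^ n
          = real j * pweight j * \<phi> (n - j)"
        using j by (simp add: pweight_def \<phi>_def cweight_def power2_eq_square)
    qed
    finally show "real n * \<phi> n = (\<Sum>j=1..n. real j * pweight j * \<phi> (n - j))" .
  qed
  have two: "(2 :: real) ^ d * 2 ^ d = 4 ^ d" by (simp flip: power_mult_distrib)
  have cb: "cbin d * 2 ^ d = cweight d"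
    unfolding cbin_def cweight_def two[symmetric] by simp
  have "tsum d (\<lambda>ns. \<Prod>n\<leftarrow>ns. cweight n) = \<phi> d * 2 ^ d" by (simp add: \<phi>_def)
  also have "\<dots> \<le> 51 / 20 * (cbin d / (real d)\<^sup>2) * 2 ^ d"
    using \<phi>_le_main[OF d] by (intro mult_right_mono) auto
  also have "\<dots> = 51 / 20 * (cweight d / (real d)\<^sup>2)" unfolding cb[symmetric] by simp
  finally show ?thesis using tsum_split[OF d0, of "\<lambda>ns. \<Prod>n\<leftarrow>ns. cweight n"] by simp
qed

lemma coeff_linprod_top_less:
  assumes "\<And>x. x \<in> set xs \<Longrightarrow> x \<noteq> 0" "length xs = Suc n"
  shows "coeff (linprod xs) n = prod_list xs * (\<Sum>x\<leftarrow>xs. 1 / x)"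
  using assms
proof (induction xs arbitrary: n)
  case (Cons x xs)
  show ?case
  proof (cases n)
    case 0
    then show ?thesis using Cons.prems by (simp add: coeff_linprod_0)
  next
    case (Suc n')
    have "coeff (linprod (x # xs)) n = coeff (linprod xs) (length xs) + x * coeff (linprod xs) n'"
      using Cons.prems by (simp only: linprod_Cons Suc coeff_linear_mult) simp
    also have "\<dots> = prod_list xs + x * (prod_list xs * (\<Sum>x\<leftarrow>xs. 1 / x))"
      using Cons.IH[of n'] Cons.prems Suc by (simp only: coeff_linprod_top) simp
    finally show ?thesis using Cons.prems(1)[of x] by (simp add: algebra_simps)
  qed
qed simp

text \<open>The ratio is the sum of the reciprocals \<open>i / (2 * d - i)\<close> of the entries,
  which is at least \<open>(d - 1) / 4\<close>.\<close>

lemma odds_top_ratio: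
  assumes d: "4001 \<le> d"
  shows "1000 * coeff (linprod (odds d)) (d - 1) \<le> coeff (linprod (odds d)) (d - 2)"
proof -
  have top: "coeff (linprod (odds d)) (d - 1) = prod_list (odds d)"
    using coeff_linprod_top[of "odds d"] by simp
  have pos: "0 \<le> prod_list (odds d)"
    by (rule prod_list_nonneg) (use odds_ge_1 in force)
  have s: "(\<Sum>x\<leftarrow>odds d. 1 / x) = (\<Sum>i=1..<d. real i / (2 * real d - real i))"
    by (simp add: odds_def o_def sum.distinct_set_conv_list[symmetric] atLeastLessThan_upt[symmetric])
  have "1000 \<le> (real d - 1) / 4" using d by simp
  also have "\<dots> = (\<Sum>i=1..<d. real i) / (2 * real d)"
  proof -
    have "2 * (\<Sum>i=1..<d. real i) = real d * (real d - 1)"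
    proof (induction d)
      case (Suc d)
      then show ?case by (cases "d = 0") (simp_all add: algebra_simps)
    qed simp
    then show ?thesis using d by (simp add: field_simps)
  qed
  also have "\<dots> \<le> (\<Sum>x\<leftarrow>odds d. 1 / x)"
    unfolding s sum_divide_distrib by (intro sum_mono divide_left_mono) auto
  finally have "prod_list (odds d) * 1000 \<le> prod_list (odds d) * (\<Sum>x\<leftarrow>odds d. 1 / x)"
    using pos by (rule mult_left_mono)
  moreover have "coeff (linprod (odds d)) (d - 2) = prod_list (odds d) * (\<Sum>x\<leftarrow>odds d. 1 / x)"
    by (rule coeff_linprod_top_less) (use odds_ge_1 d in force)+
  ultimately show ?thesis using top by simp
qed

text \<open>The three largest entries alone give \<open>d ^ 3 / 6\<close>. The 9000 is 1000 times
  the 9 in \<open>\<alpha> 1 \<le> 9 * \<alpha> 3\<close>.\<close>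

lemma odds_coeff_3:
  assumes d: "54000 \<le> d"
  shows "9000 * (real d)\<^sup>2 \<le> coeff (linprod (odds d)) 3"
proof -
  define v where "v i = (2 * real d - real i) / real i" for i
  have "[1..<d] = [1, 2, 3] @ [4..<d]"
    using d upt_conv_Cons[of 1 d] upt_conv_Cons[of 2 d] upt_conv_Cons[of 3 d]
    by (simp add: numeral_2_eq_2[symmetric])
  then have o: "odds d = [v 1, v 2, v 3] @ map v [4..<d]"
    unfolding odds_def v_def by simp
  define A where "A = linprod [v 1, v 2, v 3]"
  define B where "B = linprod (map v [4..<d])"
  have v: "v 1 \<ge> real d" "v 2 \<ge> real d / 2" "v 3 \<ge> real d / 3" using d by (auto simp: v_def)
  have A0: "0 \<le> coeff A i" for i
    unfolding A_def by (rule coeff_linprod_nonneg) (use v d in auto)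
  have B0: "0 \<le> coeff B i" for i
    unfolding B_def by (rule coeff_linprod_nonneg) (auto simp: v_def)
  have A3: "coeff A 3 = v 1 * (v 2 * v 3)"
    using coeff_linprod_top[of "[v 1, v 2, v 3]"] by (simp add: A_def numeral_3_eq_3)
  have "9000 * (real d)\<^sup>2 \<le> real d * (real d / 2 * (real d / 3))"
  proof -
    have "(real d)\<^sup>2 * 9000 \<le> (real d)\<^sup>2 * (real d / 6)" using d by (intro mult_left_mono) auto
    then show ?thesis by (simp add: power2_eq_square mult_ac)
  qed
  also have "\<dots> \<le> v 1 * (v 2 * v 3)" using v d by (intro mult_mono) auto
  also have "\<dots> = coeff A 3 * coeff B (3 - 3)" unfolding A3 by (simp add: B_def coeff_linprod_0)
  also have "\<dots> \<le> (\<Sum>i\<le>3. coeff A i * coeff B (3 - i))"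
    using A0 B0 by (intro member_le_sum[of 3 "{..3}" "\<lambda>i. coeff A i * coeff B (3 - i)"]) auto
  also have "\<dots> = coeff (linprod (odds d)) 3" unfolding o linprod_append A_def[symmetric] B_def[symmetric] coeff_mult ..
  finally show ?thesis .
qed

text \<open>From 1/3 to 2/3 the last two terms grow by at least \<open>2 ^ (d - 2)\<close>. The
  whole value grows by much less: each linear factor at most doubles, and the last 40, whose entries
  are at most 3, gain at most 3/2.\<close>

lemma odds_truncated_sum:
  assumes d: "100 \<le> d"
  defines "q \<equiv> linprod (odds d)"
  shows "999 / 1000 * poly q (1 / 3) \<le> (\<Sum>j\<le>d - 3. coeff q j / 3 ^ j)"
proof -
  define t where "t j = coeff q j / 3 ^ j" for j
  have q0: "0 \<le> coeff q j" for j
    unfolding q_def by (rule coeff_linprod_nonneg) (use odds_ge_1 in force)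
  have t0: "0 \<le> t j" for j using q0 by (simp add: t_def)
  have deg: "degree q \<le> d - 1" using degree_linprod[of "odds d"] by (simp add: q_def)
  have ev1: "poly q (1 / 3) = (\<Sum>j\<le>d - 1. t j)"
    unfolding poly_eq_sum_atMost[OF deg] t_def by (simp add: power_divide)
  have ev2: "poly q (2 / 3) = (\<Sum>j\<le>d - 1. 2 ^ j * t j)"
    unfolding poly_eq_sum_atMost[OF deg] t_def by (simp add: power_divide mult.commute)
  have "2 ^ (d - 2) * (t (d - 2) + t (d - 1)) \<le> 2 ^ (d - 2) * t (d - 2) + 2 ^ (d - 1) * t (d - 1)"
    using t0 unfolding distrib_left by (intro add_mono mult_right_mono power_increasing) auto
  also have "\<dots> = (\<Sum>j\<in>{d - 2, d - 1}. 2 ^ j * t j)" using d by simp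
  also have "\<dots> \<le> poly q (2 / 3)" unfolding ev2 using t0 by (intro sum_mono2) auto
  also have "poly q (2 / 3) \<le> (2 ^ (d - 41) * (3 / 2) ^ 40) * poly q (1 / 3)"
  proof -
    define x where "x i = (2 * real d - real i) / real i * (1 / 3)" for i
    define c where "c i = (if i < d - 40 then 2 else 3 / 2 :: real)" for i
    have x0: "0 \<le> x i" if "i \<in> {1..<d}" for i using that by (simp add: x_def)
    have "poly q (2 / 3) = (\<Prod>i=1..<d. 1 + 2 * x i)"
      unfolding q_def poly_linprod prod_list_odds x_def by (rule prod.cong) auto
    also have "\<dots> \<le> (\<Prod>i=1..<d. c i * (1 + x i))"
    proof (rule prod_mono)
      fix i assume i: "i \<in> {1..<d}"
      have "1 + 2 * x i \<le> c i * (1 + x i)"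
      proof (cases "i < d - 40")
        case True
        then show ?thesis by (simp add: c_def)
      next
        case False
        then have "2 * real d \<le> 4 * real i" using d i by linarith
        then have "x i \<le> 1" using i by (simp add: x_def field_simps)
        then show ?thesis using False by (simp add: c_def)
      qed
      then show "0 \<le> 1 + 2 * x i \<and> 1 + 2 * x i \<le> c i * (1 + x i)" using x0[OF i] by simp
    qed
    also have "\<dots> = (\<Prod>i=1..<d. c i) * (\<Prod>i=1..<d. 1 + x i)" by (rule prod.distrib)
    also have "(\<Prod>i=1..<d. 1 + x i) = poly q (1 / 3)"
      unfolding q_def poly_linprod prod_list_odds x_def by simp
    also have "{1..<d} = {1..<d - 40} \<union> {d - 40..<d}" using d by auto
    also have "(\<Prod>i\<in>{1..<d - 40} \<union> {d - 40..<d}. c i) = (\<Prod>i\<in>{1..<d - 40}. c i) * (\<Prod>i\<in>{d - 40..<d}. c i)"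
      by (rule prod.union_disjoint) auto
    also have "(\<Prod>i\<in>{1..<d - 40}. c i) = 2 ^ (d - 41)" by (simp add: c_def)
    also have "(\<Prod>i\<in>{d - 40..<d}. c i) = (3 / 2) ^ 40" using d by (simp add: c_def)
    finally show ?thesis .
  qed
  also have "(2 :: real) ^ (d - 41) * (3 / 2) ^ 40 \<le> 2 ^ (d - 2) * (1 / 1000)"
  proof -
    have "d - 2 = (d - 41) + 39" using d by simp
    then have "(2 :: real) ^ (d - 2) = 2 ^ (d - 41) * 2 ^ 39" by (simp only: power_add)
    moreover have "(3 / 2 :: real) ^ 40 \<le> 2 ^ 39 * (1 / 1000)" by (simp add: power_divide)
    ultimately show ?thesis by simp
  qed
  finally have "2 ^ (d - 2) * (t (d - 2) + t (d - 1)) \<le> 2 ^ (d - 2) * (1 / 1000 * poly q (1 / 3))"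
    using t0 by (simp add: ev1 sum_nonneg mult_right_mono)
  then have small: "t (d - 2) + t (d - 1) \<le> 1 / 1000 * poly q (1 / 3)" by simp
  have "{..d - 1} = insert (d - 1) (insert (d - 2) {..d - 3})" using d by auto
  then have "poly q (1 / 3) = t (d - 1) + (t (d - 2) + (\<Sum>j\<le>d - 3. t j))"
    unfolding ev1 using d by (simp only:) (subst sum.insert; auto)
  then show ?thesis using small unfolding t_def by linarith
qed

text \<open>31/40 is half of 31/20: lists other than \<open>[d]\<close> have
  \<open>deg_sum ns \<le> d - 2\<close>, which loses a factor 2 against
  \<open>2 ^ (d - 1)\<close>.\<close>

lemma trest_coeff_top_le:
  assumes d: "2 ^ 72 \<le> d"
  shows "trest d (\<lambda>ns. coeff (linprod (padded d ns)) (d - 1))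
    \<le> 31 / 40 * (coeff (linprod (odds d)) (d - 1) / (real d)\<^sup>2)"
proof -
  define w where "w = cweight d / (real d)\<^sup>2"
  have dbig: "100000 \<le> d" using d by (rule order_trans[rotated]) simp
  have d0: "0 < d" using dbig by simp
  have T: "trest d (\<lambda>ns. \<Prod>n\<leftarrow>ns. cweight n) \<le> 31 / 20 * w"
    using trest_cweight_le[OF d] by (simp only: w_def)
  have "trest d (\<lambda>ns. coeff (linprod (padded d ns)) (d - 1))
      \<le> trest d (\<lambda>ns. 2 ^ (d - 2) * (\<Prod>n\<leftarrow>ns. cweight n))"
  proof (rule trest_mono)
    fix ns assume ns: "valid d ns" "ns \<noteq> [d]"
    have "deg_sum ns \<le> d - 2" using deg_sum_less[OF ns d0] by simp
    moreover have "0 \<le> (\<Prod>n\<leftarrow>ns. cweight n)"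
      by (rule prod_list_nonneg) (auto intro: less_imp_le cweight_pos)
    ultimately show "coeff (linprod (padded d ns)) (d - 1) \<le> 2 ^ (d - 2) * (\<Prod>n\<leftarrow>ns. cweight n)"
      unfolding coeff_padded_top[OF ns(1) d0] by (intro mult_right_mono power_increasing) auto
  qed
  also have "\<dots> \<le> 2 ^ (d - 2) * (31 / 20 * w)"
    unfolding trest_cmult by (rule mult_left_mono[OF T]) simp
  also have "\<dots> = 31 / 40 * (2 ^ Suc (d - 2) * w)" by simp
  also have "Suc (d - 2) = d - 1" using dbig by simp
  also have "2 ^ (d - 1) * w = coeff (linprod (odds d)) (d - 1) / (real d)\<^sup>2"
    using coeff_linprod_top[of "odds d"] prod_list_odds_eq[of d] d0 by (simp add: w_def)
  finally show ?thesis .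
qed

lemma magic_top_pos:
  assumes d: "2 ^ 72 \<le> d"
  shows "0 < magic d (d - 1)"
proof -
  have d0: "0 < d" using d by (rule less_le_trans[rotated]) simp
  define x where "x = coeff (linprod (odds d)) (d - 1) / (real d)\<^sup>2"
  have "0 < prod_list (odds d)"
    using d0 cweight_pos[of d] by (simp add: prod_list_odds_eq)
  then have x0: "0 < x" using coeff_linprod_top[of "odds d"] d0 by (simp add: x_def)
  have "- 1 * trest d (\<lambda>ns. coeff (linprod (padded d ns)) (d - 1))
      \<le> trest d (\<lambda>ns. coeff (signed_poly d ns) (d - 1))"
    unfolding trest_cmult[symmetric]
  proof (rule trest_mono)
    fix ns
    have "0 \<le> coeff (linprod (concat (map odds ns))) i" for i
      by (rule coeff_linprod_nonneg) (use odds_ge_1 in force)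
    from abs_coeff_minus_power_le[of "linprod (concat (map odds ns))" "d - 1 - deg_sum ns" "d - 1", OF this]
    show "- 1 * coeff (linprod (padded d ns)) (d - 1) \<le> coeff (signed_poly d ns) (d - 1)"
      unfolding signed_poly_def linprod_padded by linarith
  qed
  moreover have "magic d (d - 1) = x + trest d (\<lambda>ns. coeff (signed_poly d ns) (d - 1))"
    unfolding magic_def tsum_split[OF d0] x_def by (simp add: signed_poly_def deg_sum_def)
  ultimately show ?thesis using trest_coeff_top_le[OF d] x0 unfolding x_def[symmetric] by linarith
qed

lemma magic_0: "magic d 0 = 1"
proof -
  have "coeff (signed_poly d ns) 0 = 1" for ns
    by (simp add: signed_poly_def coeff_mult coeff_linprod_0 coeff_0_power)
  then show ?thesis by (simp add: magic_def tsum_one)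
qed

text \<open>The list \<open>[d]\<close> dominates: by Chebyshev's inequality with weights \<open>3\<^sup>-\<^sup>i\<close> every other list of pieces
  contributes at most its share of the value at \<open>1/3\<close>, where the factors \<open>1 + t\<close> and the pieces all
  have the growth rate \<open>4/3\<close>, and the factor \<open>1 - t\<close> in place of \<open>1 + t\<close> gains \<open>3/5\<close>. So the
  rest is about \<open>3/5 \<cdot> 31/20 < 1\<close> times the main part.\<close>

lemma magic_functional_pos:
  fixes \<alpha> :: "nat \<Rightarrow> real"
  assumes d: "2 ^ 72 \<le> d" and a0: "\<alpha> 0 = 0" "\<alpha> (d - 1) = 0" and apos: "\<And>i. 0 < i \<Longrightarrow> i < d - 1 \<Longrightarrow> 0 < \<alpha> i"
    and r: "\<And>i. 0 < i \<Longrightarrow> i < d - 1 - 1 \<Longrightarrow> \<alpha> i \<le> 4 * \<alpha> (Suc i)"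
      "\<And>i. 0 < i \<Longrightarrow> i < d - 1 - 1 \<Longrightarrow> \<alpha> (Suc i) \<le> 4 * \<alpha> i"
      "\<And>i. 0 < i \<Longrightarrow> i < d - 1 - 2 \<Longrightarrow> \<alpha> i \<le> 3 * \<alpha> (Suc i)"
  shows "0 < (\<Sum>i\<le>d - 1. magic d i * \<alpha> i)"
proof -
  define D where "D = d - 1"
  define q where "q = linprod (odds d)"
  define ev where "ev p = (\<Sum>i\<le>D. coeff p i * \<alpha> i)" for p
  define P where "P ns = linprod (padded d ns)" for ns
  define w where "w = cweight d / (real d)\<^sup>2"
  have dbig: "100000 \<le> d" using d by (rule order_trans[rotated]) simp
  have d0: "0 < d" and D2: "2 \<le> D" using dbig by (auto simp: D_def)
  have rd: "0 < real d" using d0 by simp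
  have ann: "0 \<le> \<alpha> i" if "i \<le> D" for i
    using apos[of i] a0 that by (cases "i = 0 \<or> i = D") (auto simp: D_def intro: less_imp_le)
  have q0: "0 \<le> coeff q j" for j
    unfolding q_def by (rule coeff_linprod_nonneg) (use odds_ge_1 in force)
  have P0: "0 \<le> coeff (P ns) j" for ns j
    unfolding P_def by (rule coeff_linprod_nonneg) (use padded_ge_1 in force)
  have ev_q: "coeff q i * \<alpha> i \<le> ev q" if "i \<le> D" for i
    unfolding ev_def using that q0 ann by (intro member_le_sum[of i "{..D}" "\<lambda>i. coeff q i * \<alpha> i"]) auto
  \<comment> \<open>The boundary term at the bottom lacks the weight \<open>1 / d\<^sup>2\<close>,
    because constant coefficients are all 1. It is absorbed by the coefficient of index 3, of order
    \<open>d ^ 3\<close>.\<close>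
  have e1: "\<alpha> 1 \<le> 1 / 1000 * (ev q / (real d)\<^sup>2)"
  proof -
    have "\<alpha> 1 \<le> 3 * \<alpha> 2" "\<alpha> 2 \<le> 3 * \<alpha> 3" using r(3)[of 1] r(3)[of 2] dbig by (auto simp: numeral_2_eq_2 numeral_3_eq_3)
    then have "\<alpha> 1 \<le> 9 * \<alpha> 3" by linarith
    then have "(1000 * (real d)\<^sup>2) * \<alpha> 1 \<le> (1000 * (real d)\<^sup>2) * (9 * \<alpha> 3)" by (rule mult_left_mono) simp
    also have "\<dots> = (9000 * (real d)\<^sup>2) * \<alpha> 3" by simp
    also have "\<dots> \<le> coeff q 3 * \<alpha> 3"
      using odds_coeff_3[of d] dbig ann[of 3] D2 unfolding q_def by (intro mult_right_mono) (auto simp: D_def)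
    also have "\<dots> \<le> ev q" using dbig by (intro ev_q) (simp add: D_def)
    finally show ?thesis using rd by (simp add: field_simps)
  qed
  have e2: "coeff q D * \<alpha> (D - 1) \<le> 1 / 1000 * ev q"
  proof -
    have "1000 * (coeff q D * \<alpha> (D - 1)) \<le> coeff q (D - 1) * \<alpha> (D - 1)"
      using mult_right_mono[OF odds_top_ratio[of d], of "\<alpha> (D - 1)"] dbig ann[of "D - 1"]
      by (simp add: q_def D_def mult.assoc numeral_2_eq_2)
    also have "\<dots> \<le> ev q" by (rule ev_q) simp
    finally show ?thesis by simp
  qed
  have q13: "poly q (1 / 3) = (4 / 3) ^ D * cweight d"
    unfolding q_def D_def by (rule poly_odds_third) (use d0 in simp)
  define K where "K = (4 / 3) ^ D * cweight d"
  have K: "0 < K" using cweight_pos by (simp add: K_def)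
  \<comment> \<open>The ratio bound 3 makes \<open>3 ^ i * \<alpha> i\<close> increasing only up to
    \<open>D - 2\<close>, so Chebyshev's inequality involves a truncated sum, at a loss of
    1/1000.\<close>
  define L where "L = (\<Sum>j\<le>D - 2. coeff q j / 3 ^ j)"
  have Lq: "999 / 1000 * K \<le> L"
  proof -
    have "D - 2 = d - 3" by (simp add: D_def)
    then show ?thesis using odds_truncated_sum[of d] dbig q13 unfolding L_def K_def q_def by simp
  qed
  have evq0: "0 \<le> ev q" unfolding ev_def using q0 ann by (intro sum_nonneg mult_nonneg_nonneg) auto
  have evqpos: "0 < ev q"
  proof -
    have "0 < \<alpha> 1" using apos[of 1] dbig by simp
    then have "0 < ev q / (real d)\<^sup>2" using e1 by linarith
    then show ?thesis using rd by (simp add: zero_less_divide_iff)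
  qed
  have inc: "3 ^ i * \<alpha> i \<le> 3 ^ j * \<alpha> j" if "i \<le> j" "j \<le> D - 2" for i j
    using that
  proof (induction j rule: dec_induct)
    case (step k)
    have "\<alpha> k \<le> 3 * \<alpha> (Suc k)"
      using r(3)[of k] a0(1) ann[of "Suc k"] step by (cases "k = 0") (auto simp: D_def)
    then have up: "3 ^ k * \<alpha> k \<le> 3 ^ k * (3 * \<alpha> (Suc k))" by (rule mult_left_mono) simp
    have "3 ^ i * \<alpha> i \<le> 3 ^ k * \<alpha> k" using step by simp
    also note up
    also have "3 ^ k * (3 * \<alpha> (Suc k)) = 3 ^ Suc k * \<alpha> (Suc k)" by simp
    finally show ?case .
  qed simp
  have cheb: "ev (P ns) * L \<le> (4 / 3) ^ D * (\<Prod>n\<leftarrow>ns. cweight n) * ev q" if "valid d ns" for ns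
  proof -
    have "ev (P ns) * L \<le> (\<Sum>j\<le>D - 2. coeff (P ns) j / 3 ^ j) * ev q"
      unfolding ev_def L_def P_def q_def
    proof (rule lr_chebyshev)
      show "lr (linprod (padded d ns)) (linprod (odds d))"
        using that deg_sum_le[OF that d0] by (intro lr_padded) (auto simp: valid_def)
    qed (use ann inc in auto)
    also have "(\<Sum>j\<le>D - 2. coeff (P ns) j / 3 ^ j) \<le> poly (P ns) (1 / 3)"
    proof -
      have "degree (P ns) \<le> D" using degree_linprod[of "padded d ns"] length_padded[OF that d0] by (simp add: P_def D_def)
      then have "poly (P ns) (1 / 3) = (\<Sum>j\<le>D. coeff (P ns) j / 3 ^ j)"
        by (subst poly_eq_sum_atMost) (auto simp: power_divide)
      then show ?thesis using P0 by (auto intro!: sum_mono2)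
    qed
    also have "poly (P ns) (1 / 3) = (4 / 3) ^ D * (\<Prod>n\<leftarrow>ns. cweight n)"
      unfolding P_def D_def by (rule poly_padded_third[OF that d0])
    finally show ?thesis using evq0 by (simp add: mult_right_mono)
  qed
  have T: "trest d (\<lambda>ns. \<Prod>n\<leftarrow>ns. cweight n) \<le> 31 / 20 * w"
    using trest_cweight_le[OF d] by (simp add: w_def)
  have R1: "trest d (\<lambda>ns. ev (P ns)) \<le> 31 / 20 * 1000 / 999 * (ev q / (real d)\<^sup>2)"
  proof -
    have "L * trest d (\<lambda>ns. ev (P ns)) \<le> ((4 / 3) ^ D * ev q) * trest d (\<lambda>ns. \<Prod>n\<leftarrow>ns. cweight n)"
      unfolding trest_cmult[symmetric] using cheb by (intro trest_mono) (simp add: mult_ac)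
    also have "\<dots> \<le> ((4 / 3) ^ D * ev q) * (31 / 20 * w)"
      using T evq0 by (intro mult_left_mono) auto
    also have "\<dots> = K * (31 / 20 * (ev q / (real d)\<^sup>2))" by (simp add: K_def w_def)
    finally have 1: "L * trest d (\<lambda>ns. ev (P ns)) \<le> K * (31 / 20 * (ev q / (real d)\<^sup>2))" .
    have "0 \<le> trest d (\<lambda>ns. ev (P ns))"
      unfolding trest_def ev_def using P0 ann by (intro tsum_nonneg) (auto intro!: sum_nonneg mult_nonneg_nonneg)
    then have "999 / 1000 * K * trest d (\<lambda>ns. ev (P ns)) \<le> L * trest d (\<lambda>ns. ev (P ns))"
      using Lq by (rule mult_right_mono[rotated])
    also have "999 / 1000 * K * trest d (\<lambda>ns. ev (P ns)) = K * (999 / 1000 * trest d (\<lambda>ns. ev (P ns)))"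
      by (simp only: mult_ac)
    also note 1
    finally have "K * (999 / 1000 * trest d (\<lambda>ns. ev (P ns))) \<le> K * (31 / 20 * (ev q / (real d)\<^sup>2))" .
    then have "999 / 1000 * trest d (\<lambda>ns. ev (P ns)) \<le> 31 / 20 * (ev q / (real d)\<^sup>2)"
      by (rule mult_left_le_imp_le[OF _ K])
    then show ?thesis by simp
  qed
  have R2: "trest d (\<lambda>ns. coeff (P ns) 0) \<le> 1"
  proof -
    have "trest d (\<lambda>ns. coeff (P ns) 0) \<le> tsum d (\<lambda>_. 1)"
      unfolding trest_def by (rule tsum_mono) (simp add: P_def coeff_linprod_0)
    then show ?thesis by (simp add: tsum_one)
  qed
  have R3: "trest d (\<lambda>ns. coeff (P ns) D) \<le> 31 / 40 * (coeff q D / (real d)\<^sup>2)"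
    unfolding P_def q_def D_def by (rule trest_coeff_top_le[OF d])
  have lower: "(- 1) * (3 / 5 * ev (P ns) + (2 / 5 * \<alpha> 1 * coeff (P ns) 0 + 2 / 5 * \<alpha> (D - 1) * coeff (P ns) D))
      \<le> ev (signed_poly d ns)" if ns: "valid d ns" "ns \<noteq> [d]" for ns
  proof -
    define W where "W = linprod (concat (map odds ns))"
    obtain k where k: "d - 1 - deg_sum ns = Suc k" using deg_sum_less[OF ns d0]
      by (intro that[of "d - 2 - deg_sum ns"]) simp
    have W0: "0 \<le> coeff W i" for i
      unfolding W_def by (rule coeff_linprod_nonneg) (use odds_ge_1 in force)
    have degW: "degree W \<le> deg_sum ns"
      using degree_linprod[of "concat (map odds ns)"] by (simp only: length_concat_odds W_def)
    have degc: "degree ([:1, c:] ^ k * W) < D" for c :: real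
    proof -
      have "degree ([:1, c:] ^ k * W) \<le> degree ([:1, c:] ^ k) + degree W" by (rule degree_mult_le)
      also have "degree ([:1, c:] ^ k) \<le> degree [:1, c:] * k" by (rule degree_power_le)
      also have "degree [:1, c:] * k \<le> 1 * k" by (rule mult_right_mono) auto
      finally show ?thesis using degW k by (simp add: D_def)
    qed
    have "\<bar>\<Sum>i\<le>D. coeff ([:1, -1:] ^ Suc k * W) i * \<alpha> i\<bar>
        \<le> 3 / 5 * (\<Sum>i\<le>D. coeff ([:1, 1:] ^ Suc k * W) i * \<alpha> i)
          + 2 / 5 * (coeff ([:1, 1:] ^ Suc k * W) 0 * \<alpha> 1 + coeff ([:1, 1:] ^ Suc k * W) D * \<alpha> (D - 1))"
    proof (rule minus_power_functional_le)
      show "\<alpha> D = 0" using a0 by (simp add: D_def)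
    qed (use D2 a0 ann r W0 degc in \<open>auto simp: D_def\<close>)
    moreover have "[:1, -1:] ^ Suc k * W = signed_poly d ns" by (simp only: signed_poly_def k W_def)
    moreover have "[:1, 1:] ^ Suc k * W = P ns" by (simp only: P_def linprod_padded k W_def)
    ultimately have "\<bar>ev (signed_poly d ns)\<bar>
        \<le> 3 / 5 * ev (P ns) + 2 / 5 * (coeff (P ns) 0 * \<alpha> 1 + coeff (P ns) D * \<alpha> (D - 1))"
      unfolding ev_def by simp
    then show ?thesis by (simp add: algebra_simps abs_le_iff)
  qed
  have main: "ev (signed_poly d [d]) = ev q"
    by (simp add: signed_poly_def deg_sum_def q_def)
  have "(\<Sum>i\<le>d - 1. magic d i * \<alpha> i) = tsum d (\<lambda>ns. ev (signed_poly d ns))"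
    unfolding magic_def ev_def D_def by (simp add: tsum_sum tsum_cmult mult.commute[of _ "\<alpha> _"])
  also have "\<dots> = ev q / (real d)\<^sup>2 + trest d (\<lambda>ns. ev (signed_poly d ns))"
    unfolding tsum_split[OF d0] main ..
  also have "\<dots> \<ge> ev q / (real d)\<^sup>2 + (- 1) * (3 / 5 * trest d (\<lambda>ns. ev (P ns))
      + (2 / 5 * \<alpha> 1 * trest d (\<lambda>ns. coeff (P ns) 0) + 2 / 5 * \<alpha> (D - 1) * trest d (\<lambda>ns. coeff (P ns) D)))"
    unfolding trest_cmult[symmetric] trest_add[symmetric] using lower
    by (intro add_left_mono trest_mono) blast
  finally have fin: "ev q / (real d)\<^sup>2 - (3 / 5 * trest d (\<lambda>ns. ev (P ns))
      + (2 / 5 * \<alpha> 1 * trest d (\<lambda>ns. coeff (P ns) 0) + 2 / 5 * \<alpha> (D - 1) * trest d (\<lambda>ns. coeff (P ns) D)))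
      \<le> (\<Sum>i\<le>d - 1. magic d i * \<alpha> i)" by simp
  define x where "x = ev q / (real d)\<^sup>2"
  have x0: "0 < x" using evqpos rd by (simp add: x_def)
  have "\<alpha> 1 * trest d (\<lambda>ns. coeff (P ns) 0) \<le> \<alpha> 1 * 1"
    using R2 ann[of 1] D2 by (intro mult_left_mono) auto
  then have b1: "\<alpha> 1 * trest d (\<lambda>ns. coeff (P ns) 0) \<le> 1 / 1000 * x" using e1 by (simp add: x_def)
  have "\<alpha> (D - 1) * trest d (\<lambda>ns. coeff (P ns) D) \<le> \<alpha> (D - 1) * (31 / 40 * (coeff q D / (real d)\<^sup>2))"
    using R3 ann[of "D - 1"] by (intro mult_left_mono) auto
  also have "\<dots> = 31 / 40 * (coeff q D * \<alpha> (D - 1)) / (real d)\<^sup>2" by simp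
  also have "\<dots> \<le> 31 / 40 * (1 / 1000 * ev q) / (real d)\<^sup>2"
    using e2 by (intro divide_right_mono mult_left_mono) auto
  finally have b2: "\<alpha> (D - 1) * trest d (\<lambda>ns. coeff (P ns) D) \<le> 31 / 40000 * x" by (simp add: x_def)
  \<comment> \<open>In units of \<open>x\<close>, what is subtracted is at most 3/5 * 31/20 *
    1000/999 + 2/5 * (1/1000 + 31/40000), about 0.932.\<close>
  show ?thesis using fin R1 b1 b2 x0 unfolding x_def[symmetric] by linarith
qed


section \<open>The numerator polynomial and its zeros\<close>

definition magic_poly :: "nat \<Rightarrow> real poly" where
  "magic_poly d = (\<Sum>i\<le>d - 1. smult (magic d i) (eul i (d - 1 - i)))"

lemma h_star_eq_magic_poly:
  assumes d: "0 < d"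
  shows "h_star d = magic_poly d"
proof (rule h_star_eqI)
  define F where "F i = Abs_fps (\<lambda>m. real m ^ i * (1 + real m) ^ (d - 1 - i))" for i
  have E: "ehrhart_series d (P_132_213 d) = (\<Sum>i\<le>d - 1. fps_const (magic d i) * F i)"
    by (rule fps_ext)
      (simp add: ehrhart_series_def card_lattice_points card_excursions_magic[OF d] fps_sum_nth F_def)
  have "fps_of_poly (magic_poly d) = (\<Sum>i\<le>d - 1. fps_const (magic d i) * ((1 - fps_X) ^ d * F i))"
    unfolding magic_poly_def fps_of_poly_sum fps_of_poly_smult
  proof (rule sum.cong[OF refl])
    fix i assume "i \<in> {..d - 1}"
    then have "Suc (i + (d - 1 - i)) = d" using d by simp
    then show "fps_const (magic d i) * fps_of_poly (eul i (d - 1 - i))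
        = fps_const (magic d i) * ((1 - fps_X) ^ d * F i)"
      unfolding fps_eul F_def by simp
  qed
  also have "\<dots> = ehrhart_series d (P_132_213 d) * (1 - fps_X) ^ d"
    unfolding E by (simp add: sum_distrib_left mult_ac)
  finally have "fps_of_poly (magic_poly d) = ehrhart_series d (P_132_213 d) * (1 - fps_X) ^ d" .
  moreover have "(1 - fps_X :: real fps) ^ d \<noteq> 0"
  proof -
    have "fps_nth ((1 - fps_X :: real fps) ^ d) 0 = 1" by (simp add: fps_power_zeroth)
    then show ?thesis by (metis fps_zero_nth zero_neq_one)
  qed
  ultimately show "ehrhart_series d (P_132_213 d) = fps_of_poly (magic_poly d) / (1 - fps_X) ^ d"
    by simp
qed

lemma degree_magic_poly: "degree (magic_poly d) \<le> d - 1"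
proof -
  have "degree (smult (magic d i) (eul i (d - 1 - i))) \<le> d - 1" if "i \<le> d - 1" for i
    using degree_smult_le[of "magic d i" "eul i (d - 1 - i)"] degree_eul[of i "d - 1 - i"] that by linarith
  then show ?thesis unfolding magic_poly_def by (intro degree_sum_le) auto
qed

lemma coeff_magic_poly_top: "coeff (magic_poly d) (d - 1) = magic d (d - 1)"
proof -
  have "coeff (magic_poly d) (d - 1) = (\<Sum>i\<le>d - 1. if i = d - 1 then magic d i else 0)"
    unfolding magic_poly_def coeff_sum coeff_smult
  proof (rule sum.cong[OF refl])
    fix i assume i: "i \<in> {..d - 1}"
    show "magic d i * coeff (eul i (d - 1 - i)) (d - 1) = (if i = d - 1 then magic d i else 0)"
    proof (cases "i = d - 1")
      case True
      then show ?thesis using coeff_eul_top[of "d - 1"] by (simp only: diff_self_eq_0) simp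
    next
      case False
      then have "coeff (eul i (d - 1 - i)) (d - 1) = 0" using i by (intro coeff_eul_gt) auto
      then show ?thesis using False by simp
    qed
  qed
  then show ?thesis by simp
qed

lemma poly_magic_poly_0: "poly (magic_poly d) 0 = 1"
proof -
  have "coeff (eul i (d - 1 - i)) 0 = (if i = 0 then 1 else 0)" for i
    by (cases i) (simp_all add: coeff_eul_0 eul.simps(3))
  then have "poly (magic_poly d) 0 = (\<Sum>i\<le>d - 1. if i = 0 then magic d i else 0)"
    unfolding magic_poly_def poly_0_coeff_0 coeff_sum coeff_smult by (intro sum.cong) auto
  then show ?thesis by (simp add: magic_0)
qed

text \<open>As many distinct real zeros as the degree allows leave no room for further complex
  ones.\<close>

lemma complex_roots_of_split_poly:
  fixes p :: "real poly"
  assumes S: "finite S" "\<And>x. x \<in> S \<Longrightarrow> poly p x = 0" and deg: "degree p \<le> card S" and p: "p \<noteq> 0"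
    and z: "poly (map_poly complex_of_real p) z = 0"
  shows "z \<in> complex_of_real ` S"
proof -
  let ?P = "map_poly complex_of_real p"
  have P: "?P \<noteq> 0" using p by (simp add: map_poly_eq_0_iff)
  have fin: "finite {z. poly ?P z = 0}" using poly_roots_finite[OF P] .
  have sub: "complex_of_real ` S \<subseteq> {z. poly ?P z = 0}" proof safe
    fix x assume "x \<in> S"
    have "poly ?P (of_real x) = of_real (poly p x)"
      by (induction p) (simp_all add: map_poly_pCons)
    then show "poly ?P (of_real x) = 0" using S(2)[OF \<open>x \<in> S\<close>] by simp
  qed
  have "card {z. poly ?P z = 0} \<le> degree ?P" by (rule card_poly_roots_bound[OF P])
  also have "\<dots> \<le> card (complex_of_real ` S)"
    using deg by (subst card_image) (auto simp: inj_on_def degree_map_poly)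
  finally have "complex_of_real ` S = {z. poly ?P z = 0}"
    using fin sub by (intro card_seteq) auto
  then show ?thesis using z by blast
qed

lemma magic_poly_roots:
  assumes d: "2 ^ 72 \<le> d"
  obtains S where "finite S" "card S = d - 1" "\<And>x. x \<in> S \<Longrightarrow> x < 0 \<and> poly (magic_poly d) x = 0"
proof -
  have dbig: "100000 \<le> d" using d by (rule order_trans[rotated]) simp
  define n where "n = d - 2"
  have n: "d - 1 = Suc n" using dbig by (simp add: n_def)
  obtain y where neg: "\<And>k. k < n \<Longrightarrow> y k < 0" and dec: "\<And>k. Suc k < n \<Longrightarrow> y (Suc k) < y k"
    and fac: "eul 0 (Suc n) = (\<Prod>k<n. [:-y k, 1:])" using eulerian_zeros[of n] by blast
  have sgn: "0 < (- 1) ^ Suc k * poly (magic_poly d) (y k)" if k: "k < n" for k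
  proof -
    define s :: real where "s = (- 1) ^ Suc k"
    define \<alpha> where "\<alpha> i = s * poly (eul i (d - 1 - i)) (y k)" for i
    have root: "poly (eul 0 (d - 1)) (y k) = 0"
      unfolding n fac using k by (auto simp: poly_prod intro: prod_zero)
    have s: "s = 1 \<or> s = - 1" unfolding s_def by (cases "even (Suc k)") auto
    have pos: "0 < s * poly (eul 0 (Suc (d - 1))) (y k)"
      unfolding s_def n by (rule eul_next_sign[OF neg dec fac k])
    have big: "6 \<le> d - 1" using dbig by simp
    have "0 < (\<Sum>i\<le>d - 1. magic d i * \<alpha> i)"
      by (rule magic_functional_pos[OF d]) (use eul_ratio_bounds[OF big root s pos] in \<open>auto simp: \<alpha>_def\<close>)
    also have "\<dots> = s * poly (magic_poly d) (y k)"
      unfolding magic_poly_def \<alpha>_def by (simp add: poly_sum sum_distrib_left mult_ac)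
    finally show ?thesis unfolding s_def .
  qed
  have "0 < coeff (magic_poly d) (d - 1)" unfolding coeff_magic_poly_top by (rule magic_top_pos[OF d])
  then obtain b where b: "b < y (n - 1)" "0 < (- 1) ^ (d - 1) * poly (magic_poly d) b"
    using poly_sign_at_bot[OF degree_magic_poly] by blast
  define x where "x k = (if k = 0 then 0 else if k = Suc n then b else y (k - 1))" for k
  obtain w where w: "\<And>k. k < Suc n \<Longrightarrow> x (Suc k) < w k \<and> w k < x k \<and> poly (magic_poly d) (w k) = 0"
    and inj: "inj_on w {..<Suc n}"
  proof (rule sign_changes_imp_roots[of "Suc n" x "magic_poly d"])
    fix k assume k: "k < Suc n"
    have n0: "0 < n" using dbig by (simp add: n_def)
    show "x (Suc k) < x k"
    proof (cases k)
      case 0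
      then show ?thesis using neg[of 0] n0 by (simp add: x_def)
    next
      case (Suc j)
      then show ?thesis using dec[of j] b(1) k by (auto simp: x_def)
    qed
  next
    fix k assume k: "k \<le> Suc n"
    consider "k = 0" | "k = Suc n" | j where "k = Suc j" "j < n" using k by (cases k) (auto simp: le_less)
    then show "0 < (- 1) ^ k * poly (magic_poly d) (x k)"
    proof cases
      case 1
      then show ?thesis by (simp add: x_def poly_magic_poly_0)
    next
      case 2
      then show ?thesis using b(2) unfolding n by (simp add: x_def)
    next
      case 3
      then show ?thesis using sgn[of j] by (simp add: x_def)
    qed
  qed blast
  have x_neg: "x k \<le> 0" if "k < Suc n" for k using that neg[of "k - 1"] by (auto simp: x_def intro: less_imp_le)
  show ?thesis
  proof (rule that[of "w ` {..<Suc n}"])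
    show "card (w ` {..<Suc n}) = d - 1" unfolding n using card_image[OF inj] by simp
    fix v assume "v \<in> w ` {..<Suc n}"
    then obtain k where "k < Suc n" "v = w k" by auto
    then show "v < 0 \<and> poly (magic_poly d) v = 0" using w[of k] x_neg[of k] by auto
  qed simp
qed

theorem theorem1p4:
  fixes d :: nat
  assumes "d \<ge> 2 ^ 72"
  shows "\<forall>z :: complex. poly (map_poly complex_of_real (h_star d)) z = 0 \<longrightarrow> z \<in> \<real> \<and> Re z < 0"
proof (intro allI impI)
  fix z :: complex
  assume z: "poly (map_poly complex_of_real (h_star d)) z = 0"
  have "0 < d" using assms by (rule less_le_trans[rotated]) simp
  note h = h_star_eq_magic_poly[OF this]
  obtain S where S: "finite S" "card S = d - 1" "\<And>x. x \<in> S \<Longrightarrow> x < 0 \<and> poly (magic_poly d) x = 0"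
    using magic_poly_roots[OF assms] by metis
  have "magic_poly d \<noteq> 0" using poly_magic_poly_0[of d] by auto
  then have "z \<in> complex_of_real ` S"
    using complex_roots_of_split_poly[of S "magic_poly d" z] S degree_magic_poly[of d] z h by auto
  then show "z \<in> \<real> \<and> Re z < 0" using S(3) by auto
qed

end
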